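(* Let $(X,H,\mu)$ be an abstract Wiener space. Suppose that $(S_t)_{t\ge 0}$ is a family of bounded operators from $H$ to $H$ satisfying the following four properties: 1. $S_{t+u}=S_tS_u$ for all $t,u\ge 0$. 2. $S_tS_t^*=I$ for all $t\ge0$. 3. $\langle S_tx,y\rangle_H\to 0$ as $t\to\infty$ for all $x,y\in H$. 4. $(S_t)_{t\ge 0}$ extends to a strongly continuous semigroup on the larger space $X$. Then for $\mu$-almost every $x\in X$, the set of cluster points at infinity of $t\mapsto \frac{S_tx}{\sqrt{2\log t}}$ is equal to the closed unit ball of $H$.
   Context: An abstract Wiener space $(X,H,\mu)$ consists of a separable real Banach space $X$, a centered Gaussian measure $\mu$ on $X$, and its Cameron-Martin space $H\hookrightarrow X$. Adjoints are with respect to the inner product of $H$. A strongly continuous semigroup on $X$ is a semigroup $(S_t)_{t\ge0}$ of bounded operators $X\to X$ such that $\|S_tx-x\|_X\to0$ as $t\to0$ for all $x\in X$. For a function $\gamma$ from a neighbourhood of infinity in $[0,\infty)$ to $X$, a point $x\in X$ is a cluster point at infinity of $\gamma$ if there is a sequence $t_n\uparrow\infty$ with $\|\gamma(t_n)-x\|_X\to0$. (The expression $\sqrt{2\log t}$ is considered only for $t>1$.) *)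

theory Defs
  imports "HOL-Probability.Probability"
begin

text \<open>
  The law of every continuous linear functional is a centered normal law; variance zero
  (the point mass at 0) is allowed, so the measure may be degenerate.
\<close>

locale centered_gaussian_measure = prob_space \<mu>
  for \<mu> :: "'a::{banach, second_countable_topology} measure" +
  assumes sets_eq_borel: "sets \<mu> = sets borel"
    and gaussian: "bounded_linear f \<Longrightarrow>
      distr \<mu> borel f = return borel (0::real) \<or>
      (\<exists>\<sigma>>0. distr \<mu> borel f = density lborel (normal_density 0 \<sigma>))"

text \<open>
  The closure of the dual of the Banach space in \<open>L\<^sup>2(\<mu>)\<close>, as a set of functions rather than
  of equivalence classes. For Gaussian \<open>\<mu>\<close> all the integrands below are integrable.
\<close>

definition dual_L2_closure :: "'a::{banach, second_countable_topology} measure \<Rightarrow> ('a \<Rightarrow> real) set"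
  where "dual_L2_closure \<mu> =
    {g \<in> borel_measurable \<mu>. integrable \<mu> (\<lambda>x. (g x)\<^sup>2) \<and>
      (\<exists>F :: nat \<Rightarrow> 'a \<Rightarrow> real. (\<forall>n. bounded_linear (F n)) \<and>
        (\<lambda>n. \<integral>x. (F n x - g x)\<^sup>2 \<partial>\<mu>) \<longlonglongrightarrow> 0)}"

text \<open>
  \<open>cameron_martin_rep \<mu> h g\<close> says that \<open>h = \<integral> g(x) x d\<mu>(x)\<close> as a weak (Pettis) integral, with
  \<open>g\<close> in the closure of the dual. For Gaussian \<open>\<mu>\<close>, such a \<open>g\<close> is unique up to a null set, so
  the inner product below does not depend on the choice made by \<open>SOME\<close>.
\<close>

definition cameron_martin_rep ::
    "'a::{banach, second_countable_topology} measure \<Rightarrow> 'a \<Rightarrow> ('a \<Rightarrow> real) \<Rightarrow> bool"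
  where "cameron_martin_rep \<mu> h g \<longleftrightarrow> g \<in> dual_L2_closure \<mu> \<and>
    (\<forall>f :: 'a \<Rightarrow> real. bounded_linear f \<longrightarrow> f h = (\<integral>x. f x * g x \<partial>\<mu>))"

definition cameron_martin_space :: "'a::{banach, second_countable_topology} measure \<Rightarrow> 'a set"
  where "cameron_martin_space \<mu> = {h. \<exists>g. cameron_martin_rep \<mu> h g}"

definition cameron_martin_inner ::
    "'a::{banach, second_countable_topology} measure \<Rightarrow> 'a \<Rightarrow> 'a \<Rightarrow> real"
  where "cameron_martin_inner \<mu> h k =
    (\<integral>x. (SOME g. cameron_martin_rep \<mu> h g) x * (SOME g. cameron_martin_rep \<mu> k g) x \<partial>\<mu>)"

text \<open>
  The Hilbert space \<open>H\<close> is a type \<open>'h\<close>, identified with the Cameron-Martin space of \<open>\<mu>\<close> by the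
  embedding \<open>\<iota>\<close>. Injectivity of \<open>\<iota>\<close> follows from \<open>inner_eq\<close>.
\<close>

locale abstract_wiener_space = centered_gaussian_measure \<mu>
  for \<mu> :: "'a::{banach, second_countable_topology} measure" +
  fixes \<iota> :: "'h::{real_inner, banach} \<Rightarrow> 'a"
  assumes embedding: "bounded_linear \<iota>"
    and range_eq: "range \<iota> = cameron_martin_space \<mu>"
    and inner_eq: "h \<bullet> k = cameron_martin_inner \<mu> (\<iota> h) (\<iota> k)"

text \<open>Only the operators \<open>T t\<close> with \<open>t \<ge> 0\<close> are meaningful.\<close>

definition strongly_continuous_semigroup :: "(real \<Rightarrow> 'a::banach \<Rightarrow>\<^sub>L 'a) \<Rightarrow> bool"
  where "strongly_continuous_semigroup T \<longleftrightarrow>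
    T 0 = id_blinfun \<and>
    (\<forall>t\<ge>0. \<forall>u\<ge>0. T (t + u) = T t o\<^sub>L T u) \<and>
    (\<forall>x. ((\<lambda>t. norm (T t x - x)) \<longlongrightarrow> 0) (at_right 0))"

text \<open>Here \<open>D\<close> is the domain of \<open>\<gamma>\<close>, a neighbourhood of infinity.\<close>

definition cluster_points_at_infinity ::
    "real set \<Rightarrow> (real \<Rightarrow> 'a::real_normed_vector) \<Rightarrow> 'a set"
  where "cluster_points_at_infinity D \<gamma> =
    {x. \<exists>t :: nat \<Rightarrow> real. range t \<subseteq> D \<and> incseq t \<and> filterlim t at_top sequentially \<and>
      (\<lambda>n. norm (\<gamma> (t n) - x)) \<longlonglongrightarrow> 0}"

end

theory Submission
  imports Defs "HOL-Real_Asymp.Real_Asymp"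
begin

text \<open>
  Throughout, \<open>cov f g = \<integral> f x * g x d\<mu>\<close> for continuous linear functionals \<open>f\<close>, \<open>g\<close>, and \<open>riesz f\<close> is the
  vector of \<open>H\<close> with \<open>riesz f \<bullet> k = f (\<iota> k)\<close>; one has \<open>riesz f \<bullet> riesz g = cov f g\<close>. The hypothesis
  \<open>S t (adjoint (S t) x) = x\<close> implies that \<open>T t\<close> leaves all variances \<open>cov f f\<close> unchanged. The variances
  determine the law (\<open>borel_measure_eqI_char\<close>), so every \<open>T t\<close> preserves \<open>\<mu>\<close>, and weak convergence of
  \<open>S t\<close> to zero implies that \<open>f\<close> and \<open>f \<circ> T t\<close> decorrelate. Let \<open>z t = T t x / sqrt (2 ln t)\<close>, which is
  called \<open>traj x t\<close> below. The theorem combines an upper and a lower bound.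

  Upper bound. By invariance of \<open>\<mu>\<close> and the Borel-Cantelli lemma, \<open>z t\<close> at the times \<open>t = k \<delta>\<close>
  eventually enters every closed set \<open>V\<close> for which \<open>\<mu> (- r V) \<le> exp (- a r\<^sup>2)\<close> with \<open>a > 1 / 2\<close>. Fernique's
  inequality (\<open>fernique\<close>) provides such sets from any closed convex symmetric \<open>U\<close> with
  \<open>\<mu> U \<ge> 3 / 4\<close>: one may take \<open>V = 5 U\<close>. It is used three times: for balls, where it gives the second
  moment that is needed to identify the dual with vectors of \<open>H\<close>; for the sets on which the semigroup
  moves by at most \<open>\<epsilon> / 5\<close> up to time \<open>\<delta>\<close>, which passes from discrete to continuous time
  (\<open>eventually_near_convex\<close>); and for \<open>\<epsilon>\<close>-neighbourhoods of convex hulls of finite sets, which shows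
  that \<open>z t\<close> is relatively compact (\<open>trajectories_relatively_compact\<close>). For \<open>V = {f \<le> s}\<close> the Gaussian
  tail of \<open>f\<close> is enough, and it follows that \<open>f y \<le> norm (riesz f)\<close> for every cluster point \<open>y\<close>. With
  countably many \<open>f\<close> that separate points, this places \<open>y\<close> in the unit ball of \<open>H\<close>
  (\<open>limits_in_unit_ball\<close>).

  Lower bound. Let \<open>norm (riesz f) = 1\<close>. It suffices that for every \<open>\<eta> > 0\<close> there are arbitrarily large \<open>t\<close>
  with \<open>f (z t) \<ge> 1 - \<eta>\<close>: a limit along such times lies in the unit ball and pairs with \<open>riesz f\<close> to at least one, so it is
  \<open>riesz f\<close> itself. The values of \<open>f\<close> at \<open>N\<close> well separated times are standard Gaussians with
  correlations below a fixed \<open>\<epsilon>\<close>. Since no rate of decorrelation is known, the second moment bound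
  yields a maximum of the right size only with a probability \<open>N powr (- C \<epsilon>)\<close>, up to factors
  \<open>N powr o(1)\<close>. But the maximum is so
  concentrated (\<open>max_concentration\<close>) that a probability of this size at one level forces a probability
  near one at a slightly lower level. Hence all \<open>riesz f\<close> on the unit sphere are cluster points; the
  set of cluster points is closed, so it contains the sphere, and since every vector of the ball is a
  weak limit of unit vectors \<open>h + c t *\<^sub>R adjoint (S t) k\<close>, relative compactness extends this to the ball
  (\<open>unit_ball_from_unit_sphere\<close>).
\<close>

section \<open>Norming functionals\<close>

text \<open>
  An inequality for positive scalars implies positive homogeneity.
\<close>

definition sublinear :: "('a::real_vector \<Rightarrow> real) \<Rightarrow> bool" where
  "sublinear p \<longleftrightarrow> p 0 = 0 \<and> (\<forall>x y. p (x + y) \<le> p x + p y) \<and>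
    (\<forall>c>0. \<forall>x. p (c *\<^sub>R x) \<le> c * p x)"

lemma sublinear_scaleR:
  assumes "sublinear p" "c \<ge> 0"
  shows "p (c *\<^sub>R x) = c * p x"
proof (cases "c = 0")
  case True
  then show ?thesis using assms by (simp add: sublinear_def)
next
  case False
  then have c: "c > 0" using assms by simp
  have "p (inverse c *\<^sub>R (c *\<^sub>R x)) \<le> inverse c * p (c *\<^sub>R x)"
    using assms(1) c by (metis sublinear_def positive_imp_inverse_positive)
  then have "c * p x \<le> p (c *\<^sub>R x)"
    using c by (simp add: field_simps)
  moreover have "p (c *\<^sub>R x) \<le> c * p x"
    using assms(1) c by (simp add: sublinear_def)
  ultimately show ?thesis by simp
qed

lemma sublinear_lower:
  assumes "sublinear p"
  shows "- p (- x) \<le> p x"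
proof -
  have "p (x + - x) \<le> p x + p (- x)" using assms unfolding sublinear_def by blast
  moreover have "p 0 = 0" using assms by (simp add: sublinear_def)
  ultimately show ?thesis by simp
qed

text \<open>
  The largest sublinear \<open>q \<le> p\<close> with \<open>q (- y) \<le> - p y\<close>. It drives both halves of the Hahn-Banach
  argument: a minimal sublinear functional is left unchanged by every such modification, hence is
  linear; and a linear functional below the modification of the norm at \<open>x\<close> takes the value
  \<open>norm x\<close> at \<open>x\<close>.
\<close>

definition tilt :: "('a::real_vector \<Rightarrow> real) \<Rightarrow> 'a \<Rightarrow> 'a \<Rightarrow> real" where
  "tilt p y x = (INF t\<in>{0..}. p (x + t *\<^sub>R y) - t * p y)"

lemma tilt_le:
  assumes "sublinear p" "t \<ge> 0"
  shows "tilt p y x \<le> p (x + t *\<^sub>R y) - t * p y"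
  unfolding tilt_def
proof (rule cINF_lower)
  show "bdd_below ((\<lambda>t. p (x + t *\<^sub>R y) - t * p y) ` {0..})"
  proof (rule bdd_belowI2[where m="- p (- x)"])
    fix t :: real assume "t \<in> {0..}"
    then have "t * p y = p ((x + t *\<^sub>R y) + - x)"
      using sublinear_scaleR[OF assms(1)] by simp
    also have "\<dots> \<le> p (x + t *\<^sub>R y) + p (- x)"
      using assms(1) unfolding sublinear_def by blast
    finally show "- p (- x) \<le> p (x + t *\<^sub>R y) - t * p y" by simp
  qed
qed (use assms in simp)

lemma tilt_greatest:
  assumes "\<And>t. t \<ge> 0 \<Longrightarrow> m \<le> p (x + t *\<^sub>R y) - t * p y"
  shows "m \<le> tilt p y x"
  unfolding tilt_def by (rule cINF_greatest) (use assms in auto)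

lemma sublinear_tilt:
  assumes p: "sublinear p"
  shows "sublinear (tilt p y)"
  unfolding sublinear_def
proof (intro conjI allI impI)
  have "0 \<le> tilt p y 0"
    by (rule tilt_greatest) (simp add: sublinear_scaleR[OF p])
  moreover have "tilt p y 0 \<le> 0"
    using tilt_le[OF p, of 0 y 0] p by (simp add: sublinear_def)
  ultimately show "tilt p y 0 = 0" by simp
next
  fix u v
  have *: "tilt p y (u + v) \<le> (p (u + s *\<^sub>R y) - s * p y) + (p (v + t *\<^sub>R y) - t * p y)"
    if "s \<ge> 0" "t \<ge> 0" for s t
  proof -
    have "p ((u + v) + (s + t) *\<^sub>R y) = p ((u + s *\<^sub>R y) + (v + t *\<^sub>R y))"
      by (simp add: algebra_simps)
    also have "\<dots> \<le> p (u + s *\<^sub>R y) + p (v + t *\<^sub>R y)"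
      using p unfolding sublinear_def by blast
    finally show ?thesis
      using tilt_le[OF p, of "s + t" y "u + v"] that by (simp add: algebra_simps)
  qed
  have "tilt p y (u + v) - (p (v + t *\<^sub>R y) - t * p y) \<le> tilt p y u" if "t \<ge> 0" for t
    by (rule tilt_greatest) (use *[OF _ that] in \<open>simp add: algebra_simps\<close>)
  then have "tilt p y (u + v) - tilt p y u \<le> tilt p y v"
    by (intro tilt_greatest) (simp add: algebra_simps)
  then show "tilt p y (u + v) \<le> tilt p y u + tilt p y v" by simp
next
  fix c :: real and x assume c: "c > 0"
  have "tilt p y (c *\<^sub>R x) / c \<le> tilt p y x"
  proof (rule tilt_greatest)
    fix t :: real assume t: "t \<ge> 0"
    have "p (c *\<^sub>R x + (c * t) *\<^sub>R y) = c * p (x + t *\<^sub>R y)"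
      using sublinear_scaleR[OF p, of c "x + t *\<^sub>R y"] c by (simp add: algebra_simps)
    then show "tilt p y (c *\<^sub>R x) / c \<le> p (x + t *\<^sub>R y) - t * p y"
      using tilt_le[OF p, of "c * t" y "c *\<^sub>R x"] c t by (simp add: field_simps)
  qed
  then show "tilt p y (c *\<^sub>R x) \<le> c * tilt p y x"
    using c by (simp add: field_simps)
qed

lemma tilt_self:
  assumes "sublinear p"
  shows "tilt p y x \<le> p x"
  using tilt_le[OF assms, of 0 y x] by simp

lemma sublinear_INF_chain:
  assumes p: "sublinear p" and ne: "C \<noteq> {}"
    and C: "\<And>q. q \<in> C \<Longrightarrow> sublinear q \<and> q \<le> p"
    and chain: "\<And>q r. q \<in> C \<Longrightarrow> r \<in> C \<Longrightarrow> q \<le> r \<or> r \<le> q"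
  shows "sublinear (\<lambda>x. INF q\<in>C. q x)" and "\<And>q x. q \<in> C \<Longrightarrow> (INF q\<in>C. q x) \<le> q x"
proof -
  have bdd: "bdd_below ((\<lambda>q. q x) ` C)" for x
  proof (rule bdd_belowI2[where m="- p (- x)"])
    fix q assume "q \<in> C"
    then have "- q (- x) \<le> q x" "q (- x) \<le> p (- x)"
      using C sublinear_lower by (auto simp: le_fun_def)
    then show "- p (- x) \<le> q x" by simp
  qed
  show low: "(INF q\<in>C. q x) \<le> q x" if "q \<in> C" for q x
    by (rule cINF_lower[OF bdd that])
  show "sublinear (\<lambda>x. INF q\<in>C. q x)"
    unfolding sublinear_def
  proof (intro conjI allI impI)
    have "(\<lambda>q. q 0) ` C = (\<lambda>q. 0) ` C"
      by (rule image_cong) (use C in \<open>auto simp: sublinear_def\<close>)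
    then have "(\<lambda>q. q 0) ` C = {0}" using ne by auto
    then show "(INF q\<in>C. q 0) = 0" by simp
  next
    fix x y
    have *: "(INF q\<in>C. q (x + y)) \<le> q x + r y" if qr: "q \<in> C" "r \<in> C" for q r
    proof -
      obtain w where w: "w \<in> C" "w \<le> q" "w \<le> r" using chain[OF qr] qr by blast
      have "w (x + y) \<le> w x + w y" using C w(1) unfolding sublinear_def by blast
      also have "\<dots> \<le> q x + r y" using w by (auto simp: le_fun_def intro: add_mono)
      finally show ?thesis using low[OF w(1), of "x + y"] by simp
    qed
    have "(INF q\<in>C. q (x + y)) - r y \<le> (INF q\<in>C. q x)" if "r \<in> C" for r
      by (rule cINF_greatest[OF ne]) (use *[OF _ that] in \<open>simp add: algebra_simps\<close>)
    then have "(INF q\<in>C. q (x + y)) - (INF q\<in>C. q x) \<le> (INF q\<in>C. q y)"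
      by (intro cINF_greatest[OF ne]) (simp add: algebra_simps)
    then show "(INF q\<in>C. q (x + y)) \<le> (INF q\<in>C. q x) + (INF q\<in>C. q y)" by simp
  next
    fix c :: real and x :: 'a assume c: "c > 0"
    have "(INF q\<in>C. q (c *\<^sub>R x)) / c \<le> (INF q\<in>C. q x)"
    proof (rule cINF_greatest[OF ne])
      fix q assume q: "q \<in> C"
      have "q (c *\<^sub>R x) \<le> c * q x" using C[OF q] c by (simp add: sublinear_def)
      then show "(INF q\<in>C. q (c *\<^sub>R x)) / c \<le> q x"
        using low[OF q, of "c *\<^sub>R x"] c by (simp add: field_simps)
    qed
    then show "(INF q\<in>C. q (c *\<^sub>R x)) \<le> c * (INF q\<in>C. q x)"
      using c by (simp add: field_simps)
  qed
qed

text \<open>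
  Zorn's lemma gives a minimal sublinear functional below \<open>p\<close>. As it coincides with all its
  modifications by \<^const>\<open>tilt\<close>, it is superadditive, hence linear.
\<close>

lemma sublinear_dominates_linear:
  assumes p: "sublinear p"
  shows "\<exists>f. linear f \<and> (\<forall>x. f x \<le> p x)"
proof -
  define A where "A = {q. sublinear q \<and> q \<le> p}"
  define P :: "('a \<Rightarrow> real) \<Rightarrow> ('a \<Rightarrow> real) \<Rightarrow> bool" where "P = (\<lambda>a b. b \<le> a)"
  have "\<exists>m\<in>A. \<forall>a\<in>A. P m a \<longrightarrow> a = m"
  proof (rule predicate_Zorn)
    show "partial_order_on A (relation_of P A)"
      by (rule partial_order_on_relation_ofI) (auto simp: P_def)
  next
    fix C assume "C \<in> Chains (relation_of P A)"
    then have CA: "C \<subseteq> A" and ch: "\<And>a b. a \<in> C \<Longrightarrow> b \<in> C \<Longrightarrow> a \<le> b \<or> b \<le> a"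
      by (auto simp: Chains_def relation_of_def P_def)
    show "\<exists>u\<in>A. \<forall>a\<in>C. P a u"
    proof (cases "C = {}")
      case True
      then show ?thesis using p by (auto simp: A_def)
    next
      case False
      have C: "sublinear q \<and> q \<le> p" if "q \<in> C" for q using that CA by (auto simp: A_def)
      note inf = sublinear_INF_chain[OF p False C ch]
      obtain q0 where "q0 \<in> C" using False by blast
      then have "(\<lambda>x. INF q\<in>C. q x) \<le> p"
        using inf(2) C by (fastforce simp: le_fun_def intro: order_trans)
      then have "(\<lambda>x. INF q\<in>C. q x) \<in> A" using inf(1) by (simp add: A_def)
      moreover have "\<forall>a\<in>C. P a (\<lambda>x. INF q\<in>C. q x)" using inf(2) by (auto simp: P_def le_fun_def)
      ultimately show ?thesis by blast
    qed
  qed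
  then obtain m where m: "m \<in> A" and min: "\<And>a. a \<in> A \<Longrightarrow> a \<le> m \<Longrightarrow> a = m"
    by (auto simp: P_def)
  have sm: "sublinear m" and mp: "m \<le> p" using m by (auto simp: A_def)
  have tm: "tilt m y = m" for y
  proof (rule min)
    show "tilt m y \<le> m" using tilt_self[OF sm] by (auto simp: le_fun_def)
    then show "tilt m y \<in> A" using sublinear_tilt[OF sm] mp by (auto simp: A_def)
  qed
  have add: "m (x + y) = m x + m y" for x y
  proof (rule antisym)
    show "m (x + y) \<le> m x + m y" using sm unfolding sublinear_def by blast
    show "m x + m y \<le> m (x + y)" using tilt_le[OF sm, of 1 y x] by (simp add: tm)
  qed
  have "m 0 = 0" using sm by (simp add: sublinear_def)
  then have neg: "m (- x) = - m x" for x using add[of x "- x"] by simp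
  have "m (c *\<^sub>R x) = c *\<^sub>R m x" for c x
  proof (cases "c \<ge> 0")
    case True
    then show ?thesis by (simp add: sublinear_scaleR[OF sm])
  next
    case False
    then have "m ((- c) *\<^sub>R x) = (- c) * m x" by (intro sublinear_scaleR[OF sm]) simp
    then show ?thesis using neg[of "c *\<^sub>R x"] by simp
  qed
  then have "linear m" using add by (intro linearI) auto
  then show ?thesis using mp by (auto simp: le_fun_def)
qed

lemma norming_functional_exists:
  fixes x :: "'a::real_normed_vector"
  shows "\<exists>f. bounded_linear f \<and> (\<forall>y. \<bar>f y\<bar> \<le> norm y) \<and> f x = norm x"
proof -
  have sn: "sublinear (norm :: 'a \<Rightarrow> real)"
    by (auto simp: sublinear_def norm_triangle_ineq)
  obtain f where f: "linear f" "\<And>y. f y \<le> tilt norm x y"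
    using sublinear_dominates_linear[OF sublinear_tilt[OF sn]] by blast
  have le: "f y \<le> norm y" for y using f(2) tilt_self[OF sn] order_trans by blast
  have abs: "\<bar>f y\<bar> \<le> norm y" for y
    using le[of y] le[of "- y"] linear_neg[OF f(1), of y] by simp
  have "f (- x) \<le> - norm x"
    using f(2)[of "- x"] tilt_le[OF sn, of 1 x "- x"] by simp
  then have "f x = norm x" using le[of x] linear_neg[OF f(1), of x] by simp
  moreover have "bounded_linear f"
    using f(1) abs by (intro bounded_linear_intro[where K=1])
      (auto simp: linear_add linear_scale)
  ultimately show ?thesis using abs by blast
qed

definition norming_sequence :: "(nat \<Rightarrow> 'a::real_normed_vector \<Rightarrow> real) \<Rightarrow> bool" where
  "norming_sequence F \<longleftrightarrow> (\<forall>n. bounded_linear (F n)) \<and> (\<forall>n x. \<bar>F n x\<bar> \<le> norm x) \<and>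
    (\<forall>x r. (\<forall>n. F n x \<le> r) \<longrightarrow> norm x \<le> r)"

text \<open>
  It is enough to norm the points of a dense sequence, because the functionals are uniformly
  Lipschitz.
\<close>

lemma norming_sequence_exists:
  "\<exists>F :: nat \<Rightarrow> 'a::{real_normed_vector, second_countable_topology} \<Rightarrow> real. norming_sequence F"
proof -
  obtain D :: "'a set" where D: "countable D" "\<And>X. open X \<Longrightarrow> X \<noteq> {} \<Longrightarrow> \<exists>d\<in>D. d \<in> X"
    using countable_dense_setE by blast
  have ne: "D \<noteq> {}" using D(2)[of UNIV] by auto
  define F where "F n = (SOME f. bounded_linear f \<and> (\<forall>y. \<bar>f y\<bar> \<le> norm y) \<and>
    f (from_nat_into D n) = norm (from_nat_into D n))" for n
  have F: "bounded_linear (F n) \<and> (\<forall>y. \<bar>F n y\<bar> \<le> norm y) \<and>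
    F n (from_nat_into D n) = norm (from_nat_into D n)" for n
    unfolding F_def by (rule someI_ex[OF norming_functional_exists])
  have "norm x \<le> r" if r: "\<And>n. F n x \<le> r" for x r
  proof (rule field_le_epsilon)
    fix e :: real assume e: "e > 0"
    obtain d where d: "d \<in> D" "d \<in> ball x (e / 2)" using D(2)[of "ball x (e/2)"] e by auto
    obtain n where n: "from_nat_into D n = d"
      using from_nat_into_surj[OF D(1) d(1)] by blast
    have "norm x \<le> norm d + norm (x - d)" by (metis norm_triangle_sub add.commute)
    also have "norm d = F n x - F n (x - d)"
      using F[of n] n by (simp add: linear_diff bounded_linear.linear)
    also have "\<dots> \<le> r + norm (x - d)"
      using r[of n] F[of n] by (smt (verit) abs_le_D2)
    finally show "norm x \<le> r + e" using d(2) by (simp add: dist_norm)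
  qed
  then have "norming_sequence F" using F by (auto simp: norming_sequence_def)
  then show ?thesis by blast
qed

lemma norming_sequence_separates:
  assumes "norming_sequence F" "\<And>n. F n x = F n y"
  shows "x = y"
proof -
  have "F n (x - y) = 0" for n
    using assms by (simp add: norming_sequence_def linear_diff bounded_linear.linear)
  then have "norm (x - y) \<le> 0"
    using assms(1) unfolding norming_sequence_def by (metis order_refl)
  then show ?thesis by simp
qed

section \<open>A Borel measure is determined by its characteristic functional\<close>

lemma bounded_linear_measurable:
  "bounded_linear (g :: 'a::real_normed_vector \<Rightarrow> 'b::real_normed_vector) \<Longrightarrow> g \<in> borel_measurable borel"
  by (rule borel_measurable_continuous_onI) (rule linear_continuous_on)

text \<open>
  The uniqueness theorem on the line, applied to the images under \<open>f\<close> of the measures with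
  density \<open>w\<close>, after normalisation.
\<close>

lemma weighted_char_unique:
  fixes M N :: "'a measure" and w f :: "'a \<Rightarrow> real"
  assumes M: "finite_measure M" and N: "finite_measure N" and sets: "sets N = sets M"
    and w [measurable]: "w \<in> borel_measurable M" and f [measurable]: "f \<in> borel_measurable M"
    and bnd: "\<And>x. 0 \<le> w x" "\<And>x. w x \<le> K"
    and eq: "\<And>t. (\<integral>x. w x *\<^sub>R cis (t * f x) \<partial>M) = (\<integral>x. w x *\<^sub>R cis (t * f x) \<partial>N)"
    and B: "B \<in> sets borel"
  shows "(\<integral>x. w x * indicator B (f x) \<partial>M) = (\<integral>x. w x * indicator B (f x) \<partial>N)"
proof -
  define m where "m = (\<integral>x. w x \<partial>M)"
  have meas_eq: "borel_measurable N = borel_measurable M"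
    by (rule measurable_cong_sets) (use sets in auto)
  have wN [measurable]: "w \<in> borel_measurable N" and fN [measurable]: "f \<in> borel_measurable N"
    using w f by (simp_all add: measurable_cong_sets[OF sets refl])
  have [simp]: "\<bar>w x\<bar> \<le> K" for x using bnd[of x] by simp
  have iM: "integrable M w" and iN: "integrable N w"
    by (auto intro!: finite_measure.integrable_const_bound[where B=K] M N)
  have "complex_of_real (\<integral>x. w x \<partial>M) = complex_of_real (\<integral>x. w x \<partial>N)"
    using eq[of 0] by (simp add: scaleR_conv_of_real)
  then have mN: "m = (\<integral>x. w x \<partial>N)" by (simp add: m_def)
  have m0: "m \<ge> 0" unfolding m_def by (rule integral_nonneg_AE) (simp add: bnd)
  have BI: "(\<lambda>x. indicator B x :: real) \<in> borel_measurable borel"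
    using B by (rule borel_measurable_indicator)
  show ?thesis
  proof (cases "m = 0")
    case True
    have "(\<integral>x. w x * indicator B (f x) \<partial>Q) = 0"
      if "integrable Q w" "(\<integral>x. w x \<partial>Q) = 0" for Q
    proof -
      have "AE x in Q. w x = 0"
        using that integral_nonneg_eq_0_iff_AE[of Q w] bnd by simp
      then show ?thesis by (intro integral_eq_zero_AE) auto
    qed
    then show ?thesis using iM iN True mN m_def by simp
  next
    case False
    then have mp: "m > 0" using m0 by simp
    define R where "R Q = distr (density Q (\<lambda>x. ennreal (w x / m))) borel f" for Q
    have R: "real_distribution (R Q)" "char (R Q) t = (\<integral>x. w x *\<^sub>R cis (t * f x) \<partial>Q) / m"
        "measure (R Q) B = (\<integral>x. w x * indicator B (f x) \<partial>Q) / m"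
      if [measurable]: "w \<in> borel_measurable Q" "f \<in> borel_measurable Q"
        and iQ: "integrable Q w" and mQ: "m = (\<integral>x. w x \<partial>Q)" for Q t
    proof -
      have 1: "emeasure (density Q (\<lambda>x. ennreal (w x / m))) (space Q) = 1"
      proof -
        have "emeasure (density Q (\<lambda>x. ennreal (w x / m))) (space Q)
            = (\<integral>\<^sup>+x. ennreal (w x / m) \<partial>Q)"
          by (subst emeasure_density) (auto intro!: nn_integral_cong)
        also have "\<dots> = ennreal (\<integral>x. w x / m \<partial>Q)"
          using iQ bnd m0 by (intro nn_integral_eq_integral) auto
        also have "\<dots> = 1" using mp mQ by simp
        finally show ?thesis .
      qed
      then interpret P: prob_space "density Q (\<lambda>x. ennreal (w x / m))"
        by (intro prob_spaceI) simp
      show rd: "real_distribution (R Q)"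
        unfolding R_def by (rule P.real_distribution_distr) simp
      have "char (R Q) t = (\<integral>x. iexp (t * f x) \<partial>density Q (\<lambda>x. ennreal (w x / m)))"
        unfolding char_def R_def by (subst integral_distr) auto
      also have "\<dots> = (\<integral>x. (w x / m) *\<^sub>R iexp (t * f x) \<partial>Q)"
        by (subst integral_density) (use bnd m0 in auto)
      also have "\<dots> = (\<integral>x. (w x *\<^sub>R cis (t * f x)) / complex_of_real m \<partial>Q)"
        by (intro Bochner_Integration.integral_cong refl)
          (simp add: cis_conv_exp scaleR_conv_of_real)
      finally show "char (R Q) t = (\<integral>x. w x *\<^sub>R cis (t * f x) \<partial>Q) / m" by simp
      have "measure (R Q) B = (\<integral>x. indicator B x \<partial>R Q)"
        using B by (simp add: R_def)
      also have "\<dots> = (\<integral>x. indicator B (f x) \<partial>density Q (\<lambda>x. ennreal (w x / m)))"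
        unfolding R_def by (subst integral_distr) (use BI in auto)
      also have "\<dots> = (\<integral>x. (w x / m) *\<^sub>R indicator B (f x) \<partial>Q)"
        by (subst integral_density) (use bnd m0 B in auto)
      finally show "measure (R Q) B = (\<integral>x. w x * indicator B (f x) \<partial>Q) / m" by simp
    qed
    note RM = R[OF w f iM m_def] and RN = R[OF wN fN iN mN]
    have "R M = R N"
      by (rule Levy_uniqueness[OF RM(1) RN(1)]) (simp add: fun_eq_iff RM(2) RN(2) eq)
    then show ?thesis using RM(3) RN(3) mp by simp
  qed
qed

text \<open>
  The events carrying the same characteristic functional under both measures. They are stable
  under intersection with half-spaces, hence with every member of the \<open>\<sigma>\<close>-algebra that the
  functionals generate.
\<close>

definition char_agree :: "'a::real_normed_vector measure \<Rightarrow> 'a measure \<Rightarrow> 'a set \<Rightarrow> bool" where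
  "char_agree M N C \<longleftrightarrow> C \<in> sets borel \<and> (\<forall>g. bounded_linear g \<longrightarrow>
    (\<integral>x. indicator C x *\<^sub>R cis (g x) \<partial>M) = (\<integral>x. indicator C x *\<^sub>R cis (g x) \<partial>N))"

locale two_finite_borel_measures =
  M: finite_measure M + N: finite_measure N
  for M N :: "'a::real_normed_vector measure" +
  assumes sets_M [measurable_cong]: "sets M = sets borel"
    and sets_N [measurable_cong]: "sets N = sets borel"
begin

lemma integrable_indicator_cis:
  assumes [measurable]: "C \<in> sets borel" "bounded_linear (g :: 'a \<Rightarrow> real)"
  shows "integrable M (\<lambda>x. indicator C x *\<^sub>R cis (g x + c))"
    and "integrable N (\<lambda>x. indicator C x *\<^sub>R cis (g x + c))"
proof -
  have [measurable]: "g \<in> borel_measurable borel" using assms(2) by (rule bounded_linear_measurable)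
  have [measurable]: "cis \<in> borel_measurable borel"
    by (intro borel_measurable_continuous_onI continuous_intros)
  show "integrable M (\<lambda>x. indicator C x *\<^sub>R cis (g x + c))"
    by (rule M.integrable_const_bound[where B=1]) (auto simp: indicator_def)
  show "integrable N (\<lambda>x. indicator C x *\<^sub>R cis (g x + c))"
    by (rule N.integrable_const_bound[where B=1]) (auto simp: indicator_def)
qed

lemma char_agree_shift:
  assumes "char_agree M N C" "bounded_linear g"
  shows "(\<integral>x. indicator C x *\<^sub>R cis (g x + c) \<partial>M) = (\<integral>x. indicator C x *\<^sub>R cis (g x + c) \<partial>N)"
proof -
  have shift: "indicator C x *\<^sub>R cis (g x + c) = cis c * (indicator C x *\<^sub>R cis (g x))" for x
    by (simp add: cis_mult add.commute)
  show ?thesis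
    unfolding shift integral_mult_right_zero using assms by (simp add: char_agree_def)
qed

text \<open>
  Multiplying by the nonnegative weight \<open>1 + cos (g + c)\<close> turns an identity between complex
  integrals into one between positive measures.
\<close>

lemma char_agree_Int_halfspace:
  fixes f :: "'a \<Rightarrow> real"
  assumes C: "char_agree M N C" and f: "bounded_linear f" and B: "B \<in> sets borel"
  shows "char_agree M N (C \<inter> f -` B)"
proof -
  define E where "E = C \<inter> f -` B"
  have [measurable]: "C \<in> sets borel" using C by (simp add: char_agree_def)
  have fm [measurable]: "f \<in> borel_measurable borel" using f by (rule bounded_linear_measurable)
  have CB [measurable]: "E \<in> sets borel"
    using measurable_sets[OF fm B] by (auto simp: E_def space_borel)
  have key: "(\<integral>x. indicator E x * (1 + cos (g x + c)) \<partial>M)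
      = (\<integral>x. indicator E x * (1 + cos (g x + c)) \<partial>N)"
    if g: "bounded_linear g" for g :: "'a \<Rightarrow> real" and c
  proof -
    have [measurable]: "g \<in> borel_measurable borel" using g by (rule bounded_linear_measurable)
    have [measurable]: "(cos :: real \<Rightarrow> real) \<in> borel_measurable borel"
      by (intro borel_measurable_continuous_onI continuous_intros)
    define w where "w x = indicator C x * (1 + cos (g x + c))" for x
    have [measurable]: "w \<in> borel_measurable borel" unfolding w_def by measurable
    have w: "0 \<le> w x" "w x \<le> 2" for x
    proof -
      have "-1 \<le> cos (g x + c)" "cos (g x + c) \<le> 1" by (rule cos_ge_minus_one cos_le_one)+
      then show "0 \<le> w x" "w x \<le> 2" unfolding w_def indicator_def by (simp; linarith)+
    qed
    have lin: "bounded_linear (\<lambda>x. t * f x)" "bounded_linear (\<lambda>x. t * f x + g x)"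
        "bounded_linear (\<lambda>x. t * f x - g x)" for t
      using f g by (auto intro: bounded_linear_add bounded_linear_sub
          bounded_linear_compose[OF bounded_linear_mult_right])
    have exp: "w x *\<^sub>R cis (t * f x) = indicator C x *\<^sub>R cis (t * f x + 0)
        + (1/2) *\<^sub>R (indicator C x *\<^sub>R cis ((t * f x + g x) + c))
        + (1/2) *\<^sub>R (indicator C x *\<^sub>R cis ((t * f x - g x) + (- c)))" for x t
      by (simp add: w_def indicator_def complex_eq_iff cos_add sin_add cos_diff sin_diff
          algebra_simps)
    have E: "(\<integral>x. w x *\<^sub>R cis (t * f x) \<partial>M) = (\<integral>x. w x *\<^sub>R cis (t * f x) \<partial>N)" for t
    proof -
      have comb: "(\<integral>x. a x + (1/2) *\<^sub>R b x + (1/2) *\<^sub>R d x \<partial>Q)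
          = (\<integral>x. a x \<partial>Q) + (1/2) *\<^sub>R (\<integral>x. b x \<partial>Q) + (1/2) *\<^sub>R (\<integral>x. d x \<partial>Q)"
        if "integrable Q a" "integrable Q b" "integrable Q d" for Q and a b d :: "'a \<Rightarrow> complex"
        using that by simp
      note I = integrable_indicator_cis[OF \<open>C \<in> sets borel\<close>]
      show ?thesis
        unfolding exp comb[OF I(1)[OF lin(1)] I(1)[OF lin(2)] I(1)[OF lin(3)]]
          comb[OF I(2)[OF lin(1)] I(2)[OF lin(2)] I(2)[OF lin(3)]]
        by (simp only: char_agree_shift[OF C lin(1)] char_agree_shift[OF C lin(2)]
            char_agree_shift[OF C lin(3)])
    qed
    have "(\<integral>x. w x * indicator B (f x) \<partial>M) = (\<integral>x. w x * indicator B (f x) \<partial>N)"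
      by (rule weighted_char_unique[where K=2, OF M.finite_measure_axioms N.finite_measure_axioms
            _ _ _ w E B]) (auto simp: sets_M sets_N)
    moreover have "w x * indicator B (f x) = indicator E x * (1 + cos (g x + c))" for x
      by (simp add: w_def E_def indicator_def)
    ultimately show ?thesis by simp
  qed
  have int: "integrable M (\<lambda>x. indicator E x * cos (g x + c))"
    "integrable N (\<lambda>x. indicator E x * cos (g x + c))"
    if g: "bounded_linear g" for g :: "'a \<Rightarrow> real" and c
    using integrable_Re[OF integrable_indicator_cis(1)[OF CB g, of c]]
      integrable_Re[OF integrable_indicator_cis(2)[OF CB g, of c]] by simp_all
  have int1: "integrable M (\<lambda>x. indicator E x * 1 :: real)"
    "integrable N (\<lambda>x. indicator E x * 1 :: real)"
    using int[OF bounded_linear_zero, of 0] by simp_all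
  have cos: "(\<integral>x. indicator E x * cos (g x + c) \<partial>M)
      = (\<integral>x. indicator E x * cos (g x + c) \<partial>N)"
    if g: "bounded_linear g" for g :: "'a \<Rightarrow> real" and c
  proof -
    have "(\<integral>x. indicator E x \<partial>M) + (\<integral>x. indicator E x * cos (g x + d) \<partial>M)
      = (\<integral>x. indicator E x \<partial>N) + (\<integral>x. indicator E x * cos (g x + d) \<partial>N)" for d
      using key[OF g, of d] int[OF g, of d] int1 by (simp add: distrib_left)
    from this[of c] this[of "c + pi"] show ?thesis
      by (simp add: add.assoc[symmetric])
  qed
  show ?thesis
    unfolding E_def[symmetric] char_agree_def
  proof (intro conjI allI impI CB)
    fix g :: "'a \<Rightarrow> real" assume g: "bounded_linear g"
    note I = integrable_indicator_cis[OF CB g, of 0]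
    show "(\<integral>x. indicator E x *\<^sub>R cis (g x) \<partial>M)
        = (\<integral>x. indicator E x *\<^sub>R cis (g x) \<partial>N)"
    proof (rule complex_eqI)
      show "Re (\<integral>x. indicator E x *\<^sub>R cis (g x) \<partial>M)
          = Re (\<integral>x. indicator E x *\<^sub>R cis (g x) \<partial>N)"
        using cos[OF g, of 0] I by (simp flip: integral_Re)
      show "Im (\<integral>x. indicator E x *\<^sub>R cis (g x) \<partial>M)
          = Im (\<integral>x. indicator E x *\<^sub>R cis (g x) \<partial>N)"
        using cos[OF g, of "- (pi / 2)"] I by (simp add: cos_diff flip: integral_Im)
    qed
  qed
qed

lemma char_agree_Diff:
  assumes "char_agree M N C" "char_agree M N D" "D \<subseteq> C"
  shows "char_agree M N (C - D)"
proof -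
  have CD: "C \<in> sets borel" "D \<in> sets borel" using assms by (auto simp: char_agree_def)
  have "indicator (C - D) x *\<^sub>R cis (g x) = indicator C x *\<^sub>R cis (g x + 0) - indicator D x *\<^sub>R cis (g x + 0)"
    for x and g :: "'a \<Rightarrow> real"
    using assms(3) by (auto simp: indicator_def)
  then show ?thesis
    using assms CD integrable_indicator_cis[OF CD(1), of _ 0] integrable_indicator_cis[OF CD(2), of _ 0]
    by (simp add: char_agree_def)
qed

lemma char_agree_INT:
  assumes C: "\<And>n. char_agree M N (C n)" and dec: "decseq C"
  shows "char_agree M N (\<Inter>n. C n)"
  unfolding char_agree_def
proof (intro conjI allI impI)
  have Cb [measurable]: "C n \<in> sets borel" for n using C by (simp add: char_agree_def)
  show "(\<Inter>n. C n) \<in> sets borel" by measurable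
  fix g :: "'a \<Rightarrow> real" assume g: "bounded_linear g"
  have [measurable]: "g \<in> borel_measurable borel" using g by (rule bounded_linear_measurable)
  have [measurable]: "cis \<in> borel_measurable borel"
    by (intro borel_measurable_continuous_onI continuous_intros)
  have lim: "(\<lambda>n. \<integral>x. indicator (C n) x *\<^sub>R cis (g x) \<partial>Q)
      \<longlonglongrightarrow> (\<integral>x. indicator (\<Inter>n. C n) x *\<^sub>R cis (g x) \<partial>Q)"
    if "finite_measure Q" and [measurable_cong]: "sets Q = sets borel" for Q
  proof (rule integral_dominated_convergence[where w="\<lambda>_. 1"])
    show "integrable Q (\<lambda>_. 1::real)" using that(1) by (simp add: finite_measure.integrable_const)
    show "AE x in Q. (\<lambda>n. indicator (C n) x *\<^sub>R cis (g x)) \<longlonglongrightarrow> indicator (\<Inter>n. C n) x *\<^sub>R cis (g x)"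
      by (intro AE_I2 tendsto_scaleR LIMSEQ_indicator_decseq dec tendsto_const)
  qed (auto simp: indicator_def)
  have "(\<lambda>n. \<integral>x. indicator (C n) x *\<^sub>R cis (g x) \<partial>M)
      = (\<lambda>n. \<integral>x. indicator (C n) x *\<^sub>R cis (g x) \<partial>N)"
    using C g by (simp add: char_agree_def)
  then show "(\<integral>x. indicator (\<Inter>n. C n) x *\<^sub>R cis (g x) \<partial>M)
      = (\<integral>x. indicator (\<Inter>n. C n) x *\<^sub>R cis (g x) \<partial>N)"
    using lim[OF N.finite_measure_axioms sets_N]
    by (intro LIMSEQ_unique[OF lim[OF M.finite_measure_axioms sets_M]]) simp
qed

lemma char_agree_Int_sigma:
  assumes D: "D \<in> sigma_sets UNIV {f -` B | f B. bounded_linear f \<and> B \<in> sets (borel :: real measure)}"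
    and C: "char_agree M N C"
  shows "char_agree M N (C \<inter> D)"
  using D C
proof (induction arbitrary: C)
  case (Basic a)
  then show ?case using char_agree_Int_halfspace by auto
next
  case Empty
  then show ?case by (simp add: char_agree_def)
next
  case (Compl a)
  have "C \<inter> (UNIV - a) = C - (C \<inter> a)" by auto
  then show ?case using char_agree_Diff[OF Compl.prems Compl.IH[OF Compl.prems]] by simp
next
  case (Union a)
  define E where "E n = C \<inter> (\<Inter>i<n. - a i)" for n :: nat
  have E: "char_agree M N (E n)" for n
  proof (induction n)
    case 0
    then show ?case using Union.prems by (simp add: E_def)
  next
    case (Suc n)
    have "E (Suc n) = E n - (E n \<inter> a n)" by (auto simp: E_def less_Suc_eq)
    then show ?case using char_agree_Diff[OF Suc Union.IH[OF Suc]] by simp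
  qed
  have "decseq E" unfolding decseq_def E_def by force
  then have "char_agree M N (\<Inter>n. E n)" by (rule char_agree_INT[OF E])
  moreover have "C \<inter> \<Union> (range a) = C - (\<Inter>n. E n)" by (auto simp: E_def)
  moreover have "(\<Inter>n. E n) \<subseteq> C" by (auto simp: E_def)
  ultimately show ?case using char_agree_Diff[OF Union.prems] by simp
qed

end

text \<open>
  A norming sequence turns every closed ball into a countable intersection of half-spaces.
\<close>

lemma borel_sets_generated_by_functionals:
  assumes X: "X \<in> sets (borel :: 'a::{real_normed_vector, second_countable_topology} measure)"
  shows "X \<in> sigma_sets UNIV {f -` B | f B. bounded_linear f \<and> B \<in> sets (borel :: real measure)}"
    (is "_ \<in> sigma_sets _ ?G")
proof -
  interpret sigma_algebra "UNIV :: 'a set" "sigma_sets UNIV ?G"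
    by (rule sigma_algebra_sigma_sets) simp
  obtain F :: "nat \<Rightarrow> 'a \<Rightarrow> real" where F: "norming_sequence F" using norming_sequence_exists by blast
  have cb: "cball a r \<in> sigma_sets UNIV ?G" for a :: 'a and r
  proof -
    have "cball a r = (\<Inter>n. F n -` {..r + F n a})"
    proof (intro set_eqI iffI)
      fix x assume x: "x \<in> cball a r"
      have "F n x \<le> r + F n a" for n
      proof -
        have "F n x - F n a = F n (x - a)"
          using F by (simp add: norming_sequence_def linear_diff bounded_linear.linear)
        also have "\<dots> \<le> norm (x - a)"
          using F unfolding norming_sequence_def by (metis abs_le_D1)
        finally show ?thesis using x by (simp add: dist_norm norm_minus_commute)
      qed
      then show "x \<in> (\<Inter>n. F n -` {..r + F n a})" by auto
    next
      fix x assume "x \<in> (\<Inter>n. F n -` {..r + F n a})"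
      then have "F n (x - a) \<le> r" for n
        using F by (simp add: norming_sequence_def linear_diff bounded_linear.linear algebra_simps)
      then have "norm (x - a) \<le> r" using F unfolding norming_sequence_def by blast
      then show "x \<in> cball a r" by (simp add: dist_norm norm_minus_commute)
    qed
    moreover have "F n -` {..r + F n a} \<in> sigma_sets UNIV ?G" for n
    proof (rule sigma_sets.Basic)
      have "bounded_linear (F n)" "{..r + F n a} \<in> sets borel"
        using F by (auto simp: norming_sequence_def)
      then show "F n -` {..r + F n a} \<in> ?G" by blast
    qed
    ultimately show ?thesis by auto
  qed
  have op: "U \<in> sigma_sets UNIV ?G" if U: "open U" for U :: "'a set"
  proof -
    obtain D :: "'a set" where D: "countable D" "\<And>X. open X \<Longrightarrow> X \<noteq> {} \<Longrightarrow> \<exists>d\<in>D. d \<in> X"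
      using countable_dense_setE by blast
    define I where "I = {p \<in> D \<times> \<rat>. cball (fst p) (snd p) \<subseteq> U}"
    have "countable I" unfolding I_def using D(1) countable_rat by (auto intro: countable_subset)
    have "U = (\<Union>p\<in>I. cball (fst p) (snd p))"
    proof (intro set_eqI iffI)
      fix x assume "x \<in> U"
      then obtain e where e: "e > 0" "ball x e \<subseteq> U" using U openE by blast
      obtain q where q: "q \<in> \<rat>" "0 < q" "q < e / 2"
        using Rats_dense_in_real[of 0 "e/2"] e(1) by auto
      obtain d where d: "d \<in> D" "d \<in> ball x q" using D(2)[of "ball x q"] q by auto
      have "cball d q \<subseteq> ball x e"
      proof
        fix y assume "y \<in> cball d q"
        then have "dist x y \<le> dist x d + q" using dist_triangle[of x y d] by simp
        then show "y \<in> ball x e" using d(2) q by simp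
      qed
      then have "(d, q) \<in> I" using d(1) q(1) e(2) by (auto simp: I_def)
      moreover have "x \<in> cball d q" using d(2) by (simp add: dist_commute)
      ultimately show "x \<in> (\<Union>p\<in>I. cball (fst p) (snd p))" by force
    qed (auto simp: I_def)
    also have "\<dots> \<in> sigma_sets UNIV ?G"
      by (rule countable_UN'[OF \<open>countable I\<close>]) (use cb in auto)
    finally show ?thesis .
  qed
  have "sigma_sets UNIV {U. open U} \<subseteq> sigma_sets UNIV ?G"
    by (rule sigma_sets_subset) (use op in auto)
  then show ?thesis using X by (auto simp: borel_def)
qed

theorem borel_measure_eqI_char:
  fixes M N :: "'a::{real_normed_vector, second_countable_topology} measure"
  assumes "finite_measure M" "finite_measure N" "sets M = sets borel" "sets N = sets borel"
    and eq: "\<And>g. bounded_linear g \<Longrightarrow> (\<integral>x. cis (g x) \<partial>M) = (\<integral>x. cis (g x) \<partial>N)"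
  shows "M = N"
proof (rule measure_eqI)
  interpret two_finite_borel_measures M N
    using assms by (simp add: two_finite_borel_measures_def two_finite_borel_measures_axioms_def)
  show "sets M = sets N" using assms by simp
  fix X assume "X \<in> sets M"
  then have X: "X \<in> sets borel" using assms by simp
  have "char_agree M N UNIV" using eq by (simp add: char_agree_def)
  then have "char_agree M N X"
    using char_agree_Int_sigma[OF borel_sets_generated_by_functionals[OF X]] by force
  then have "(\<integral>x. indicator X x *\<^sub>R cis 0 \<partial>M) = (\<integral>x. indicator X x *\<^sub>R cis 0 \<partial>N)"
    using bounded_linear_zero unfolding char_agree_def by blast
  then have "complex_of_real (\<integral>x. indicator X x \<partial>M) = complex_of_real (\<integral>x. indicator X x \<partial>N)"
    by (simp add: scaleR_conv_of_real)
  then have "measure M X = measure N X" using X by (simp add: sets_M sets_N)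
  then show "emeasure M X = emeasure N X"
    by (simp add: M.emeasure_eq_measure N.emeasure_eq_measure)
qed

section \<open>Gaussian functionals\<close>

lemma normal_density_exp_moment:
  assumes "\<sigma> > 0"
  shows "has_bochner_integral lborel (\<lambda>x. normal_density 0 \<sigma> x * exp (l * x)) (exp (l\<^sup>2 * \<sigma>\<^sup>2 / 2))"
proof -
  have "- x\<^sup>2 / (2 * \<sigma>\<^sup>2) + l * x = l\<^sup>2 * \<sigma>\<^sup>2 / 2 + - (x - l * \<sigma>\<^sup>2)\<^sup>2 / (2 * \<sigma>\<^sup>2)" for x
    using assms by (simp add: field_simps power2_eq_square)
  then have "normal_density 0 \<sigma> x * exp (l * x)
      = exp (l\<^sup>2 * \<sigma>\<^sup>2 / 2) * normal_density (l * \<sigma>\<^sup>2) \<sigma> x" for x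
    by (simp add: normal_density_def flip: exp_add)
  then show ?thesis using assms by (simp add: has_bochner_integral_iff)
qed

lemma normal_density_char:
  assumes "\<sigma> > 0"
  shows "(\<integral>x. normal_density 0 \<sigma> x *\<^sub>R cis x \<partial>lborel) = exp (- (\<sigma>\<^sup>2 / 2))"
proof -
  have "\<sigma> * normal_density 0 \<sigma> (\<sigma> * y) = std_normal_density y" for y
    using assms by (simp add: normal_density_def power_mult_distrib real_sqrt_mult)
  then have "(\<integral>x. normal_density 0 \<sigma> x *\<^sub>R cis x \<partial>lborel)
      = (\<integral>y. std_normal_density y *\<^sub>R cis (\<sigma> * y) \<partial>lborel)"
    using lborel_integral_real_affine[of \<sigma> "\<lambda>x. normal_density 0 \<sigma> x *\<^sub>R cis x" 0] assms
    by (simp flip: integral_scaleR_right)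
  also have "\<dots> = char std_normal_distribution \<sigma>"
    unfolding char_def by (subst integral_density) (auto simp: cis_conv_exp)
  also have "\<dots> = exp (- (\<sigma>\<^sup>2 / 2))" by (simp add: char_std_normal_distribution)
  finally show ?thesis .
qed

lemma integrable_mult_of_squares:
  fixes f g :: "'a \<Rightarrow> real"
  assumes [measurable]: "f \<in> borel_measurable M" "g \<in> borel_measurable M"
    and "integrable M (\<lambda>x. (f x)\<^sup>2)" "integrable M (\<lambda>x. (g x)\<^sup>2)"
  shows "integrable M (\<lambda>x. f x * g x)"
proof (rule Bochner_Integration.integrable_bound)
  show "integrable M (\<lambda>x. (f x)\<^sup>2 + (g x)\<^sup>2)" using assms by simp
  have "\<bar>a * b\<bar> \<le> a\<^sup>2 + b\<^sup>2" for a b :: real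
  proof -
    have "2 * (\<bar>a\<bar> * \<bar>b\<bar>) \<le> a\<^sup>2 + b\<^sup>2"
      using sum_squares_bound[of "\<bar>a\<bar>" "\<bar>b\<bar>"] by (simp add: power2_eq_square mult.assoc)
    moreover have "0 \<le> \<bar>a\<bar> * \<bar>b\<bar>" by simp
    ultimately show ?thesis unfolding abs_mult by linarith
  qed
  then show "AE x in M. norm (f x * g x) \<le> norm ((f x)\<^sup>2 + (g x)\<^sup>2)" by simp
qed measurable

context centered_gaussian_measure
begin

lemma sets_mu_borel [measurable_cong]: "sets \<mu> = sets borel"
  by (rule sets_eq_borel)

lemma space_mu [simp]: "space \<mu> = UNIV"
  using sets_eq_imp_space_eq[OF sets_eq_borel] by simp

lemma bl_measurable:
  "bounded_linear (f :: 'a \<Rightarrow> 'b::real_normed_vector) \<Longrightarrow> f \<in> borel_measurable \<mu>"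
  using bounded_linear_measurable by (simp add: measurable_cong_sets[OF sets_eq_borel refl])

lemma gaussian_law:
  fixes f :: "'a \<Rightarrow> real"
  assumes f: "bounded_linear f"
  shows "\<exists>\<sigma>\<ge>0. integrable \<mu> (\<lambda>x. (f x)\<^sup>2) \<and> (\<integral>x. (f x)\<^sup>2 \<partial>\<mu>) = \<sigma>\<^sup>2
    \<and> (\<forall>l. has_bochner_integral \<mu> (\<lambda>x. exp (l * f x)) (exp (l\<^sup>2 * \<sigma>\<^sup>2 / 2)))
    \<and> (\<integral>x. cis (f x) \<partial>\<mu>) = exp (- (\<sigma>\<^sup>2 / 2))
    \<and> (\<sigma> > 0 \<longrightarrow> distr \<mu> borel f = density lborel (normal_density 0 \<sigma>))"
proof -
  have fm [measurable]: "f \<in> borel_measurable \<mu>" using f by (rule bl_measurable)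
  have [measurable]: "cis \<in> borel_measurable borel"
    by (intro borel_measurable_continuous_onI continuous_intros)
  from gaussian[OF f] show ?thesis
  proof (elim disjE exE conjE)
    assume *: "distr \<mu> borel f = return borel 0"
    have "AE y in distr \<mu> borel f. y = 0"
      unfolding * by (simp add: AE_return)
    then have AE: "AE x in \<mu>. f x = 0" by (simp add: AE_distr_iff)
    have eq: "has_bochner_integral \<mu> (\<lambda>x. h (f x)) (h 0)"
      if [measurable]: "h \<in> borel_measurable borel"
      for h :: "real \<Rightarrow> 'c::{banach, second_countable_topology}"
    proof -
      have "has_bochner_integral \<mu> (\<lambda>x. h 0) (h 0)"
        using prob_space by (simp add: has_bochner_integral_iff)
      moreover have "AE x in \<mu>. h (f x) = h 0" using AE by auto
      ultimately show ?thesis by (subst has_bochner_integral_cong_AE[where g="\<lambda>x. h 0"]) auto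
    qed
    have "has_bochner_integral \<mu> (\<lambda>x. (f x)\<^sup>2) 0" using eq[of "\<lambda>y. y\<^sup>2"] by simp
    moreover have "has_bochner_integral \<mu> (\<lambda>x. exp (l * f x)) 1" for l
      using eq[of "\<lambda>y. exp (l * y)"] by simp
    moreover have "has_bochner_integral \<mu> (\<lambda>x. cis (f x)) 1" using eq[of cis] by simp
    ultimately show ?thesis by (intro exI[of _ 0]) (simp add: has_bochner_integral_iff)
  next
    fix \<sigma> :: real assume \<sigma>: "\<sigma> > 0" and *: "distr \<mu> borel f = density lborel (normal_density 0 \<sigma>)"
    have eq: "has_bochner_integral \<mu> (\<lambda>x. h (f x)) v
        \<longleftrightarrow> has_bochner_integral lborel (\<lambda>y. normal_density 0 \<sigma> y *\<^sub>R h y) v"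
      if [measurable]: "h \<in> borel_measurable borel"
      for h :: "real \<Rightarrow> 'c::{banach, second_countable_topology}" and v
    proof -
      have "has_bochner_integral \<mu> (\<lambda>x. h (f x)) v \<longleftrightarrow> has_bochner_integral (distr \<mu> borel f) h v"
        by (simp add: has_bochner_integral_iff integrable_distr_eq integral_distr)
      also have "\<dots> \<longleftrightarrow> has_bochner_integral lborel (\<lambda>y. normal_density 0 \<sigma> y *\<^sub>R h y) v"
        unfolding * by (simp add: has_bochner_integral_iff integrable_density integral_density)
      finally show ?thesis .
    qed
    have "has_bochner_integral lborel (\<lambda>y. normal_density 0 \<sigma> y * y\<^sup>2) (\<sigma>\<^sup>2)"
      using normal_moment_even[OF \<sigma>, of 0 1] \<sigma> by (simp add: fact_numeral)
    then have "has_bochner_integral \<mu> (\<lambda>x. (f x)\<^sup>2) (\<sigma>\<^sup>2)" by (subst eq) auto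
    moreover have "has_bochner_integral \<mu> (\<lambda>x. exp (l * f x)) (exp (l\<^sup>2 * \<sigma>\<^sup>2 / 2))" for l
      using normal_density_exp_moment[OF \<sigma>, of l] by (subst eq) auto
    moreover have "(\<integral>x. cis (f x) \<partial>\<mu>) = exp (- (\<sigma>\<^sup>2 / 2))"
    proof -
      have "integrable \<mu> (\<lambda>x. cis (f x))" by (rule integrable_const_bound[where B=1]) auto
      then have "has_bochner_integral \<mu> (\<lambda>x. cis (f x)) (\<integral>x. cis (f x) \<partial>\<mu>)"
        by (rule has_bochner_integral_integrable)
      then have "has_bochner_integral lborel (\<lambda>y. normal_density 0 \<sigma> y *\<^sub>R cis y) (\<integral>x. cis (f x) \<partial>\<mu>)"
        by (subst (asm) eq) auto
      then show ?thesis using normal_density_char[OF \<sigma>] by (simp add: has_bochner_integral_iff)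
    qed
    ultimately show ?thesis using \<sigma> * by (intro exI[of _ \<sigma>]) (simp add: has_bochner_integral_iff)
  qed
qed

definition cov :: "('a \<Rightarrow> real) \<Rightarrow> ('a \<Rightarrow> real) \<Rightarrow> real" where
  "cov f g = (\<integral>x. f x * g x \<partial>\<mu>)"

lemma integrable_square: "bounded_linear (f :: 'a \<Rightarrow> real) \<Longrightarrow> integrable \<mu> (\<lambda>x. (f x)\<^sup>2)"
  using gaussian_law by blast

lemma integrable_product:
  "bounded_linear (f :: 'a \<Rightarrow> real) \<Longrightarrow> bounded_linear (g :: 'a \<Rightarrow> real) \<Longrightarrow> integrable \<mu> (\<lambda>x. f x * g x)"
  by (intro integrable_mult_of_squares bl_measurable integrable_square)

lemma cov_square: "cov f f = (\<integral>x. (f x)\<^sup>2 \<partial>\<mu>)"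
  by (simp add: cov_def power2_eq_square)

lemma cov_nonneg: "0 \<le> cov f f"
  unfolding cov_square by simp

lemma cov_lincomb:
  fixes f g :: "'a \<Rightarrow> real"
  assumes "bounded_linear f" "bounded_linear g"
  shows "cov (\<lambda>x. a * f x + b * g x) (\<lambda>x. a * f x + b * g x)
    = a\<^sup>2 * cov f f + 2 * a * b * cov f g + b\<^sup>2 * cov g g"
proof -
  have "(a * f x + b * g x) * (a * f x + b * g x)
      = a\<^sup>2 * (f x * f x) + 2 * a * b * (f x * g x) + b\<^sup>2 * (g x * g x)" for x
    by (simp add: algebra_simps power2_eq_square)
  then show ?thesis
    using integrable_product assms by (simp add: cov_def)
qed

lemma bounded_linear_lincomb:
  fixes f g :: "'a \<Rightarrow> real"
  assumes "bounded_linear f" "bounded_linear g"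
  shows "bounded_linear (\<lambda>x. a * f x + b * g x)"
  using assms by (auto intro: bounded_linear_add bounded_linear_compose[OF bounded_linear_mult_right])

lemma char_functional:
  fixes f :: "'a \<Rightarrow> real"
  assumes "bounded_linear f"
  shows "(\<integral>x. cis (f x) \<partial>\<mu>) = exp (- (cov f f / 2))"
  using gaussian_law[OF assms] by (auto simp: cov_square)

lemma tail_le:
  fixes f :: "'a \<Rightarrow> real"
  assumes f: "bounded_linear f" and v: "cov f f \<le> v" "v > 0" and r: "r \<ge> 0"
  shows "prob {x. r \<le> f x} \<le> exp (- (r\<^sup>2 / (2 * v)))"
proof -
  have [measurable]: "f \<in> borel_measurable \<mu>" using f by (rule bl_measurable)
  define l where "l = r / v"
  obtain \<sigma> where \<sigma>: "cov f f = \<sigma>\<^sup>2"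
    "has_bochner_integral \<mu> (\<lambda>x. exp (l * f x)) (exp (l\<^sup>2 * \<sigma>\<^sup>2 / 2))"
    using gaussian_law[OF f] by (auto simp: cov_square)
  have I: "integrable \<mu> (\<lambda>x. exp (- l * r) * exp (l * f x))"
    using \<sigma>(2) by (simp add: has_bochner_integral_iff)
  have "prob {x. r \<le> f x} = (\<integral>x. indicator {x. r \<le> f x} x \<partial>\<mu>)" by simp
  also have "\<dots> \<le> (\<integral>x. exp (- l * r) * exp (l * f x) \<partial>\<mu>)"
  proof (rule integral_mono[OF _ I])
    show "integrable \<mu> (\<lambda>x. indicat_real {x. r \<le> f x} x)"
      by (rule integrable_real_indicator) (auto simp: less_top[symmetric])
    have "l * r \<le> l * y" if "r \<le> y" for y
      unfolding l_def by (rule mult_left_mono) (use that r v in auto)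
    then show "indicat_real {x. r \<le> f x} x \<le> exp (- l * r) * exp (l * f x)" for x
      by (auto simp: indicator_def simp flip: exp_add)
  qed
  also have "\<dots> = exp (l\<^sup>2 * \<sigma>\<^sup>2 / 2 - l * r)"
  proof -
    have "(\<integral>x. exp (- l * r) * exp (l * f x) \<partial>\<mu>) = exp (- l * r) * exp (l\<^sup>2 * \<sigma>\<^sup>2 / 2)"
      using \<sigma>(2) by (simp add: has_bochner_integral_iff)
    also have "\<dots> = exp (l\<^sup>2 * \<sigma>\<^sup>2 / 2 - l * r)" by (simp flip: exp_add)
    finally show ?thesis .
  qed
  also have "\<dots> \<le> exp (l\<^sup>2 * v / 2 - l * r)"
    using v \<sigma>(1) by (auto intro!: mult_left_mono divide_right_mono)
  also have "l\<^sup>2 * v / 2 - l * r = - (r\<^sup>2 / (2 * v))"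
    using v by (simp add: l_def field_simps power2_eq_square)
  finally show ?thesis .
qed

lemma tail_ge:
  fixes f :: "'a \<Rightarrow> real"
  assumes f: "bounded_linear f" and v: "cov f f = 1" and u: "u \<ge> 0"
  shows "std_normal_density (u + 1) \<le> prob {x. u \<le> f x}"
proof -
  have [measurable]: "f \<in> borel_measurable \<mu>" using f by (rule bl_measurable)
  obtain \<sigma> where "\<sigma> \<ge> 0" "\<sigma>\<^sup>2 = 1"
      "\<sigma> > 0 \<longrightarrow> distr \<mu> borel f = density lborel (normal_density 0 \<sigma>)"
    using gaussian_law[OF f] v by (auto simp: cov_square)
  then have D: "distr \<mu> borel f = density lborel std_normal_density"
    by (metis abs_of_nonneg real_sqrt_abs real_sqrt_one zero_less_one)
  have "std_normal_density (u + 1) = (\<integral>y. std_normal_density (u + 1) * indicator {u..u + 1} y \<partial>lborel)"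
    by simp
  also have "\<dots> \<le> (\<integral>y. std_normal_density y * indicator {u..} y \<partial>lborel)"
  proof (rule integral_mono)
    show "integrable lborel (\<lambda>y. std_normal_density y * indicat_real {u..} y)"
      using integrable_mult_indicator[OF _ integrable_normal_density[of 1 0], of "{u..}"]
      by (simp add: mult.commute)
    fix y
    have "y\<^sup>2 \<le> (u + 1)\<^sup>2" if "u \<le> y" "y \<le> u + 1"
      using that u by (intro power_mono) auto
    then show "std_normal_density (u + 1) * indicat_real {u..u + 1} y
        \<le> std_normal_density y * indicat_real {u..} y"
      by (auto simp: indicator_def normal_density_def intro!: divide_right_mono)
  qed simp
  also have "\<dots> = (\<integral>y. indicator {u..} y \<partial>distr \<mu> borel f)"
    unfolding D by (subst integral_density) auto
  also have "\<dots> = measure (distr \<mu> borel f) {u..}" by simp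
  also have "\<dots> = prob {x. u \<le> f x}"
    by (subst measure_distr) (auto simp: vimage_def)
  finally show ?thesis .
qed

text \<open>The law is determined by the variances of the functionals.\<close>

lemma distr_invariant:
  assumes A: "bounded_linear A"
    and inv: "\<And>f :: 'a \<Rightarrow> real. bounded_linear f \<Longrightarrow> cov (\<lambda>x. f (A x)) (\<lambda>x. f (A x)) = cov f f"
  shows "distr \<mu> borel A = \<mu>"
proof (rule borel_measure_eqI_char)
  have Am [measurable]: "A \<in> borel_measurable \<mu>" using A by (rule bl_measurable)
  have [measurable]: "cis \<in> borel_measurable borel"
    by (intro borel_measurable_continuous_onI continuous_intros)
  show "finite_measure (distr \<mu> borel A)" by (rule finite_measure_distr) (rule Am)
  fix g :: "'a \<Rightarrow> real" assume g: "bounded_linear g"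
  have [measurable]: "g \<in> borel_measurable borel" using g by (rule bounded_linear_measurable)
  have "(\<integral>x. cis (g x) \<partial>distr \<mu> borel A) = (\<integral>x. cis (g (A x)) \<partial>\<mu>)"
    by (subst integral_distr) auto
  also have "\<dots> = (\<integral>x. cis (g x) \<partial>\<mu>)"
    using char_functional[OF g] char_functional[OF bounded_linear_compose[OF g A]] inv[OF g] by simp
  finally show "(\<integral>x. cis (g x) \<partial>distr \<mu> borel A) = (\<integral>x. cis (g x) \<partial>\<mu>)" .
qed (auto simp: sets_eq_borel finite_measure_axioms)

section \<open>Rotation invariance and Fernique's inequality\<close>

definition rotate :: "real \<Rightarrow> real \<Rightarrow> 'a \<times> 'a \<Rightarrow> 'a \<times> 'a" where
  "rotate a b = (\<lambda>(x, y). (a *\<^sub>R x + b *\<^sub>R y, - b *\<^sub>R x + a *\<^sub>R y))"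

lemma sets_pair_borel: "sets (\<mu> \<Otimes>\<^sub>M \<mu>) = sets (borel :: ('a \<times> 'a) measure)"
  using sets_pair_measure_cong[OF sets_eq_borel sets_eq_borel] by (simp only: borel_prod)

lemma continuous_rotate: "continuous_on UNIV (rotate a b)"
  unfolding rotate_def case_prod_unfold by (intro continuous_intros)

sublocale pair: pair_prob_space \<mu> \<mu> ..

text \<open>
  A rotation preserves the sum of the variances of the two components of a functional on the
  product, on which alone its characteristic functional depends.
\<close>

lemma distr_rotate:
  assumes ab: "a\<^sup>2 + b\<^sup>2 = 1"
  shows "distr (\<mu> \<Otimes>\<^sub>M \<mu>) borel (rotate a b) = \<mu> \<Otimes>\<^sub>M \<mu>"
proof (rule borel_measure_eqI_char)
  have Rm: "rotate a b \<in> borel_measurable borel"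
    by (rule borel_measurable_continuous_onI) (rule continuous_rotate)
  then have Rm' [measurable]: "rotate a b \<in> borel_measurable (\<mu> \<Otimes>\<^sub>M \<mu>)"
    by (simp add: measurable_cong_sets[OF sets_pair_borel refl])
  have cm [measurable]: "cis \<in> borel_measurable borel"
    by (intro borel_measurable_continuous_onI continuous_intros)
  show "finite_measure (distr (\<mu> \<Otimes>\<^sub>M \<mu>) borel (rotate a b))"
    by (rule pair.finite_measure_distr) (rule Rm')
  show "finite_measure (\<mu> \<Otimes>\<^sub>M \<mu>)" by (rule pair.finite_measure_axioms)
  show "sets (\<mu> \<Otimes>\<^sub>M \<mu>) = sets borel" by (rule sets_pair_borel)
  fix g :: "'a \<times> 'a \<Rightarrow> real" assume g: "bounded_linear g"
  define g1 where "g1 x = g (x, 0)" for x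
  define g2 where "g2 y = g (0, y)" for y
  have g1: "bounded_linear g1" and g2: "bounded_linear g2"
    unfolding g1_def g2_def
    using bounded_linear_compose[OF g bounded_linear_Pair[OF bounded_linear_ident bounded_linear_zero]]
      bounded_linear_compose[OF g bounded_linear_Pair[OF bounded_linear_zero bounded_linear_ident]]
    by simp_all
  have split: "g (x, y) = g1 x + g2 y" for x y
    using linear_add[OF bounded_linear.linear[OF g], of "(x, 0)" "(0, y)"]
    by (simp add: g1_def g2_def)
  have prod: "(\<integral>p. cis (h (fst p) + k (snd p)) \<partial>(\<mu> \<Otimes>\<^sub>M \<mu>)) = exp (- ((cov h h + cov k k) / 2))"
    if h: "bounded_linear h" and k: "bounded_linear k" for h k :: "'a \<Rightarrow> real"
  proof -
    have [measurable]: "h \<in> borel_measurable \<mu>" "k \<in> borel_measurable \<mu>"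
      using h k by (auto intro: bl_measurable)
    have "(\<integral>p. cis (h (fst p) + k (snd p)) \<partial>(\<mu> \<Otimes>\<^sub>M \<mu>))
        = (\<integral>x. \<integral>y. cis (h (fst (x, y)) + k (snd (x, y))) \<partial>\<mu> \<partial>\<mu>)"
      by (rule pair.integral_fst'[symmetric]) (rule pair.integrable_const_bound[where B=1], auto)
    also have "\<dots> = (\<integral>x. cis (h x) * (\<integral>y. cis (k y) \<partial>\<mu>) \<partial>\<mu>)"
      by (simp flip: cis_mult)
    also have "\<dots> = (\<integral>x. cis (h x) \<partial>\<mu>) * (\<integral>y. cis (k y) \<partial>\<mu>)" by simp
    also have "\<dots> = exp (- ((cov h h + cov k k) / 2))"
      by (simp add: char_functional[OF h] char_functional[OF k] add_divide_distrib
          flip: exp_add of_real_mult)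
    finally show ?thesis .
  qed
  define h where "h x = a * g1 x + (- b) * g2 x" for x
  define k where "k x = b * g1 x + a * g2 x" for x
  have hk: "bounded_linear h" "bounded_linear k"
    unfolding h_def[abs_def] k_def[abs_def] by (rule bounded_linear_lincomb[OF g1 g2])+
  have "cov h h + cov k k = (a\<^sup>2 + b\<^sup>2) * (cov g1 g1 + cov g2 g2)"
    unfolding h_def[abs_def] k_def[abs_def] cov_lincomb[OF g1 g2] by (simp add: algebra_simps)
  then have var: "cov h h + cov k k = cov g1 g1 + cov g2 g2" using ab by simp
  have rot: "g (rotate a b p) = h (fst p) + k (snd p)" for p
    using linear_add[OF bounded_linear.linear[OF g1]] linear_scale[OF bounded_linear.linear[OF g1]]
      linear_add[OF bounded_linear.linear[OF g2]] linear_scale[OF bounded_linear.linear[OF g2]]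
      linear_diff[OF bounded_linear.linear[OF g2]]
    by (cases p) (simp add: rotate_def split h_def k_def)
  have "(\<integral>p. cis (g p) \<partial>distr (\<mu> \<Otimes>\<^sub>M \<mu>) borel (rotate a b)) = (\<integral>p. cis (g (rotate a b p)) \<partial>(\<mu> \<Otimes>\<^sub>M \<mu>))"
    by (rule integral_distr[OF Rm'])
      (rule measurable_compose[OF bounded_linear_measurable[OF g] cm])
  also have "\<dots> = (\<integral>p. cis (g1 (fst p) + g2 (snd p)) \<partial>(\<mu> \<Otimes>\<^sub>M \<mu>))"
    unfolding rot by (simp only: prod[OF hk] prod[OF g1 g2] var)
  also have "\<dots> = (\<integral>p. cis (g p) \<partial>(\<mu> \<Otimes>\<^sub>M \<mu>))"
    by (intro Bochner_Integration.integral_cong refl) (metis split prod.collapse)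
  finally show "(\<integral>p. cis (g p) \<partial>distr (\<mu> \<Otimes>\<^sub>M \<mu>) borel (rotate a b)) = (\<integral>p. cis (g p) \<partial>(\<mu> \<Otimes>\<^sub>M \<mu>))" .
qed simp

lemma prob_rotate:
  assumes "a\<^sup>2 + b\<^sup>2 = 1" and A: "A \<in> sets borel"
  shows "pair.prob {p. rotate a b p \<in> A} = pair.prob A"
proof -
  have "rotate a b \<in> borel_measurable borel"
    by (rule borel_measurable_continuous_onI) (rule continuous_rotate)
  then have Rm: "rotate a b \<in> borel_measurable (\<mu> \<Otimes>\<^sub>M \<mu>)"
    by (simp add: measurable_cong_sets[OF sets_pair_borel refl])
  have "pair.prob A = measure (distr (\<mu> \<Otimes>\<^sub>M \<mu>) borel (rotate a b)) A"
    by (simp only: distr_rotate[OF assms(1)])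
  also have "\<dots> = pair.prob {p. rotate a b p \<in> A}"
    by (subst measure_distr[OF Rm A]) (simp add: vimage_def space_pair_measure)
  finally show ?thesis by simp
qed

lemma prob_Times:
  assumes "A \<in> sets borel" "B \<in> sets borel"
  shows "pair.prob (A \<times> B) = prob A * prob B"
  using assms emeasure_pair_measure_Times[of A \<mu> B]
  by (simp add: sets_eq_borel measure_def enn2real_mult)

lemma convex_scale_add:
  fixes U :: "'a set"
  assumes U: "convex U" and a: "a \<ge> 0" "b \<ge> 0"
    and x: "x \<in> (*\<^sub>R) a ` U" and y: "y \<in> (*\<^sub>R) b ` U"
  shows "x + y \<in> (*\<^sub>R) (a + b) ` U"
proof -
  obtain u v where u: "u \<in> U" "x = a *\<^sub>R u" and v: "v \<in> U" "y = b *\<^sub>R v" using x y by blast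
  show ?thesis
  proof (cases "a + b = 0")
    case True
    then have "a = 0" "b = 0" using a by auto
    then show ?thesis using u v by (auto intro: image_eqI[of _ _ u])
  next
    case False
    then have p: "a + b > 0" using a by simp
    have "(a / (a + b)) *\<^sub>R u + (b / (a + b)) *\<^sub>R v \<in> U"
      using U u(1) v(1) a p by (intro convexD) (auto simp flip: add_divide_distrib)
    moreover have "x + y = (a + b) *\<^sub>R ((a / (a + b)) *\<^sub>R u + (b / (a + b)) *\<^sub>R v)"
      using p u v by (simp add: scaleR_add_right)
    ultimately show ?thesis by blast
  qed
qed

text \<open>
  If \<open>(y - x) / sqrt 2\<close> lies in \<open>s U\<close> while \<open>(x + y) / sqrt 2\<close> avoids \<open>t U\<close>, then both \<open>x\<close> and
  \<open>y\<close> avoid \<open>a U\<close>. By rotation invariance the two vectors in the hypothesis are as independent as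
  \<open>x\<close> and \<open>y\<close>, so the probabilities multiply on both sides.
\<close>

lemma fernique_step:
  assumes U: "closed U" "convex U" "\<And>x. x \<in> U \<Longrightarrow> - x \<in> U"
    and s: "s \<ge> 0" and a: "a \<ge> 0" and t: "t = sqrt 2 * a + s"
  shows "prob ((*\<^sub>R) s ` U) * prob (- (*\<^sub>R) t ` U) \<le> (prob (- (*\<^sub>R) a ` U))\<^sup>2"
proof -
  define c where "c = 1 / sqrt 2"
  have c: "c\<^sup>2 + c\<^sup>2 = 1" "sqrt 2 * c = 1" "c = sqrt 2 / 2"
    by (simp_all add: c_def power_divide real_div_sqrt)
  have cl: "(*\<^sub>R) r ` U \<in> sets borel" for r using closed_scaling[OF U(1)] by simp
  have clc: "- (*\<^sub>R) r ` U \<in> sets borel" for r using cl by (simp add: borel_comp)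
  have TS: "(- (*\<^sub>R) t ` U) \<times> (*\<^sub>R) s ` U \<in> sets borel"
    by (metis borel_Times cl clc)
  have TA: "(- (*\<^sub>R) a ` U) \<times> (- (*\<^sub>R) a ` U) \<in> sets (\<mu> \<Otimes>\<^sub>M \<mu>)"
    using clc by (auto simp: sets_eq_borel)
  have sub: "{p. rotate c c p \<in> (- (*\<^sub>R) t ` U) \<times> (*\<^sub>R) s ` U}
      \<subseteq> (- (*\<^sub>R) a ` U) \<times> (- (*\<^sub>R) a ` U)"
  proof (clarsimp simp: rotate_def)
    fix x y u
    assume nt: "c *\<^sub>R x + c *\<^sub>R y \<notin> (*\<^sub>R) t ` U" and u: "u \<in> U"
      and d: "c *\<^sub>R y - c *\<^sub>R x = s *\<^sub>R u"
    have scale: "sqrt 2 *\<^sub>R z \<in> (*\<^sub>R) (sqrt 2 * a) ` U" if "z \<in> (*\<^sub>R) a ` U" for z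
      using that by auto
    have "sqrt 2 *\<^sub>R z = c *\<^sub>R z + c *\<^sub>R z" for z :: 'a
      by (simp add: c(3) flip: scaleR_add_left)
    then have x: "c *\<^sub>R x + c *\<^sub>R y = sqrt 2 *\<^sub>R x + s *\<^sub>R u"
      and y: "c *\<^sub>R x + c *\<^sub>R y = sqrt 2 *\<^sub>R y + s *\<^sub>R (- u)"
      by (simp_all flip: d)
    have su: "s *\<^sub>R u \<in> (*\<^sub>R) s ` U" "s *\<^sub>R (- u) \<in> (*\<^sub>R) s ` U" using u U(3) by blast+
    have pos: "0 \<le> sqrt 2 * a" using a by simp
    show "x \<notin> (*\<^sub>R) a ` U \<and> y \<notin> (*\<^sub>R) a ` U"
      using nt convex_scale_add[OF U(2) pos s scale su(1)] convex_scale_add[OF U(2) pos s scale su(2)]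
      by (metis x y t)
  qed
  have "prob ((*\<^sub>R) s ` U) * prob (- (*\<^sub>R) t ` U)
      = pair.prob ((- (*\<^sub>R) t ` U) \<times> (*\<^sub>R) s ` U)"
    by (simp add: prob_Times cl clc mult.commute)
  also have "\<dots> = pair.prob {p. rotate c c p \<in> (- (*\<^sub>R) t ` U) \<times> (*\<^sub>R) s ` U}"
    by (rule prob_rotate[OF c(1) TS, symmetric])
  also have "\<dots> \<le> pair.prob ((- (*\<^sub>R) a ` U) \<times> (- (*\<^sub>R) a ` U))"
    by (rule pair.finite_measure_mono[OF sub TA])
  also have "\<dots> = (prob (- (*\<^sub>R) a ` U))\<^sup>2"
    by (simp add: prob_Times clc power2_eq_square)
  finally show ?thesis .
qed

text \<open>
  The radii \<open>t (n + 1) = sqrt 2 * t n + 1\<close> grow like \<open>sqrt 2 ^ n\<close>, while the tails are essentially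
  squared in each step.
\<close>

lemma fernique:
  assumes U: "closed U" "convex U" "\<And>x. x \<in> U \<Longrightarrow> - x \<in> U"
    and p: "prob U \<ge> 3 / 4" and r: "r \<ge> 1"
  shows "prob (- (*\<^sub>R) r ` U) \<le> exp (- (r\<^sup>2 / 24))"
proof -
  define t :: "nat \<Rightarrow> real" where "t n = (2 + sqrt 2) * sqrt 2 ^ n - (sqrt 2 + 1)" for n
  have t0: "t 0 = 1" and tS: "t (Suc n) = sqrt 2 * t n + 1" for n
    by (simp_all add: t_def algebra_simps)
  have tpos: "t n \<ge> 1" for n
  proof (induction n)
    case (Suc n)
    then have "0 \<le> sqrt 2 * t n" by simp
    then show ?case by (simp add: tS)
  qed (simp add: t0)
  have cl: "(*\<^sub>R) r ` U \<in> sets borel" for r using closed_scaling[OF U(1)] by simp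
  have compl: "prob (- (*\<^sub>R) r ` U) = 1 - prob ((*\<^sub>R) r ` U)" for r
    using prob_compl[of "(*\<^sub>R) r ` U"] cl by (simp add: sets_eq_borel Compl_eq_Diff_UNIV)
  have one: "(*\<^sub>R) 1 ` U = U" by simp
  have bound: "prob (- (*\<^sub>R) (t n) ` U) \<le> 3 / 4 * (1 / 3) ^ (2 ^ n)" for n
  proof (induction n)
    case 0
    then show ?case using p compl[of 1] unfolding one t0 by simp
  next
    case (Suc n)
    have "3 / 4 * prob (- (*\<^sub>R) (t (Suc n)) ` U) \<le> prob ((*\<^sub>R) 1 ` U) * prob (- (*\<^sub>R) (t (Suc n)) ` U)"
      using p unfolding one by (intro mult_right_mono) auto
    also have "\<dots> \<le> (prob (- (*\<^sub>R) (t n) ` U))\<^sup>2"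
      by (rule fernique_step[OF U]) (use tpos[of n] in \<open>auto simp: tS\<close>)
    also have "\<dots> \<le> (3 / 4 * (1 / 3) ^ (2 ^ n))\<^sup>2"
      by (rule power_mono[OF Suc]) simp
    also have "\<dots> = 3 / 4 * (3 / 4 * (1 / 3) ^ (2 ^ Suc n))"
      by (simp add: power_mult_distrib power2_eq_square flip: power_add mult_2)
    finally show ?case by simp
  qed
  have "t n \<ge> real n" for n
  proof (induction n)
    case (Suc n)
    have "1 * t n \<le> sqrt 2 * t n" using tpos[of n] by (intro mult_right_mono) auto
    then show ?case using Suc by (simp add: tS)
  qed (simp add: t0)
  then obtain m where "t m > r" using reals_Archimedean2[of r] by (meson less_le_trans)
  then obtain n where n: "t n \<le> r" "r < t (Suc n)"
    using ex_least_nat_less[of "\<lambda>m. r < t m" m] r t0 by (auto simp: not_less)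
  have mono: "(*\<^sub>R) (t n) ` U \<subseteq> (*\<^sub>R) r ` U"
  proof
    fix x assume x: "x \<in> (*\<^sub>R) (t n) ` U"
    then obtain u where "u \<in> U" by auto
    then have "(1/2) *\<^sub>R u + (1/2) *\<^sub>R (- u) \<in> U" using U(2,3) by (intro convexD) auto
    then have "0 \<in> U" by simp
    then have "0 \<in> (*\<^sub>R) (r - t n) ` U" by force
    then show "x \<in> (*\<^sub>R) r ` U"
      using convex_scale_add[OF U(2) _ _ x, of "r - t n" 0] n(1) tpos[of n] by simp
  qed
  \<comment> \<open>The constant \<open>24\<close> in the exponent is an upper bound for \<open>2 (2 + sqrt 2)\<^sup>2\<close>.\<close>
  have "0 \<le> sqrt 2" by simp
  then have "r \<le> (2 + sqrt 2) * sqrt 2 ^ Suc n"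
    using n(2) unfolding t_def by linarith
  then have "r\<^sup>2 \<le> ((2 + sqrt 2) * sqrt 2 ^ Suc n)\<^sup>2"
    using r by (intro power_mono) auto
  also have "\<dots> = (2 + sqrt 2)\<^sup>2 * (2 * 2 ^ n)"
  proof -
    have "(sqrt 2 ^ Suc n)\<^sup>2 = (2 :: real) ^ Suc n"
      by (metis power_mult mult.commute real_sqrt_pow2 zero_le_numeral)
    then show ?thesis by (simp only: power_mult_distrib power_Suc)
  qed
  also have "\<dots> \<le> 12 * (2 * 2 ^ n)"
  proof (rule mult_right_mono)
    have "sqrt 2 \<le> 3 / 2" by (rule real_le_lsqrt) (auto simp: power2_eq_square)
    then show "(2 + sqrt 2)\<^sup>2 \<le> 12" by (simp add: power2_sum)
  qed simp
  finally have r2: "r\<^sup>2 / 24 \<le> 2 ^ n" by simp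
  have "prob (- (*\<^sub>R) r ` U) \<le> prob (- (*\<^sub>R) (t n) ` U)"
    by (rule finite_measure_mono) (use mono cl in \<open>auto simp: sets_eq_borel borel_comp\<close>)
  also have "\<dots> \<le> 3 / 4 * (1 / 3) ^ (2 ^ n)" by (rule bound)
  also have "\<dots> \<le> (1 / 3) ^ (2 ^ n)" by simp
  also have "\<dots> \<le> exp (-1) ^ (2 ^ n)"
    using exp_le by (intro power_mono) (auto simp: exp_minus field_simps)
  also have "\<dots> = exp (- (2 ^ n))" by (simp flip: exp_of_nat_mult)
  also have "\<dots> \<le> exp (- (r\<^sup>2 / 24))" using r2 by simp
  finally show ?thesis .
qed

definition exp_tail :: "'a set \<Rightarrow> real \<Rightarrow> bool" where
  "exp_tail V a \<longleftrightarrow> (\<forall>r\<ge>1. prob (- (*\<^sub>R) r ` V) \<le> exp (- (a * r\<^sup>2)))"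

text \<open>
  The factor \<open>5\<close> turns the constant \<open>1 / 24\<close> in Fernique's inequality into \<open>25 / 24\<close>, beyond the
  threshold \<open>1 / 2\<close> that the Borel-Cantelli lemma needs.
\<close>

lemma fernique_exp_tail:
  assumes U: "closed U" "convex U" "\<And>x. x \<in> U \<Longrightarrow> - x \<in> U" and p: "prob U \<ge> 3 / 4"
  shows "exp_tail ((*\<^sub>R) 5 ` U) (25 / 24)"
  unfolding exp_tail_def
proof (intro allI impI)
  fix r :: real assume r: "r \<ge> 1"
  have "(*\<^sub>R) r ` (*\<^sub>R) 5 ` U = (*\<^sub>R) (5 * r) ` U" by (simp add: image_image mult.commute)
  then show "prob (- (*\<^sub>R) r ` (*\<^sub>R) 5 ` U) \<le> exp (- (25 / 24 * r\<^sup>2))"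
    using fernique[OF U p, of "5 * r"] r by (simp add: power_mult_distrib)
qed

lemma exists_heavy_incseq:
  assumes "incseq A" "\<And>n. A n \<in> sets borel" "(\<Union>n. A n) = UNIV" "q < 1"
  shows "\<exists>n. prob (A n) \<ge> q"
proof -
  have "(\<lambda>n. prob (A n)) \<longlonglongrightarrow> prob (\<Union>n. A n)"
    by (rule finite_Lim_measure_incseq) (use assms in \<open>auto simp: sets_eq_borel\<close>)
  then have "(\<lambda>n. prob (A n)) \<longlonglongrightarrow> 1" using assms(3) prob_space by simp
  then have "eventually (\<lambda>n. q < prob (A n)) sequentially"
    using assms(4) by (rule order_tendstoD)
  then show ?thesis using eventually_happens by (fastforce intro: less_imp_le)
qed

text \<open>
  Fernique's inequality for a ball of probability at least \<open>3 / 4\<close> makes the tail of the norm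
  decay faster than every power.
\<close>

lemma integrable_norm_square: "integrable \<mu> (\<lambda>x. (norm x)\<^sup>2)"
proof -
  have [measurable]: "(norm :: 'a \<Rightarrow> real) \<in> borel_measurable \<mu>" by measurable
  have "(\<Union>n. cball 0 (real n)) = (UNIV :: 'a set)" by (auto simp: real_arch_simple)
  then obtain s :: nat where s: "prob (cball 0 (real s)) \<ge> 3 / 4"
  proof -
    have "incseq (\<lambda>n. cball (0 :: 'a) (real n))" by (auto simp: incseq_def)
    then show ?thesis
      using exists_heavy_incseq[of "\<lambda>n. cball 0 (real n)" "3/4"] that
        \<open>(\<Union>n. cball 0 (real n)) = UNIV\<close> by auto
  qed
  define S where "S = real s + 1"
  have S: "S > 0" by (simp add: S_def)
  have pS: "prob (cball 0 S) \<ge> 3 / 4"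
  proof -
    have "prob (cball 0 (real s)) \<le> prob (cball 0 S)"
      by (rule finite_measure_mono) (auto simp: sets_eq_borel S_def)
    then show ?thesis using s by simp
  qed
  have tail: "prob {x. real n * S < norm x} \<le> exp (- ((real n)\<^sup>2 / 24))" for n :: nat
  proof (cases "n = 0")
    case False
    have "{x :: 'a. real n * S < norm x} = - (*\<^sub>R) (real n) ` cball 0 S"
      using False S by (subst cball_scale) auto
    then show ?thesis using fernique[of "cball 0 S" "real n"] pS False by simp
  qed simp
  have pw: "ennreal ((norm x)\<^sup>2)
      \<le> (\<Sum>n. ennreal (S\<^sup>2 * (2 * real n + 1)) * indicator {x. real n * S < norm x} x)" for x :: 'a
  proof -
    define k where "k = nat \<lceil>norm x / S\<rceil>"
    have k: "norm x \<le> real k * S"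
      using S by (simp add: k_def pos_divide_le_eq[symmetric])
    have small: "real n * S < norm x" if "n < k" for n
    proof -
      have "real n < norm x / S" using that unfolding k_def by linarith
      then show ?thesis using S by (simp add: field_simps)
    qed
    have "(\<Sum>n<k. 2 * real n + 1) = (real k)\<^sup>2"
      by (induction k) (auto simp: power2_eq_square algebra_simps)
    then have "(norm x)\<^sup>2 \<le> (\<Sum>n<k. S\<^sup>2 * (2 * real n + 1))"
      using power_mono[OF k, of 2] by (simp add: power_mult_distrib mult.commute flip: sum_distrib_left)
    then have "ennreal ((norm x)\<^sup>2) \<le> ennreal (\<Sum>n<k. S\<^sup>2 * (2 * real n + 1))"
      by (rule ennreal_leI)
    also have "\<dots> = (\<Sum>n<k. ennreal (S\<^sup>2 * (2 * real n + 1)))"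
      by (subst sum_ennreal) auto
    also have "\<dots> = (\<Sum>n<k. ennreal (S\<^sup>2 * (2 * real n + 1)) * indicator {x. real n * S < norm x} x)"
      using small by (intro sum.cong) auto
    also have "\<dots> \<le> (\<Sum>n. ennreal (S\<^sup>2 * (2 * real n + 1)) * indicator {x. real n * S < norm x} x)"
      by (rule sum_le_suminf) auto
    finally show ?thesis .
  qed
  have "(\<integral>\<^sup>+x. ennreal ((norm x)\<^sup>2) \<partial>\<mu>)
      \<le> (\<integral>\<^sup>+x. (\<Sum>n. ennreal (S\<^sup>2 * (2 * real n + 1)) * indicator {x. real n * S < norm x} x) \<partial>\<mu>)"
    by (rule nn_integral_mono) (rule pw)
  also have "\<dots> = (\<Sum>n. \<integral>\<^sup>+x. ennreal (S\<^sup>2 * (2 * real n + 1)) * indicator {x. real n * S < norm x} x \<partial>\<mu>)"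
    by (rule nn_integral_suminf) measurable
  also have "\<dots> = (\<Sum>n. ennreal (S\<^sup>2 * (2 * real n + 1) * prob {x. real n * S < norm x}))"
    by (subst nn_integral_cmult_indicator) (auto simp: emeasure_eq_measure ennreal_mult)
  also have "\<dots> \<le> (\<Sum>n. ennreal (S\<^sup>2 * (2 * real n + 1) * exp (- ((real n)\<^sup>2 / 24))))"
    by (intro suminf_le ennreal_leI mult_left_mono tail) auto
  also have "\<dots> < \<infinity>"
  proof -
    have "(\<lambda>n. (2 * real n + 1) * exp (- ((real n)\<^sup>2 / 24))) \<in> O(\<lambda>n. 1 / (real n)\<^sup>2)"
      by real_asymp
    moreover have "summable (\<lambda>n. norm (1 / (real n)\<^sup>2))"
      using inverse_power_summable[of 2, where 'a=real] by (simp add: inverse_eq_divide)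
    ultimately have "summable (\<lambda>n. (2 * real n + 1) * exp (- ((real n)\<^sup>2 / 24)))"
      by (rule summable_comparison_test_bigo[rotated])
    then have "summable (\<lambda>n. S\<^sup>2 * (2 * real n + 1) * exp (- ((real n)\<^sup>2 / 24)))"
      using summable_mult by (simp add: mult.assoc)
    then show ?thesis by (subst suminf_ennreal2) auto
  qed
  finally show ?thesis by (intro integrableI_nonneg) auto
qed

end

section \<open>Riesz representation and adjoints\<close>

text \<open>
  The graph of the functional is only required to be a rational subspace of \<open>'h \<times> \<real>\<close>, because
  the lemma is also applied to a countable set of functionals. The representing vector is the
  limit of a maximising sequence for \<open>2 c - (norm v)\<^sup>2\<close>: by the parallelogram law such a sequence is
  Cauchy, and rational variations around it give the representation in the limit.
\<close>

lemma riesz_representation_rational: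
  fixes G :: "('h::{real_inner, banach} \<times> real) set"
  assumes ne: "G \<noteq> {}"
    and lin: "\<And>p q r s. p \<in> G \<Longrightarrow> q \<in> G \<Longrightarrow> r \<in> \<rat> \<Longrightarrow> s \<in> \<rat> \<Longrightarrow> r *\<^sub>R p + s *\<^sub>R q \<in> G"
    and bnd: "\<And>v c. (v, c) \<in> G \<Longrightarrow> c \<le> C * norm v" and C: "C \<ge> 0"
  shows "\<exists>k. norm k \<le> C \<and> (\<forall>(v, c)\<in>G. k \<bullet> v = c)"
proof -
  define Q :: "'h \<times> real \<Rightarrow> real" where "Q p = 2 * snd p - (norm (fst p))\<^sup>2" for p
  define M where "M = (SUP p\<in>G. Q p)"
  have Qle: "Q p \<le> C\<^sup>2" if "p \<in> G" for p
  proof -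
    have "snd p \<le> C * norm (fst p)" using bnd[of "fst p" "snd p"] that by simp
    moreover have "0 \<le> (C - norm (fst p))\<^sup>2" by simp
    ultimately show ?thesis by (simp add: Q_def power2_diff)
  qed
  then have bdd: "bdd_above (Q ` G)" by (meson bdd_aboveI2)
  have QM: "Q p \<le> M" if "p \<in> G" for p unfolding M_def by (rule cSUP_upper[OF that bdd])
  have "\<exists>p\<in>G. M - 1 / (real n + 1) < Q p" for n
    using less_cSUP_iff[OF ne bdd, of "M - 1 / (real n + 1)"] by (simp add: M_def[symmetric])
  then obtain p where p: "p n \<in> G" "M - 1 / (real n + 1) < Q (p n)" for n by metis
  have dist: "(norm (fst (p m) - fst (p n)))\<^sup>2 \<le> 2 / (real m + 1) + 2 / (real n + 1)" for m n
  proof -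
    have "(1/2) *\<^sub>R p m + (1/2) *\<^sub>R p n \<in> G" using lin p(1) by simp
    then have mid: "Q ((1/2) *\<^sub>R p m + (1/2) *\<^sub>R p n) \<le> M" by (rule QM)
    define D where "D = (norm (fst (p m) - fst (p n)))\<^sup>2"
    have "Q ((1/2) *\<^sub>R p m + (1/2) *\<^sub>R p n) = (Q (p m) + Q (p n)) / 2 + D / 4"
      by (simp add: Q_def D_def power2_norm_eq_inner inner_add_left inner_add_right inner_diff_left
          inner_diff_right inner_commute field_simps)
    then have "D \<le> 2 * (M - Q (p m)) + 2 * (M - Q (p n))" using mid by (simp add: field_simps)
    also have "\<dots> \<le> 2 * (1 / (real m + 1)) + 2 * (1 / (real n + 1))"
      using p(2)[of m] p(2)[of n] by (intro add_mono mult_left_mono) auto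
    finally show ?thesis by (simp add: D_def)
  qed
  have "Cauchy (\<lambda>n. fst (p n))"
  proof (rule metric_CauchyI)
    fix e :: real assume e: "e > 0"
    obtain N :: nat where N: "4 / e\<^sup>2 < real N" using reals_Archimedean2 by blast
    have small: "2 / (real m + 1) < e\<^sup>2 / 2" if "m \<ge> N" for m
    proof -
      have "4 / e\<^sup>2 < real m + 1" using N that by simp
      then show ?thesis using e by (simp add: field_simps)
    qed
    have "dist (fst (p m)) (fst (p n)) < e" if "m \<ge> N" "n \<ge> N" for m n
    proof -
      have "(norm (fst (p m) - fst (p n)))\<^sup>2 < e\<^sup>2"
        using dist[of m n] small[OF that(1)] small[OF that(2)] by simp
      then show ?thesis using e by (simp add: dist_norm power_less_imp_less_base)
    qed
    then show "\<exists>N. \<forall>m\<ge>N. \<forall>n\<ge>N. dist (fst (p m)) (fst (p n)) < e" by blast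
  qed
  then obtain k where k: "(\<lambda>n. fst (p n)) \<longlonglongrightarrow> k" using Cauchy_convergent convergentD by blast
  have QL: "(\<lambda>n. Q (p n)) \<longlonglongrightarrow> M"
  proof (rule tendsto_sandwich[where f="\<lambda>n. M - 1 / (real n + 1)" and h="\<lambda>n. M"])
    show "(\<lambda>n. M - 1 / (real n + 1)) \<longlonglongrightarrow> M" by real_asymp
  qed (use p QM in \<open>auto intro!: always_eventually less_imp_le\<close>)
  have var: "2 * r * (c - k \<bullet> v) \<le> r\<^sup>2 * (norm v)\<^sup>2" if vc: "(v, c) \<in> G" and r: "r \<in> \<rat>" for v c r
  proof -
    have "Q (p n) + 2 * r * (c - fst (p n) \<bullet> v) - r\<^sup>2 * (norm v)\<^sup>2 \<le> M" for n
    proof -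
      have "1 *\<^sub>R p n + r *\<^sub>R (v, c) \<in> G" by (rule lin[OF p(1) vc Rats_1 r])
      then have "Q (1 *\<^sub>R p n + r *\<^sub>R (v, c)) \<le> M" by (rule QM)
      moreover have "Q (1 *\<^sub>R p n + r *\<^sub>R (v, c))
          = Q (p n) + 2 * r * (c - fst (p n) \<bullet> v) - r\<^sup>2 * (norm v)\<^sup>2"
      proof -
        have "(norm (u + r *\<^sub>R v))\<^sup>2 = (norm u)\<^sup>2 + 2 * r * (u \<bullet> v) + r\<^sup>2 * (norm v)\<^sup>2" for u
          unfolding power2_norm_eq_inner
          by (simp add: inner_add_left inner_add_right inner_commute[of v u] power2_eq_square
              distrib_left)
        then show ?thesis by (simp add: Q_def algebra_simps)
      qed
      ultimately show ?thesis by simp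
    qed
    moreover have "(\<lambda>n. Q (p n) + 2 * r * (c - fst (p n) \<bullet> v) - r\<^sup>2 * (norm v)\<^sup>2)
        \<longlonglongrightarrow> M + 2 * r * (c - k \<bullet> v) - r\<^sup>2 * (norm v)\<^sup>2"
      by (intro tendsto_intros QL k)
    ultimately have "M + 2 * r * (c - k \<bullet> v) - r\<^sup>2 * (norm v)\<^sup>2 \<le> M"
      by (meson LIMSEQ_le_const2)
    then show ?thesis by simp
  qed
  have le: "c - k \<bullet> v \<le> 0" if vc: "(v, c) \<in> G" for v c
  proof (rule LIMSEQ_le_const)
    show "(\<lambda>n. 1 / (real n + 1) * (norm v)\<^sup>2 / 2) \<longlonglongrightarrow> 0" by real_asymp
    have "c - k \<bullet> v \<le> 1 / (real n + 1) * (norm v)\<^sup>2 / 2" for n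
    proof -
      define r where "r = 1 / (real n + 1)"
      have r: "r > 0" "r \<in> \<rat>" by (auto simp: r_def intro!: Rats_divide Rats_add)
      have "(2 * (c - k \<bullet> v)) * r \<le> (r * (norm v)\<^sup>2) * r"
        using var[OF vc r(2)] by (simp add: power2_eq_square mult_ac)
      then have "2 * (c - k \<bullet> v) \<le> r * (norm v)\<^sup>2" using r(1) by (rule mult_right_le_imp_le)
      then have "c - k \<bullet> v \<le> r * (norm v)\<^sup>2 / 2" by (subst pos_le_divide_eq) (simp_all add: mult.commute)
      then show ?thesis unfolding r_def .
    qed
    then show "\<exists>N. \<forall>n\<ge>N. c - k \<bullet> v \<le> 1 / (real n + 1) * (norm v)\<^sup>2 / 2" by blast
  qed
  have rep: "k \<bullet> v = c" if vc: "(v, c) \<in> G" for v c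
  proof -
    have "(- 1) *\<^sub>R (v, c) + 0 *\<^sub>R (v, c) \<in> G" by (rule lin[OF vc vc]) auto
    then have "(- v, - c) \<in> G" by simp
    then show ?thesis using le[OF vc] le[of "- v" "- c"] by simp
  qed
  have "k \<bullet> k \<le> C * norm k"
  proof (rule LIMSEQ_le)
    show "(\<lambda>n. k \<bullet> fst (p n)) \<longlonglongrightarrow> k \<bullet> k" "(\<lambda>n. C * norm (fst (p n))) \<longlonglongrightarrow> C * norm k"
      by (intro tendsto_intros k)+
    have "k \<bullet> fst (p n) \<le> C * norm (fst (p n))" for n
      using rep[of "fst (p n)" "snd (p n)"] bnd[of "fst (p n)" "snd (p n)"] p(1)[of n] by simp
    then show "\<exists>N. \<forall>n\<ge>N. k \<bullet> fst (p n) \<le> C * norm (fst (p n))" by blast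
  qed
  then have "norm k \<le> C"
    using C by (cases "k = 0") (auto simp: power2_norm_eq_inner[symmetric] power2_eq_square)
  then show ?thesis using rep by blast
qed

lemma adjoint_inner:
  fixes A :: "'h::{real_inner, banach} \<Rightarrow> 'h"
  assumes A: "bounded_linear A"
  shows "A x \<bullet> y = x \<bullet> adjoint A y"
proof -
  obtain K where K: "K > 0" "\<And>x. norm (A x) \<le> norm x * K"
    using bounded_linear.pos_bounded[OF A] by blast
  interpret A: bounded_linear A by (rule A)
  have ex: "\<exists>k. norm k \<le> K * norm y \<and> (\<forall>(v, c)\<in>{(v, c). c = A v \<bullet> y}. k \<bullet> v = c)" for y
  proof (rule riesz_representation_rational)
    fix v c assume "(v, c) \<in> {(v, c). c = A v \<bullet> y}"
    then have "c \<le> norm (A v) * norm y" using norm_cauchy_schwarz by simp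
    also have "\<dots> \<le> (norm v * K) * norm y" by (rule mult_right_mono[OF K(2)]) simp
    finally show "c \<le> K * norm y * norm v" by (simp add: mult_ac)
  qed (use K(1) in \<open>auto simp: A.add A.scaleR inner_add_left\<close>)
  have "\<exists>k. \<forall>x. A x \<bullet> y = x \<bullet> k" for y
  proof -
    obtain k where "\<forall>(v, c)\<in>{(v, c). c = A v \<bullet> y}. k \<bullet> v = c" using ex[of y] by blast
    then have "k \<bullet> x = A x \<bullet> y" for x by auto
    then have "A x \<bullet> y = x \<bullet> k" for x by (metis inner_commute)
    then show ?thesis by blast
  qed
  then have "\<exists>A'. \<forall>x y. A x \<bullet> y = x \<bullet> A' y" by metis
  then have "\<forall>x y. A x \<bullet> y = x \<bullet> adjoint A y"
    unfolding adjoint_def by (rule someI_ex)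
  then show ?thesis by blast
qed

section \<open>The Cameron-Martin space\<close>

context abstract_wiener_space
begin

lemma cameron_martin_rep_square_integrable:
  assumes "cameron_martin_rep \<mu> h g"
  shows "g \<in> borel_measurable \<mu>" "integrable \<mu> (\<lambda>x. (g x)\<^sup>2)"
  using assms by (auto simp: cameron_martin_rep_def dual_L2_closure_def)

text \<open>
  The difference of two representatives is orthogonal to every functional, while it is an
  \<open>L\<^sup>2\<close>-limit of functionals when one representative is a functional.
\<close>

lemma cameron_martin_rep_unique:
  assumes g: "cameron_martin_rep \<mu> h g" and f: "cameron_martin_rep \<mu> h f" "bounded_linear f"
  shows "AE x in \<mu>. g x = f x"
proof -
  note gm [measurable] = cameron_martin_rep_square_integrable(1)[OF g]
  note fm [measurable] = bl_measurable[OF f(2)]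
  have g2: "integrable \<mu> (\<lambda>x. g x * g x)" and gf: "integrable \<mu> (\<lambda>x. g x * f x)"
    using cameron_martin_rep_square_integrable[OF g] integrable_square[OF f(2)]
    by (auto intro!: integrable_mult_of_squares)
  have gF: "integrable \<mu> (\<lambda>x. g x * F x)" if "bounded_linear F" for F
    using cameron_martin_rep_square_integrable[OF g] integrable_square[OF that] bl_measurable[OF that]
    by (auto intro!: integrable_mult_of_squares)
  have orth: "(\<integral>x. F x * g x \<partial>\<mu>) = (\<integral>x. F x * f x \<partial>\<mu>)" if "bounded_linear F" for F
    using g f that by (simp add: cameron_martin_rep_def)
  obtain F where F: "\<And>n. bounded_linear (F n)" "(\<lambda>n. \<integral>x. (F n x - g x)\<^sup>2 \<partial>\<mu>) \<longlonglongrightarrow> 0"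
    using g by (auto simp: cameron_martin_rep_def dual_L2_closure_def)
  have int_d: "integrable \<mu> (\<lambda>x. (g x - f x)\<^sup>2)"
  proof -
    have "(g x - f x)\<^sup>2 = g x * g x - 2 * (g x * f x) + f x * f x" for x
      by (simp add: power2_eq_square algebra_simps)
    then show ?thesis using g2 gf integrable_product[OF f(2) f(2)] by simp
  qed
  have "(\<integral>x. (g x - f x)\<^sup>2 \<partial>\<mu>) \<le> (\<integral>x. (F n x - g x)\<^sup>2 \<partial>\<mu>)" for n
  proof -
    define R where "R x = F n x - f x" for x
    have R: "bounded_linear R" unfolding R_def[abs_def] by (rule bounded_linear_sub[OF F(1) f(2)])
    have "(F n x - g x)\<^sup>2 = (g x - f x)\<^sup>2 - 2 * (R x * g x - R x * f x) + R x * R x" for x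
      by (simp add: R_def power2_eq_square algebra_simps)
    then have "(\<integral>x. (F n x - g x)\<^sup>2 \<partial>\<mu>)
        = (\<integral>x. (g x - f x)\<^sup>2 \<partial>\<mu>) - 2 * ((\<integral>x. R x * g x \<partial>\<mu>) - (\<integral>x. R x * f x \<partial>\<mu>)) + cov R R"
      using int_d gF[OF R] integrable_product[OF R f(2)] integrable_product[OF R R]
      by (simp add: cov_def mult.commute)
    then show ?thesis using orth[OF R] cov_nonneg[of R] by simp
  qed
  then have "(\<integral>x. (g x - f x)\<^sup>2 \<partial>\<mu>) \<le> 0"
    by (intro LIMSEQ_le_const[OF F(2)]) auto
  then have "(\<integral>x. (g x - f x)\<^sup>2 \<partial>\<mu>) = 0"
    by (intro antisym) auto
  then have "AE x in \<mu>. (g x - f x)\<^sup>2 = 0"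
    by (subst (asm) integral_nonneg_eq_0_iff_AE[OF int_d]) auto
  then show ?thesis by auto
qed

text \<open>
  The weak integral \<open>\<integral> f(x) x d\<mu>(x)\<close> is a Bochner integral because \<open>\<mu>\<close> has a second moment.
\<close>

lemma cameron_martin_rep_functional:
  fixes f :: "'a \<Rightarrow> real"
  assumes f: "bounded_linear f"
  shows "\<exists>h. cameron_martin_rep \<mu> (\<iota> h) f"
proof -
  have [measurable]: "f \<in> borel_measurable \<mu>" by (rule bl_measurable[OF f])
  obtain K where K: "\<And>x. norm (f x) \<le> norm x * K" using bounded_linear.bounded[OF f] by blast
  have int: "integrable \<mu> (\<lambda>x. f x *\<^sub>R x)"
  proof (rule Bochner_Integration.integrable_bound)
    show "integrable \<mu> (\<lambda>x. K * (norm x)\<^sup>2)" using integrable_norm_square by simp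
    have "norm (f x *\<^sub>R x) \<le> norm (K * (norm x)\<^sup>2)" for x
    proof -
      have "\<bar>f x\<bar> * norm x \<le> (norm x * K) * norm x"
        using K[of x] by (intro mult_right_mono) auto
      then show ?thesis by (simp add: power2_eq_square mult_ac)
    qed
    then show "AE x in \<mu>. norm (f x *\<^sub>R x) \<le> norm (K * (norm x)\<^sup>2)" by simp
  qed measurable
  have dual: "f \<in> dual_L2_closure \<mu>"
    using f integrable_square[OF f] unfolding dual_L2_closure_def
    by (auto intro!: exI[of _ "\<lambda>_. f"])
  have "F (\<integral>x. f x *\<^sub>R x \<partial>\<mu>) = (\<integral>x. F x * f x \<partial>\<mu>)" if F: "bounded_linear F" for F :: "'a \<Rightarrow> real"
    using integral_bounded_linear[OF F int] linear_scale[OF bounded_linear.linear[OF F]]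
    by (simp add: mult.commute)
  then have "cameron_martin_rep \<mu> (\<integral>x. f x *\<^sub>R x \<partial>\<mu>) f"
    using dual by (simp add: cameron_martin_rep_def)
  then show ?thesis
    using range_eq by (metis (mono_tags, lifting) cameron_martin_space_def image_iff mem_Collect_eq)
qed

definition rep :: "'h \<Rightarrow> 'a \<Rightarrow> real" where
  "rep h = (SOME g. cameron_martin_rep \<mu> (\<iota> h) g)"

lemma cameron_martin_rep_rep: "cameron_martin_rep \<mu> (\<iota> h) (rep h)"
proof -
  have "\<iota> h \<in> cameron_martin_space \<mu>" using range_eq by blast
  then have "\<exists>g. cameron_martin_rep \<mu> (\<iota> h) g" by (simp add: cameron_martin_space_def)
  then show ?thesis unfolding rep_def by (rule someI_ex)
qed

lemma inner_rep: "h \<bullet> k = (\<integral>x. rep h x * rep k x \<partial>\<mu>)"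
  unfolding inner_eq cameron_martin_inner_def rep_def ..

lemmas rep_measurable = cameron_martin_rep_square_integrable(1)[OF cameron_martin_rep_rep]
lemmas integrable_rep_square = cameron_martin_rep_square_integrable(2)[OF cameron_martin_rep_rep]

lemma functional_iota:
  "bounded_linear f \<Longrightarrow> f (\<iota> k) = (\<integral>x. f x * rep k x \<partial>\<mu>)"
  using cameron_martin_rep_rep[of k] by (simp add: cameron_martin_rep_def)

text \<open>\<open>riesz\<close> is the adjoint of the embedding, from the dual of \<open>'a\<close> to \<open>'h\<close>.\<close>

definition riesz :: "('a \<Rightarrow> real) \<Rightarrow> 'h" where
  "riesz f = (SOME h. \<forall>k. h \<bullet> k = f (\<iota> k))"

lemma riesz_inner_and_rep:
  assumes f: "bounded_linear f"
  shows "riesz f \<bullet> k = f (\<iota> k)" "cameron_martin_rep \<mu> (\<iota> (riesz f)) f"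
proof -
  have [measurable]: "f \<in> borel_measurable \<mu>" by (rule bl_measurable[OF f])
  obtain h where h: "cameron_martin_rep \<mu> (\<iota> h) f" using cameron_martin_rep_functional[OF f] ..
  note rep_measurable [measurable]
  have "AE x in \<mu>. rep h x = f x"
    by (rule cameron_martin_rep_unique[OF cameron_martin_rep_rep h f])
  then have "(\<integral>x. rep h x * rep k x \<partial>\<mu>) = (\<integral>x. f x * rep k x \<partial>\<mu>)" for k
    by (intro integral_cong_AE) (auto intro!: borel_measurable_times rep_measurable)
  then have hk: "h \<bullet> k = f (\<iota> k)" for k by (simp only: inner_rep functional_iota[OF f])
  then have "\<forall>k. riesz f \<bullet> k = f (\<iota> k)"
    unfolding riesz_def by (rule someI[of _ h, OF allI])
  then have R: "riesz f \<bullet> k = f (\<iota> k)" for k by blast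
  then show "riesz f \<bullet> k = f (\<iota> k)" .
  have "riesz f = h" using R hk by (metis vector_eq_rdot)
  then show "cameron_martin_rep \<mu> (\<iota> (riesz f)) f" using h by simp
qed

lemmas riesz_inner = riesz_inner_and_rep(1)

lemma riesz_cov:
  assumes "bounded_linear f" "bounded_linear g"
  shows "riesz f \<bullet> riesz g = cov f g"
  using riesz_inner[OF assms(1)] riesz_inner_and_rep(2)[OF assms(2)] assms(1)
  by (simp add: cameron_martin_rep_def cov_def)

lemma norm_riesz: "bounded_linear f \<Longrightarrow> (norm (riesz f))\<^sup>2 = cov f f"
  by (simp add: power2_norm_eq_inner riesz_cov)

lemma riesz_eqI:
  assumes "bounded_linear f" "\<And>k. h \<bullet> k = f (\<iota> k)"
  shows "riesz f = h"
  using riesz_inner[OF assms(1)] assms(2) by (metis vector_eq_rdot)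

lemma riesz_lincomb:
  assumes "bounded_linear f" "bounded_linear g"
  shows "riesz (\<lambda>x. a * f x + b * g x) = a *\<^sub>R riesz f + b *\<^sub>R riesz g"
  by (rule riesz_eqI[OF bounded_linear_lincomb[OF assms]])
    (simp add: inner_add_left riesz_inner assms)

text \<open>
  \<open>rep h\<close> is an \<open>L\<^sup>2\<close>-limit of functionals, and the Riesz vectors of these functionals lie at the
  same distances from \<open>h\<close>.
\<close>

lemma riesz_dense:
  assumes "e > 0"
  shows "\<exists>f. bounded_linear f \<and> norm (riesz f - h) < e"
proof -
  obtain F where F: "\<And>n. bounded_linear (F n)" "(\<lambda>n. \<integral>x. (F n x - rep h x)\<^sup>2 \<partial>\<mu>) \<longlonglongrightarrow> 0"
    using cameron_martin_rep_rep[of h] by (auto simp: cameron_martin_rep_def dual_L2_closure_def)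
  have "(norm (riesz (F n) - h))\<^sup>2 = (\<integral>x. (F n x - rep h x)\<^sup>2 \<partial>\<mu>)" for n
  proof -
    have "(F n x - rep h x)\<^sup>2 = F n x * F n x - 2 * (F n x * rep h x) + rep h x * rep h x" for x
      by (simp add: power2_eq_square algebra_simps)
    moreover have "integrable \<mu> (\<lambda>x. F n x * rep h x)" "integrable \<mu> (\<lambda>x. rep h x * rep h x)"
      by (rule integrable_mult_of_squares[OF bl_measurable[OF F(1)] rep_measurable
            integrable_square[OF F(1)] integrable_rep_square])
        (rule integrable_mult_of_squares[OF rep_measurable rep_measurable
            integrable_rep_square integrable_rep_square])
    ultimately have "(\<integral>x. (F n x - rep h x)\<^sup>2 \<partial>\<mu>) = cov (F n) (F n) - 2 * F n (\<iota> h) + h \<bullet> h"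
      using integrable_product[OF F(1) F(1)] by (simp add: cov_def functional_iota[OF F(1)] inner_rep)
    also have "\<dots> = (norm (riesz (F n) - h))\<^sup>2"
    proof -
      have "riesz (F n) \<bullet> h = F n (\<iota> h)" by (rule riesz_inner[OF F(1)])
      then have "h \<bullet> riesz (F n) = F n (\<iota> h)" by (subst inner_commute)
      with \<open>riesz (F n) \<bullet> h = F n (\<iota> h)\<close> show ?thesis
        by (simp add: power2_norm_eq_inner inner_diff_left inner_diff_right riesz_cov F(1))
    qed
    finally show ?thesis by simp
  qed
  then have "(\<lambda>n. (norm (riesz (F n) - h))\<^sup>2) \<longlonglongrightarrow> 0" using F(2) by simp
  then have "(\<lambda>n. norm (riesz (F n) - h)) \<longlonglongrightarrow> 0" by simp
  then have "eventually (\<lambda>n. norm (riesz (F n) - h) < e) sequentially"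
    using assms by (rule order_tendstoD)
  then obtain n where "norm (riesz (F n) - h) < e" using eventually_happens by fastforce
  then show ?thesis using F(1) by blast
qed

end

section \<open>The semigroup\<close>

locale wiener_semigroup = abstract_wiener_space \<mu> \<iota>
  for \<mu> :: "'a::{banach, second_countable_topology} measure"
    and \<iota> :: "'h::{real_inner, banach} \<Rightarrow> 'a" +
  fixes S :: "real \<Rightarrow> 'h \<Rightarrow>\<^sub>L 'h" and T :: "real \<Rightarrow> 'a \<Rightarrow>\<^sub>L 'a"
  assumes coisometry: "t \<ge> 0 \<Longrightarrow> S t (adjoint (S t) x) = x"
    and weakly_null: "((\<lambda>t. S t x \<bullet> y) \<longlongrightarrow> 0) at_top"
    and semigroup: "strongly_continuous_semigroup T"
    and extends: "t \<ge> 0 \<Longrightarrow> T t (\<iota> x) = \<iota> (S t x)"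
begin

lemma S_adjoint: "S t x \<bullet> y = x \<bullet> adjoint (S t) y"
  by (rule adjoint_inner) (rule blinfun.bounded_linear_right)

lemma norm_adjoint:
  assumes "t \<ge> 0"
  shows "norm (adjoint (S t) x) = norm x"
proof -
  have "adjoint (S t) x \<bullet> adjoint (S t) x = x \<bullet> x"
    using S_adjoint[of t "adjoint (S t) x" x] coisometry[OF assms] by simp
  then show ?thesis by (simp add: norm_eq_sqrt_inner)
qed

lemma T_add: "t \<ge> 0 \<Longrightarrow> u \<ge> 0 \<Longrightarrow> T (t + u) x = T t (T u x)"
  using semigroup by (simp add: strongly_continuous_semigroup_def)

lemma T_zero: "T 0 x = x"
  using semigroup by (simp add: strongly_continuous_semigroup_def)

lemma bounded_linear_T: "bounded_linear f \<Longrightarrow> bounded_linear (\<lambda>x. f (T t x))"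
  by (rule bounded_linear_compose[OF _ blinfun.bounded_linear_right])

lemma riesz_T:
  assumes "bounded_linear f" "t \<ge> 0"
  shows "riesz (\<lambda>x. f (T t x)) = adjoint (S t) (riesz f)"
proof (rule riesz_eqI[OF bounded_linear_T[OF assms(1)]])
  fix k
  have "adjoint (S t) (riesz f) \<bullet> k = S t k \<bullet> riesz f"
    unfolding S_adjoint by (rule inner_commute)
  also have "\<dots> = f (\<iota> (S t k))"
    by (subst inner_commute) (rule riesz_inner[OF assms(1)])
  finally show "adjoint (S t) (riesz f) \<bullet> k = f (T t (\<iota> k))" by (simp add: extends assms(2))
qed

lemma cov_T:
  assumes f: "bounded_linear f" "bounded_linear g" and t: "t \<ge> 0"
  shows "cov (\<lambda>x. f (T t x)) (\<lambda>x. g (T t x)) = cov f g"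
proof -
  have "cov (\<lambda>x. f (T t x)) (\<lambda>x. g (T t x)) = adjoint (S t) (riesz f) \<bullet> adjoint (S t) (riesz g)"
    by (simp only: riesz_cov[OF bounded_linear_T[OF f(1)] bounded_linear_T[OF f(2)], symmetric]
        riesz_T[OF f(1) t] riesz_T[OF f(2) t])
  also have "\<dots> = riesz f \<bullet> riesz g" by (simp only: coisometry[OF t] flip: S_adjoint)
  finally show ?thesis by (simp add: riesz_cov f)
qed

lemma distr_T: "t \<ge> 0 \<Longrightarrow> distr \<mu> borel (T t) = \<mu>"
  by (rule distr_invariant) (auto intro: blinfun.bounded_linear_right cov_T)

lemma prob_T:
  assumes t: "t \<ge> 0" and A: "A \<in> sets borel"
  shows "prob {x. T t x \<in> A} = prob A"
proof -
  have "prob A = measure (distr \<mu> borel (T t)) A" using distr_T[OF t] by simp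
  also have "\<dots> = prob {x. T t x \<in> A}"
    by (subst measure_distr[OF bl_measurable[OF blinfun.bounded_linear_right] A])
      (simp add: vimage_def)
  finally show ?thesis ..
qed

lemma cov_T_tendsto_0:
  assumes f: "bounded_linear f"
  shows "((\<lambda>t. cov (\<lambda>x. f (T t x)) f) \<longlongrightarrow> 0) at_top"
proof -
  have "eventually (\<lambda>t. S t (riesz f) \<bullet> riesz f = cov (\<lambda>x. f (T t x)) f) at_top"
    using eventually_ge_at_top[of 0]
  proof eventually_elim
    case (elim t)
    have "S t (riesz f) \<bullet> riesz f = riesz f \<bullet> adjoint (S t) (riesz f)" by (rule S_adjoint)
    also have "\<dots> = riesz (\<lambda>x. f (T t x)) \<bullet> riesz f"
      unfolding riesz_T[OF f elim] by (rule inner_commute)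
    also have "\<dots> = cov (\<lambda>x. f (T t x)) f" by (rule riesz_cov[OF bounded_linear_T[OF f] f])
    finally show ?case .
  qed
  with weakly_null[of "riesz f" "riesz f"] show ?thesis by (rule Lim_transform_eventually)
qed

end

section \<open>Almost sure upper bounds\<close>

context wiener_semigroup
begin

definition traj :: "'a \<Rightarrow> real \<Rightarrow> 'a" where
  "traj x t = T t x /\<^sub>R sqrt (2 * ln t)"

text \<open>
  At a large time \<open>k \<delta>\<close> the exceptional event has probability at most \<open>(k \<delta>) powr (- 2 a)\<close>, by the
  invariance of \<open>\<mu>\<close>. This is summable for \<open>a > 1 / 2\<close>, which is where the normalisation \<open>sqrt (2 ln t)\<close> comes
  from.
\<close>

lemma eventually_in_scaled:
  assumes V: "closed V" and a: "a > 1 / 2" and \<delta>: "\<delta> > 0" and tail: "exp_tail V a"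
  shows "AE x in \<mu>. eventually (\<lambda>k. T (real k * \<delta>) x \<in> (*\<^sub>R) (sqrt (2 * ln (real k * \<delta>))) ` V) sequentially"
proof -
  define B where "B k = - (*\<^sub>R) (sqrt (2 * ln (real k * \<delta>))) ` V" for k :: nat
  define A where "A k = {x. T (real k * \<delta>) x \<in> B k}" for k
  have B: "B k \<in> sets borel" for k
    using closed_scaling[OF V] by (auto simp: B_def intro: borel_comp)
  have A: "A k \<in> sets \<mu>" for k
    using measurable_sets[OF bl_measurable[OF blinfun.bounded_linear_right] B, of "T (real k * \<delta>)" k]
    by (simp add: A_def vimage_def)
  have pA: "prob (A k) = prob (B k)" for k
    unfolding A_def by (rule prob_T[OF _ B]) (use \<delta> in simp)
  have "summable (\<lambda>k. prob (A k))"
  proof (rule summable_comparison_test_ev)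
    have "eventually (\<lambda>k. real k * \<delta> \<ge> exp 1) sequentially"
      using \<delta> by real_asymp
    then show "eventually (\<lambda>k. norm (prob (A k)) \<le> \<delta> powr (- (2 * a)) * real k powr (- (2 * a))) sequentially"
    proof eventually_elim
      case (elim k)
      have pos: "real k * \<delta> > 0" using elim exp_gt_zero[of 1] by linarith
      then have ln: "ln (real k * \<delta>) \<ge> 1" using elim by (simp add: ln_ge_iff)
      then have "sqrt (2 * ln (real k * \<delta>)) \<ge> 1" by simp
      then have "prob (B k) \<le> exp (- (a * (sqrt (2 * ln (real k * \<delta>)))\<^sup>2))"
        using tail unfolding B_def exp_tail_def by blast
      also have "\<dots> = exp (- (2 * a) * ln (real k * \<delta>))"
        using ln by (simp add: mult.commute)
      also have "\<dots> = (real k * \<delta>) powr (- (2 * a))"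
      proof -
        have "exp (b * ln y) = y powr b" if "y > 0" for b y :: real
          using that by (simp add: powr_def)
        then show ?thesis using pos .
      qed
      also have "\<dots> = \<delta> powr (- (2 * a)) * real k powr (- (2 * a))"
        using \<delta> by (subst powr_mult) (auto simp: mult.commute)
      finally show ?case by (simp add: pA)
    qed
    show "summable (\<lambda>k. \<delta> powr (- (2 * a)) * real k powr (- (2 * a)))"
      using a by (intro summable_mult) (simp add: summable_real_powr_iff)
  qed
  then have "AE x in \<mu>. eventually (\<lambda>k. x \<in> space \<mu> - A k) sequentially"
    by (intro borel_cantelli_AE1 A) (auto simp: less_top[symmetric])
  then show ?thesis by (simp add: A_def B_def)
qed

text \<open>
  Times are sampled in steps of length \<open>\<delta>\<close>, chosen so small that the displacement during one step
  is, with probability at least \<open>3 / 4\<close>, at most \<open>\<epsilon> / 5\<close>; Fernique's inequality then controls the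
  displacement at all times.
\<close>

lemma eventually_near_convex:
  assumes C: "closed C" "convex C" "0 \<in> C" and a: "a > 1 / 2" and \<epsilon>: "\<epsilon> > 0" and tail: "exp_tail C a"
  shows "AE x in \<mu>. eventually (\<lambda>t. \<exists>c\<in>C. norm (traj x t - c) \<le> \<epsilon>) at_top"
proof -
  define U where "U n = {x. \<forall>u\<in>{0..1 / real (Suc n)}. norm (T u x - x) \<le> \<epsilon> / 5}" for n :: nat
  have lin: "bounded_linear (\<lambda>x. T u x - x)" for u
    by (intro bounded_linear_sub blinfun.bounded_linear_right bounded_linear_ident)
  have U_eq: "U n = (\<Inter>u\<in>{0..1 / real (Suc n)}. (\<lambda>x. T u x - x) -` cball 0 (\<epsilon> / 5))" for n
    by (auto simp: U_def)
  have Uclosed: "closed (U n)" for n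
    unfolding U_eq
    by (intro closed_INT ballI closed_vimage closed_cball linear_continuous_on lin)
  have Uconvex: "convex (U n)" for n
    unfolding U_eq
    by (intro convex_INT convex_linear_vimage bounded_linear.linear lin convex_cball)
  have Usym: "- x \<in> U n" if "x \<in> U n" for x n
  proof -
    have "norm (T u (- x) - (- x)) = norm (T u x - x)" for u
      by (metis (no_types, lifting) blinfun.minus_right minus_diff_minus norm_minus_cancel)
    then show ?thesis using that unfolding U_def by auto
  qed
  have "incseq U"
    unfolding incseq_def
  proof (intro allI impI)
    fix m n :: nat assume "m \<le> n"
    then have "1 / real (Suc n) \<le> 1 / real (Suc m)" by (intro frac_le) auto
    then have "{0..1 / real (Suc n)} \<subseteq> {0..1 / real (Suc m)}" by auto
    then show "U m \<subseteq> U n" unfolding U_def by blast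
  qed
  moreover have "(\<Union>n. U n) = UNIV"
  proof -
    have "\<exists>n. x \<in> U n" for x
    proof -
      have "((\<lambda>t. norm (T t x - x)) \<longlongrightarrow> 0) (at_right 0)"
        using semigroup by (simp add: strongly_continuous_semigroup_def)
      then have "eventually (\<lambda>t. norm (T t x - x) < \<epsilon> / 5) (at_right 0)"
        by (rule order_tendstoD) (use \<epsilon> in simp)
      then obtain b where b: "b > 0" "\<And>t. 0 < t \<Longrightarrow> t < b \<Longrightarrow> norm (T t x - x) < \<epsilon> / 5"
        unfolding eventually_at_right_field by blast
      obtain n where n: "1 / real (Suc n) < b" using b(1) nat_approx_posE by metis
      have "norm (T u x - x) \<le> \<epsilon> / 5" if "0 \<le> u" "u \<le> 1 / real (Suc n)" for u
      proof (cases "u = 0")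
        case True
        then show ?thesis using \<epsilon> by (simp add: T_zero)
      next
        case False
        then show ?thesis using b(2)[of u] that n by (auto intro: less_imp_le)
      qed
      then show ?thesis by (auto simp: U_def intro!: exI[of _ n])
    qed
    then show ?thesis by blast
  qed
  ultimately obtain n where n: "prob (U n) \<ge> 3 / 4"
    using exists_heavy_incseq[of U "3 / 4"] Uclosed by auto
  define \<delta> where "\<delta> = 1 / real (Suc n)"
  have \<delta>: "\<delta> > 0" by (simp add: \<delta>_def)
  define W where "W = (*\<^sub>R) 5 ` U n"
  have W: "closed W" unfolding W_def by (rule closed_scaling[OF Uclosed])
  have tailW: "exp_tail W (25 / 24)"
    unfolding W_def by (rule fernique_exp_tail[OF Uclosed Uconvex Usym n])
  have AE1: "AE x in \<mu>. eventually (\<lambda>k. T (real k * \<delta>) x \<in> (*\<^sub>R) (sqrt (2 * ln (real k * \<delta>))) ` C) sequentially"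
    by (rule eventually_in_scaled[OF C(1) a \<delta> tail])
  have AE2: "AE x in \<mu>. eventually (\<lambda>k. T (real k * \<delta>) x \<in> (*\<^sub>R) (sqrt (2 * ln (real k * \<delta>))) ` W) sequentially"
    by (rule eventually_in_scaled[OF W _ \<delta> tailW]) simp
  from AE1 AE2 show ?thesis
  proof eventually_elim
    case (elim x)
    then have ev: "eventually (\<lambda>k. T (real k * \<delta>) x \<in> (*\<^sub>R) (sqrt (2 * ln (real k * \<delta>))) ` C
        \<and> T (real k * \<delta>) x \<in> (*\<^sub>R) (sqrt (2 * ln (real k * \<delta>))) ` W \<and> real k * \<delta> > 1) sequentially"
    proof -
      have "eventually (\<lambda>k. real k * \<delta> > 1) sequentially" using \<delta> by real_asymp
      with elim show ?thesis by eventually_elim auto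
    qed
    have "filterlim (\<lambda>t. nat \<lfloor>t / \<delta>\<rfloor>) sequentially at_top"
      using \<delta> by (intro filterlim_compose[OF filterlim_nat_sequentially]
          filterlim_compose[OF filterlim_floor_sequentially]) real_asymp
    then have "eventually (\<lambda>t. (T (real (nat \<lfloor>t / \<delta>\<rfloor>) * \<delta>) x
          \<in> (*\<^sub>R) (sqrt (2 * ln (real (nat \<lfloor>t / \<delta>\<rfloor>) * \<delta>))) ` C
        \<and> T (real (nat \<lfloor>t / \<delta>\<rfloor>) * \<delta>) x
          \<in> (*\<^sub>R) (sqrt (2 * ln (real (nat \<lfloor>t / \<delta>\<rfloor>) * \<delta>))) ` W
        \<and> real (nat \<lfloor>t / \<delta>\<rfloor>) * \<delta> > 1)) at_top"
      by (rule eventually_compose_filterlim[OF ev])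
    with eventually_ge_at_top[of 0] show ?case
    proof eventually_elim
      case (elim t)
      define s where "s = real (nat \<lfloor>t / \<delta>\<rfloor>) * \<delta>"
      define p where "p = sqrt (2 * ln s)"
      define q where "q = sqrt (2 * ln t)"
      have s1: "s > 1" using elim by (simp add: s_def)
      have fl: "real (nat \<lfloor>t / \<delta>\<rfloor>) \<le> t / \<delta>" "t / \<delta> < real (nat \<lfloor>t / \<delta>\<rfloor>) + 1"
        using elim \<delta> by (simp_all add: of_nat_nat)
      have st: "s \<le> t" "t - s \<le> \<delta>"
        using fl \<delta> by (simp_all add: s_def field_simps)
      have p: "p > 0" using s1 by (simp add: p_def)
      have pq: "p \<le> q" using s1 st by (simp add: p_def q_def)
      obtain c where c: "c \<in> C" "T s x = p *\<^sub>R c" using elim by (auto simp: s_def p_def)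
      obtain w where w: "w \<in> U n" "T s x = (5 * p) *\<^sub>R w"
        using elim by (auto simp: s_def p_def W_def mult.commute)
      define d where "d = (p / q) *\<^sub>R c"
      have "(p / q) *\<^sub>R c + (1 - p / q) *\<^sub>R 0 \<in> C"
        using C c(1) p pq by (intro convexD) auto
      then have d: "d \<in> C" by (simp add: d_def)
      have "T t x = T (t - s) (T s x)"
        using T_add[of "t - s" s x] st s1 by simp
      then have "T t x - T s x = (5 * p) *\<^sub>R (T (t - s) w - w)"
        by (simp add: w(2) blinfun.scaleR_right scaleR_diff_right)
      moreover have "norm (T (t - s) w - w) \<le> \<epsilon> / 5"
        using w(1) st by (simp add: U_def \<delta>_def)
      ultimately have "norm (T t x - T s x) \<le> (5 * p) * (\<epsilon> / 5)"
        using p by (simp add: mult_left_mono)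
      then have disp: "norm (T t x - T s x) \<le> p * \<epsilon>" by simp
      have "traj x t - d = (1 / q) *\<^sub>R (T t x - T s x)"
        unfolding traj_def d_def c(2) q_def
        by (simp add: divide_inverse scaleR_diff_right mult.commute)
      then have "norm (traj x t - d) = norm (T t x - T s x) / q"
        using p pq by simp
      also have "\<dots> \<le> (p * \<epsilon>) / q" using disp p pq by (intro divide_right_mono) auto
      also have "\<dots> \<le> \<epsilon>" using p pq \<epsilon> by (simp add: field_simps)
      finally show ?case using d by blast
    qed
  qed
qed

text \<open>
  The convex set is five times an \<open>\<epsilon> / 6\<close>-neighbourhood of the convex hull of finitely many points.
  By separability, enough points make the neighbourhood heavy enough for Fernique's inequality.
\<close>

lemma eventually_near_compact:
  assumes \<epsilon>: "\<epsilon> > 0"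
  shows "AE x in \<mu>. \<exists>K. compact K \<and> eventually (\<lambda>t. \<exists>c\<in>K. norm (traj x t - c) \<le> \<epsilon>) at_top"
proof -
  define e where "e = \<epsilon> / 6"
  have e: "e > 0" using \<epsilon> by (simp add: e_def)
  obtain D :: "'a set" where D: "countable D" "\<And>X. open X \<Longrightarrow> X \<noteq> {} \<Longrightarrow> \<exists>d\<in>D. d \<in> X"
    using countable_dense_setE by blast
  define P where "P m = (from_nat_into D ` {..<m}) \<union> uminus ` (from_nat_into D ` {..<m})" for m :: nat
  define U where "U m = (\<Union>y\<in>convex hull (P m). \<Union>z\<in>cball 0 e. {y + z})" for m
  have finP: "finite (P m)" for m by (simp add: P_def)
  have symP: "uminus ` P m = P m" for m
    by (auto simp: P_def image_Un image_image)
  have K: "compact (convex hull (P m))" for m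
    by (rule finite_imp_compact_convex_hull[OF finP])
  have Uclosed: "closed (U m)" for m
    unfolding U_def by (rule compact_closed_sums[OF K closed_cball])
  have Uconvex: "convex (U m)" for m
    unfolding U_def by (rule convex_sums) auto
  have hullsym: "uminus ` (convex hull (P m)) = convex hull (P m)" for m
    using convex_hull_linear_image[of "uminus :: 'a \<Rightarrow> 'a" "P m"]
    by (simp add: symP module_hom_uminus linear_uminus)
  have Usym: "- x \<in> U m" if xU: "x \<in> U m" for x m
  proof -
    obtain y z where yz: "y \<in> convex hull (P m)" "z \<in> cball 0 e" "x = y + z"
      using xU unfolding U_def by blast
    have "- y \<in> convex hull (P m)" using hullsym yz(1) by blast
    moreover have "- z \<in> cball 0 e" using yz(2) by simp
    moreover have "- x = - y + - z" using yz(3) by simp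
    ultimately show ?thesis unfolding U_def by blast
  qed
  have "incseq U"
  proof (rule incseq_SucI)
    fix m
    have "P m \<subseteq> P (Suc m)" by (auto simp: P_def)
    then show "U m \<subseteq> U (Suc m)" unfolding U_def using hull_mono by blast
  qed
  moreover have "(\<Union>m. U m) = UNIV"
  proof -
    have "\<exists>m. x \<in> U m" for x
    proof -
      obtain d where d: "d \<in> D" "d \<in> ball x e" using D(2)[of "ball x e"] e by auto
      obtain i where i: "from_nat_into D i = d" using from_nat_into_surj[OF D(1) d(1)] by blast
      have "d \<in> P (Suc i)" unfolding P_def using i by blast
      then have "d \<in> convex hull (P (Suc i))" by (rule hull_inc)
      moreover have "x - d \<in> cball 0 e" using d(2) by (simp add: dist_norm norm_minus_commute)
      moreover have "x = d + (x - d)" by simp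
      ultimately have "x \<in> U (Suc i)" unfolding U_def by blast
      then show ?thesis ..
    qed
    then show ?thesis by blast
  qed
  ultimately obtain m where m: "prob (U m) \<ge> 3 / 4"
    using exists_heavy_incseq[of U "3 / 4"] Uclosed by auto
  have "U m \<noteq> {}" using m by auto
  then obtain u where u: "u \<in> U m" by blast
  then have "(1/2) *\<^sub>R u + (1/2) *\<^sub>R (- u) \<in> U m" using Usym by (intro convexD[OF Uconvex]) auto
  then have zero: "0 \<in> U m" by simp
  define C where "C = (*\<^sub>R) 5 ` U m"
  have C: "closed C" "convex C" "0 \<in> C"
    unfolding C_def using closed_scaling[OF Uclosed] convex_scaling[OF Uconvex] zero by force+
  have tail: "exp_tail C (25 / 24)"
    unfolding C_def by (rule fernique_exp_tail[OF Uclosed Uconvex Usym m])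
  have "AE x in \<mu>. eventually (\<lambda>t. \<exists>c\<in>C. norm (traj x t - c) \<le> e) at_top"
    by (rule eventually_near_convex[OF C _ e tail]) simp
  then show ?thesis
  proof eventually_elim
    case (elim x)
    show ?case
    proof (intro exI conjI)
      show "compact ((*\<^sub>R) 5 ` (convex hull (P m)))" by (rule compact_scaling[OF K])
      show "eventually (\<lambda>t. \<exists>c\<in>(*\<^sub>R) 5 ` (convex hull (P m)). norm (traj x t - c) \<le> \<epsilon>) at_top"
        using elim
      proof eventually_elim
        case (elim t)
        then obtain c where c: "c \<in> C" "norm (traj x t - c) \<le> e" by blast
        then obtain y z where yz: "y \<in> convex hull (P m)" "norm z \<le> e" "c = 5 *\<^sub>R (y + z)"
          by (auto simp: C_def U_def)
        have "norm (traj x t - 5 *\<^sub>R y) = norm ((traj x t - c) + 5 *\<^sub>R z)"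
          by (simp add: yz(3) scaleR_add_right)
        also have "\<dots> \<le> norm (traj x t - c) + 5 * norm z"
          using norm_triangle_ineq[of "traj x t - c" "5 *\<^sub>R z"] by simp
        also have "\<dots> \<le> \<epsilon>" using c(2) yz(2) by (simp add: e_def)
        finally show ?case using yz(1) by blast
      qed
    qed
  qed
qed

text \<open>
  The half-space \<open>f \<le> s\<close> has tails of rate \<open>s\<^sup>2 / (2 v)\<close> for every \<open>v\<close> above the variance of \<open>f\<close>,
  and this exceeds \<open>1 / 2\<close> as soon as \<open>v < s\<^sup>2\<close>.
\<close>

lemma eventually_functional_le:
  fixes f :: "'a \<Rightarrow> real"
  assumes f: "bounded_linear f" and s: "s > 0" "cov f f < s\<^sup>2" and \<eta>: "\<eta> > 0"
  shows "AE x in \<mu>. eventually (\<lambda>t. f (traj x t) \<le> s + \<eta>) at_top"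
proof -
  obtain K where K: "K > 0" "\<And>x. norm (f x) \<le> norm x * K"
    using bounded_linear.pos_bounded[OF f] by blast
  define v where "v = (cov f f + s\<^sup>2) / 2"
  have v: "cov f f \<le> v" "v < s\<^sup>2" "v > 0" using s cov_nonneg[of f] by (auto simp: v_def)
  define C where "C = {x. f x \<le> s}"
  have scaled: "(*\<^sub>R) r ` C = {x. f x \<le> r * s}" if "r \<ge> 1" for r
  proof (intro set_eqI iffI)
    fix x assume "x \<in> (*\<^sub>R) r ` C"
    then show "x \<in> {x. f x \<le> r * s}"
      using that linear_scale[OF bounded_linear.linear[OF f]] by (auto simp: C_def)
  next
    fix x assume x: "x \<in> {x. f x \<le> r * s}"
    have "inverse r *\<^sub>R x \<in> C"
      using x that linear_scale[OF bounded_linear.linear[OF f]] by (auto simp: C_def field_simps)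
    moreover have "x = r *\<^sub>R (inverse r *\<^sub>R x)" using that by simp
    ultimately show "x \<in> (*\<^sub>R) r ` C" by blast
  qed
  have [measurable]: "f \<in> borel_measurable \<mu>" by (rule bl_measurable[OF f])
  have "AE x in \<mu>. eventually (\<lambda>t. \<exists>c\<in>C. norm (traj x t - c) \<le> \<eta> / K) at_top"
  proof (rule eventually_near_convex[where a="s\<^sup>2 / (2 * v)"])
    have C_eq: "C = f -` {..s}" by (auto simp: C_def)
    show "closed C" unfolding C_eq
      by (intro closed_vimage closed_atMost linear_continuous_on f)
    show "convex C" unfolding C_eq
      by (intro convex_linear_vimage bounded_linear.linear f) (simp add: convex_real_interval)
    show "0 \<in> C" using s linear_0[OF bounded_linear.linear[OF f]] by (simp add: C_def)
    show "1 / 2 < s\<^sup>2 / (2 * v)" using v by (simp add: field_simps)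
    show "0 < \<eta> / K" using \<eta> K by simp
    show "exp_tail C (s\<^sup>2 / (2 * v))"
      unfolding exp_tail_def
    proof (intro allI impI)
      fix r :: real assume r: "r \<ge> 1"
      have "prob (- (*\<^sub>R) r ` C) \<le> prob {x. r * s \<le> f x}"
        unfolding scaled[OF r] by (rule finite_measure_mono) (auto intro!: borel_measurable_le)
      also have "\<dots> \<le> exp (- ((r * s)\<^sup>2 / (2 * v)))"
        by (rule tail_le[OF f v(1,3)]) (use r s in simp)
      finally show "prob (- (*\<^sub>R) r ` C) \<le> exp (- (s\<^sup>2 / (2 * v) * r\<^sup>2))"
        by (simp add: power_mult_distrib mult.commute)
    qed
  qed
  then show ?thesis
  proof eventually_elim
    case (elim x)
    then show ?case
    proof eventually_elim
      case (elim t)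
      then obtain c where c: "f c \<le> s" "norm (traj x t - c) \<le> \<eta> / K" by (auto simp: C_def)
      have "f (traj x t) - f c \<le> norm (traj x t - c) * K"
        using K(2)[of "traj x t - c"] linear_diff[OF bounded_linear.linear[OF f]] by simp
      also have "\<dots> \<le> \<eta>" using c(2) K(1) by (simp add: field_simps)
      finally show ?case using c(1) by simp
    qed
  qed
qed

lemma limit_le_sqrt_cov:
  fixes f :: "'a \<Rightarrow> real"
  assumes f: "bounded_linear f"
  shows "AE x in \<mu>. \<forall>y t. filterlim t at_top sequentially \<longrightarrow> (\<lambda>n. traj x (t n)) \<longlonglongrightarrow> y
    \<longrightarrow> f y \<le> sqrt (cov f f)"
proof -
  have "AE x in \<mu>. \<forall>m. eventually (\<lambda>t. f (traj x t)
      \<le> (sqrt (cov f f) + 1 / (real m + 1)) + 1 / (real m + 1)) at_top"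
  proof (subst AE_all_countable, intro allI eventually_functional_le f)
    fix m :: nat
    have "1 / (real m + 1) > 0" by simp
    then show "0 < sqrt (cov f f) + 1 / (real m + 1)"
      using real_sqrt_ge_zero[OF cov_nonneg[of f]] by linarith
    have "(sqrt (cov f f))\<^sup>2 < (sqrt (cov f f) + 1 / (real m + 1))\<^sup>2"
      using cov_nonneg[of f] by (intro power_strict_mono) auto
    then show "cov f f < (sqrt (cov f f) + 1 / (real m + 1))\<^sup>2"
      using cov_nonneg[of f] by simp
  qed simp
  then show ?thesis
  proof eventually_elim
    case (elim x)
    show ?case
    proof (intro allI impI)
      fix y t assume t: "filterlim t at_top sequentially" and y: "(\<lambda>n. traj x (t n)) \<longlonglongrightarrow> y"
      have fy: "(\<lambda>n. f (traj x (t n))) \<longlonglongrightarrow> f y" by (rule bounded_linear.tendsto[OF f y])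
      have "f y \<le> (sqrt (cov f f) + 1 / (real m + 1)) + 1 / (real m + 1)" for m
      proof (rule tendsto_upperbound[OF fy])
        show "eventually (\<lambda>n. f (traj x (t n))
            \<le> (sqrt (cov f f) + 1 / (real m + 1)) + 1 / (real m + 1)) sequentially"
          by (rule eventually_compose_filterlim[OF spec[OF elim, of m] t])
      qed simp
      moreover have "(\<lambda>m. (sqrt (cov f f) + 1 / (real m + 1)) + 1 / (real m + 1))
          \<longlonglongrightarrow> sqrt (cov f f)"
      proof -
        have "(\<lambda>m. (c + 1 / (real m + 1)) + 1 / (real m + 1)) \<longlonglongrightarrow> c" for c by real_asymp
        then show ?thesis .
      qed
      ultimately show "f y \<le> sqrt (cov f f)"
        by (meson LIMSEQ_le_const)
    qed
  qed
qed

text \<open>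
  The null sets of countably many functionals can be discarded at once. For a single limit point
  to define a linear form on them, these functionals have to be closed under rational combinations.
\<close>

definition rat_comb :: "(nat \<Rightarrow> 'a \<Rightarrow> real) \<Rightarrow> nat \<Rightarrow> (nat \<Rightarrow> rat) \<Rightarrow> 'a \<Rightarrow> real" where
  "rat_comb F n r x = (\<Sum>i<n. of_rat (r i) * F i x)"

lemma countable_rat_combs: "countable {rat_comb F n r | n r. True}"
proof -
  have "rat_comb F n r = rat_comb F (length (map r [0..<n])) (nth (map r [0..<n]))" for n r
    by (auto simp: rat_comb_def fun_eq_iff)
  then have "{rat_comb F n r | n r. True} \<subseteq> (\<lambda>l. rat_comb F (length l) (nth l)) ` UNIV"
    by blast
  then show ?thesis by (rule countable_subset) simp
qed

lemma rat_comb_lincomb: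
  "\<exists>k s. \<forall>x. of_rat a * rat_comb F n r x + of_rat b * rat_comb F n' r' x = rat_comb F k s x"
proof (intro exI allI)
  fix x
  have ext: "rat_comb F n r x = (\<Sum>i<max n n'. of_rat (if i < n then r i else 0) * F i x)"
    and ext': "rat_comb F n' r' x = (\<Sum>i<max n n'. of_rat (if i < n' then r' i else 0) * F i x)"
    unfolding rat_comb_def by (intro sum.mono_neutral_cong_left; auto)+
  show "of_rat a * rat_comb F n r x + of_rat b * rat_comb F n' r' x
      = rat_comb F (max n n') (\<lambda>i. a * (if i < n then r i else 0) + b * (if i < n' then r' i else 0)) x"
    unfolding ext ext' unfolding rat_comb_def
    by (simp add: sum_distrib_left sum.distrib[symmetric] of_rat_add of_rat_mult algebra_simps
        cong: if_cong)
qed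

lemma bounded_linear_rat_comb:
  assumes "\<And>n. bounded_linear (F n)"
  shows "bounded_linear (rat_comb F n r)"
  unfolding rat_comb_def[abs_def] using assms
  by (intro bounded_linear_sum) (auto intro: bounded_linear_compose[OF bounded_linear_mult_right])

text \<open>
  A limit point \<open>y\<close> acts on the Riesz vectors of a countable rational space of functionals with norm
  at most one, so it is represented there by a vector of the unit ball; the functionals separate
  points.
\<close>

theorem limits_in_unit_ball:
  "AE x in \<mu>. \<forall>y t. filterlim t at_top sequentially \<longrightarrow> (\<lambda>n. traj x (t n)) \<longlonglongrightarrow> y
    \<longrightarrow> y \<in> \<iota> ` cball 0 1"
proof -
  obtain F :: "nat \<Rightarrow> 'a \<Rightarrow> real" where F: "norming_sequence F" using norming_sequence_exists by blast
  define D where "D = {rat_comb F n r | n r. True}"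
  have blF: "bounded_linear (F n)" for n using F by (simp add: norming_sequence_def)
  have blD: "bounded_linear f" if "f \<in> D" for f
    using that bounded_linear_rat_comb[OF blF] by (auto simp: D_def)
  have FD: "F n \<in> D" for n
  proof -
    have "F n = rat_comb F (Suc n) (\<lambda>i. if i = n then 1 else 0)"
      by (simp add: rat_comb_def fun_eq_iff)
    then show ?thesis unfolding D_def by blast
  qed
  have "AE x in \<mu>. \<forall>f\<in>D. \<forall>y t. filterlim t at_top sequentially \<longrightarrow> (\<lambda>n. traj x (t n)) \<longlonglongrightarrow> y
    \<longrightarrow> f y \<le> sqrt (cov f f)"
    by (subst AE_ball_countable[OF countable_rat_combs[of F, folded D_def]])
      (intro ballI limit_le_sqrt_cov blD)
  then show ?thesis
  proof eventually_elim
    case (elim x)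
    show ?case
    proof (intro allI impI)
      fix y t assume "filterlim t at_top sequentially" "(\<lambda>n. traj x (t n)) \<longlonglongrightarrow> y"
      then have le: "f y \<le> sqrt (cov f f)" if "f \<in> D" for f using elim that by blast
      have nr: "norm (riesz f) = sqrt (cov f f)" if "f \<in> D" for f
        using norm_riesz[OF blD[OF that]] by (metis norm_ge_zero real_sqrt_abs abs_of_nonneg)
      define G where "G = (\<lambda>f. (riesz f, f y)) ` D"
      have "\<exists>k. norm k \<le> 1 \<and> (\<forall>(v, c)\<in>G. k \<bullet> v = c)"
      proof (rule riesz_representation_rational)
        show "G \<noteq> {}" using FD by (auto simp: G_def)
        show "c \<le> 1 * norm v" if "(v, c) \<in> G" for v c using that le nr by (auto simp: G_def)
        fix p q and r s :: real assume p: "p \<in> G" and q: "q \<in> G" and r: "r \<in> \<rat>" and s: "s \<in> \<rat>"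
        obtain f g where fg: "f \<in> D" "g \<in> D" "p = (riesz f, f y)" "q = (riesz g, g y)"
          using p q by (auto simp: G_def)
        obtain a b where ab: "r = of_rat a" "s = of_rat b" using r s by (auto elim!: Rats_cases)
        have "(\<lambda>x. r * f x + s * g x) \<in> D"
        proof -
          obtain n u n' u' where "f = rat_comb F n u" "g = rat_comb F n' u'"
            using fg(1,2) by (auto simp: D_def)
          then obtain k w where "\<forall>x. r * f x + s * g x = rat_comb F k w x"
            using rat_comb_lincomb[of a F n u b n' u'] ab by auto
          then have "(\<lambda>x. r * f x + s * g x) = rat_comb F k w" by auto
          then show ?thesis unfolding D_def by blast
        qed
        moreover have "r *\<^sub>R p + s *\<^sub>R q
            = (riesz (\<lambda>x. r * f x + s * g x), (\<lambda>x. r * f x + s * g x) y)"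
          by (simp add: fg(3,4) riesz_lincomb[OF blD[OF fg(1)] blD[OF fg(2)]])
        ultimately show "r *\<^sub>R p + s *\<^sub>R q \<in> G" unfolding G_def by blast
      qed simp
      then obtain k where k: "norm k \<le> 1" "\<And>f. f \<in> D \<Longrightarrow> k \<bullet> riesz f = f y"
        by (auto simp: G_def)
      have "F n (\<iota> k) = F n y" for n
        using riesz_inner[OF blF, of n k] k(2)[OF FD[of n]] by (metis inner_commute)
      then have "\<iota> k = y" by (rule norming_sequence_separates[OF F])
      then show "y \<in> \<iota> ` cball 0 1" using k(1) by force
    qed
  qed
qed

text \<open>Being near compact sets up to every \<open>\<epsilon>\<close> is total boundedness.\<close>

theorem trajectories_relatively_compact:
  "AE x in \<mu>. \<forall>t. filterlim t at_top sequentially \<longrightarrow>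
    (\<exists>r y. strict_mono r \<and> (\<lambda>n. traj x (t (r n))) \<longlonglongrightarrow> y)"
proof -
  have "AE x in \<mu>. \<forall>m::nat. \<exists>K. compact K \<and>
      eventually (\<lambda>t. \<exists>c\<in>K. norm (traj x t - c) \<le> 1 / (real m + 1)) at_top"
    by (subst AE_all_countable) (auto intro: eventually_near_compact)
  then show ?thesis
  proof eventually_elim
    case (elim x)
    show ?case
    proof (intro allI impI)
      fix t :: "nat \<Rightarrow> real" assume t: "filterlim t at_top sequentially"
      define z where "z n = traj x (t n)" for n :: nat
      have tb: "\<exists>k. finite k \<and> range z \<subseteq> (\<Union>c\<in>k. ball c e)" if e: "e > 0" for e
      proof -
        obtain m where m: "1 / real (Suc m) < e / 2" using nat_approx_posE[of "e / 2"] e by auto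
        obtain K where K: "compact K"
          "eventually (\<lambda>t. \<exists>c\<in>K. norm (traj x t - c) \<le> 1 / (real m + 1)) at_top"
          using elim by blast
        have "eventually (\<lambda>n. \<exists>c\<in>K. norm (z n - c) \<le> 1 / (real m + 1)) sequentially"
          unfolding z_def by (rule eventually_compose_filterlim[OF K(2) t])
        then obtain N where N: "\<And>n. n \<ge> N \<Longrightarrow> \<exists>c\<in>K. norm (z n - c) \<le> 1 / (real m + 1)"
          unfolding eventually_sequentially by blast
        obtain k where k: "finite k" "K \<subseteq> (\<Union>c\<in>k. ball c (e / 2))"
          using K(1) e unfolding compact_eq_totally_bounded by (meson half_gt_zero)
        have "z n \<in> (\<Union>c\<in>k \<union> z ` {..<N}. ball c e)" for n
        proof (cases "n < N")
          case True
          then show ?thesis using e by force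
        next
          case False
          then obtain c where c: "c \<in> K" "norm (z n - c) \<le> 1 / (real m + 1)" using N[of n] by (auto simp: not_less)
          then obtain c' where c': "c' \<in> k" "dist c' c < e / 2" using k(2) by force
          have "dist c' (z n) \<le> dist c' c + dist c (z n)" by (rule dist_triangle)
          also have "\<dots> < e" using c c' m by (simp add: dist_norm norm_minus_commute add.commute)
          finally show ?thesis using c'(1) by auto
        qed
        then have "range z \<subseteq> (\<Union>c\<in>k \<union> z ` {..<N}. ball c e)" by blast
        moreover have "finite (k \<union> z ` {..<N})" using k(1) by simp
        ultimately show ?thesis by blast
      qed
      have "compact (closure (range z))"
        unfolding compact_eq_totally_bounded complete_eq_closed
      proof (intro conjI allI impI)
        show "closed (closure (range z))" by simp
        fix e :: real assume e: "e > 0"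
        obtain k where k: "finite k" "range z \<subseteq> (\<Union>c\<in>k. ball c (e / 2))" using tb[of "e / 2"] e by auto
        have "closed (\<Union>c\<in>k. cball c (e / 2))" using k(1) by (intro closed_UN) auto
        moreover have "(\<Union>c\<in>k. ball c (e / 2)) \<subseteq> (\<Union>c\<in>k. cball c (e / 2))"
          by (rule UN_mono) auto
        ultimately have "closure (range z) \<subseteq> (\<Union>c\<in>k. cball c (e / 2))"
          using k(2) by (meson closure_minimal order_trans)
        also have "\<dots> \<subseteq> (\<Union>c\<in>k. ball c e)" by (rule UN_mono) (use e in auto)
        finally show "\<exists>k. finite k \<and> closure (range z) \<subseteq> (\<Union>c\<in>k. ball c e)"
          using k(1) by blast
      qed
      then obtain l r where "strict_mono r" "(z \<circ> r) \<longlonglongrightarrow> l"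
        using compact_imp_seq_compact seq_compactE closure_subset by (metis range_subsetD)
      then show "\<exists>r y. strict_mono r \<and> (\<lambda>n. traj x (t (r n))) \<longlonglongrightarrow> y"
        by (auto simp: z_def comp_def)
    qed
  qed
qed

end

section \<open>Maxima of weakly correlated Gaussian functionals\<close>

text \<open>
  Integrating \<open>2 l N - l\<^sup>2 N\<^sup>2 \<le> 1\<close>, valid wherever the number \<open>N\<close> of events that occur is positive,
  with the best constant \<open>l\<close>.
\<close>

lemma (in prob_space) second_moment_union:
  assumes I: "finite I" "I \<noteq> {}" and A: "\<And>i. i \<in> I \<Longrightarrow> A i \<in> events"
    and p: "p > 0" "\<And>i. i \<in> I \<Longrightarrow> prob (A i) = p"
    and q: "q \<ge> 0" "\<And>i j. i \<in> I \<Longrightarrow> j \<in> I \<Longrightarrow> i \<noteq> j \<Longrightarrow> prob (A i \<inter> A j) \<le> q"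
  shows "1 \<le> prob (\<Union>i\<in>I. A i) * (1 / (real (card I) * p) + q / p\<^sup>2)"
proof -
  define n where "n = real (card I)"
  have n: "n > 0" using I by (simp add: n_def card_gt_0_iff)
  define X where "X x = (\<Sum>i\<in>I. indicat_real (A i) x)" for x
  define D where "D = n * p + n\<^sup>2 * q"
  have D: "D > 0" using n p q by (simp add: D_def add_pos_nonneg)
  define l where "l = n * p / D"
  have U: "(\<Union>i\<in>I. A i) \<in> events" using I A by auto
  have X2: "(X x)\<^sup>2 = (\<Sum>i\<in>I. \<Sum>j\<in>I. indicat_real (A i \<inter> A j) x)" for x
    by (simp add: X_def power2_eq_square sum_product indicator_inter_arith)
  have intA: "integrable M (indicat_real B)" if "B \<in> events" for B
    using that by (intro integrable_real_indicator) (auto simp: less_top[symmetric])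
  have intX: "integrable M X" and EX: "(\<integral>x. X x \<partial>M) = n * p"
    unfolding X_def using A p intA by (simp_all add: n_def)
  have int2: "integrable M (\<lambda>x. (X x)\<^sup>2)"
    unfolding X2 using A by (intro Bochner_Integration.integrable_sum intA) auto
  have "(\<integral>x. (X x)\<^sup>2 \<partial>M) = (\<Sum>i\<in>I. \<Sum>j\<in>I. prob (A i \<inter> A j))"
    unfolding X2 using A intA by (simp add: Bochner_Integration.integral_sum sets.Int)
  also have "\<dots> \<le> (\<Sum>i\<in>I. \<Sum>j\<in>I. (if i = j then p else 0) + q)"
    using p q by (intro sum_mono) auto
  also have "\<dots> = D"
    using I by (simp add: sum.distrib D_def n_def power2_eq_square algebra_simps)
  finally have EX2: "(\<integral>x. (X x)\<^sup>2 \<partial>M) \<le> D" .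
  have "2 * l * X x - l\<^sup>2 * (X x)\<^sup>2 \<le> indicat_real (\<Union>i\<in>I. A i) x" for x
  proof (cases "x \<in> (\<Union>i\<in>I. A i)")
    case True
    have "0 \<le> (1 - l * X x)\<^sup>2" by simp
    then show ?thesis using True by (simp add: power2_diff power_mult_distrib)
  next
    case False
    then have "X x = 0" unfolding X_def by (intro sum.neutral) auto
    then show ?thesis by simp
  qed
  then have "(\<integral>x. 2 * l * X x - l\<^sup>2 * (X x)\<^sup>2 \<partial>M) \<le> (\<integral>x. indicat_real (\<Union>i\<in>I. A i) x \<partial>M)"
    using intX int2 intA[OF U] by (intro integral_mono) auto
  then have "2 * l * (n * p) - l\<^sup>2 * (\<integral>x. (X x)\<^sup>2 \<partial>M) \<le> prob (\<Union>i\<in>I. A i)"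
    using intX int2 U by (simp add: EX)
  moreover have "l\<^sup>2 * (\<integral>x. (X x)\<^sup>2 \<partial>M) \<le> l\<^sup>2 * D" by (rule mult_left_mono[OF EX2]) simp
  moreover have "2 * l * (n * p) - l\<^sup>2 * D = (n * p)\<^sup>2 / D"
    using D by (simp add: l_def power2_eq_square field_simps)
  ultimately have "(n * p)\<^sup>2 / D \<le> prob (\<Union>i\<in>I. A i)" by linarith
  then have "(n * p)\<^sup>2 / D * (D / (n * p)\<^sup>2) \<le> prob (\<Union>i\<in>I. A i) * (D / (n * p)\<^sup>2)"
    using D by (intro mult_right_mono) auto
  moreover have "D / (n * p)\<^sup>2 = 1 / (n * p) + q / p\<^sup>2"
    using n p by (simp add: D_def power2_eq_square field_simps)
  moreover have "(n * p)\<^sup>2 / D * (D / (n * p)\<^sup>2) = 1" using D n p by simp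
  ultimately show ?thesis unfolding n_def by metis
qed

context centered_gaussian_measure
begin

text \<open>
  The point \<open>v\<close> is rotated back by the angle \<open>\<Delta>\<close> towards an independent vector \<open>w\<close>. If the
  maximum was lower before by \<open>d / n\<close>, then the functional which attains the maximum at \<open>v\<close> was
  lower by at least that amount. As this functional is chosen independently of \<open>w\<close>, its value at
  \<open>w\<close> is controlled by a single Gaussian tail instead of a union bound; its value at \<open>v\<close> enters
  only with the factor \<open>1 - cos \<Delta>\<close>, of second order in \<open>1 / n\<close>.
\<close>

lemma max_rise_step:
  fixes g :: "nat \<Rightarrow> 'a \<Rightarrow> real"
  assumes I: "finite I" "I \<noteq> {}"
    and g: "\<And>i. i \<in> I \<Longrightarrow> bounded_linear (g i)" "\<And>i. i \<in> I \<Longrightarrow> cov (g i) (g i) = 1"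
    and d: "d > 0" and n: "n \<ge> (1 :: nat)" and \<Delta>: "\<Delta> = pi / (2 * real n)"
    and Mx: "\<And>x. Mx x = Max ((\<lambda>i. g i x) ` I)"
    and Q: "Q = {(v, w). d / real n \<le> Mx v - Mx (cos \<Delta> *\<^sub>R v - sin \<Delta> *\<^sub>R w)}"
  shows "Q \<in> sets borel" (is ?thesis1)
    and "pair.prob Q
      \<le> real (card I) * exp (- ((real n * d / 4)\<^sup>2 / 2)) + exp (- ((d / 4)\<^sup>2 / 2))" (is ?thesis2)
proof -
  have gb [measurable]: "g i \<in> borel_measurable borel" if "i \<in> I" for i
    using g(1)[OF that] by (rule bounded_linear_measurable)
  have Mb [measurable]: "Mx \<in> borel_measurable borel"
    unfolding Mx by (rule borel_measurable_Max[OF I(1)]) (rule gb)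
  have "(\<lambda>p. cos \<Delta> *\<^sub>R fst p - sin \<Delta> *\<^sub>R snd p) \<in> borel_measurable (borel :: ('a \<times> 'a) measure)"
    by (intro borel_measurable_continuous_onI continuous_intros)
  then have "(\<lambda>p. Mx (cos \<Delta> *\<^sub>R fst p - sin \<Delta> *\<^sub>R snd p)) \<in> borel_measurable (borel :: ('a \<times> 'a) measure)"
    by (rule measurable_compose[OF _ Mb])
  moreover have "(fst :: 'a \<times> 'a \<Rightarrow> 'a) \<in> borel_measurable borel"
    by (intro borel_measurable_continuous_onI continuous_intros)
  then have "(\<lambda>p :: 'a \<times> 'a. Mx (fst p)) \<in> borel_measurable borel"
    by (rule measurable_compose[OF _ Mb])
  ultimately have Qm: "{p \<in> space borel. d / real n \<le> Mx (fst p) - Mx (cos \<Delta> *\<^sub>R fst p - sin \<Delta> *\<^sub>R snd p)} \<in> sets borel"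
    by measurable
  have "Q = {p \<in> space borel. d / real n \<le> Mx (fst p) - Mx (cos \<Delta> *\<^sub>R fst p - sin \<Delta> *\<^sub>R snd p)}"
    by (auto simp: Q)
  then show Qb: ?thesis1 using Qm by (simp only:)
  define H where "H i = {w. d / 4 \<le> g i w}" for i
  define G where "G i = {v. real n * d / 4 \<le> g i v}" for i
  define A where "A i = {v. g i v = Mx v \<and> (\<forall>j\<in>I \<inter> {..<i}. g j v \<noteq> Mx v)}" for i
  have HG: "H i \<in> sets borel" "G i \<in> sets borel" if "i \<in> I" for i
    unfolding H_def G_def using gb[OF that] by (auto intro!: borel_measurable_le)
  have Ab: "A i \<in> sets borel" if "i \<in> I" for i
  proof -
    have [measurable]: "g i \<in> borel_measurable borel" using gb[OF that] .
    have "A i = {v \<in> space borel. g i v = Mx v} - (\<Union>j\<in>I \<inter> {..<i}. {v \<in> space borel. g j v = Mx v})"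
      by (auto simp: A_def)
    also have "\<dots> \<in> sets borel"
      using I(1) gb by (intro sets.Diff sets.finite_UN) (auto intro!: borel_measurable_eq)
    finally show ?thesis .
  qed
  \<comment> \<open>The crude bound \<open>pi \<le> 4\<close> gives the constants \<open>1 / 4\<close> in the statement.\<close>
  have pi4: "pi \<le> 4" using pi_less_4 by simp
  have n0: "real n > 0" using n by simp
  have \<Delta>0: "0 \<le> \<Delta>" "\<Delta> \<le> pi" using n pi_gt_zero by (auto simp: \<Delta> field_simps)
  have sin: "0 \<le> sin \<Delta>" "sin \<Delta> \<le> pi / (2 * real n)"
    using sin_ge_zero[OF \<Delta>0] sin_x_le_x[OF \<Delta>0(1)] by (auto simp: \<Delta>)
  have cos: "0 \<le> 1 - cos \<Delta>" "1 - cos \<Delta> \<le> 2 / (real n)\<^sup>2"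
  proof -
    show "0 \<le> 1 - cos \<Delta>" using cos_le_one[of \<Delta>] by simp
    have "1 - cos \<Delta> = 2 * (sin (\<Delta> / 2))\<^sup>2" using cos_double_sin[of "\<Delta> / 2"] by simp
    also have "\<dots> \<le> 2 * (\<Delta> / 2)\<^sup>2"
      using sin_x_le_x[of "\<Delta> / 2"] \<Delta>0 sin_ge_zero[of "\<Delta> / 2"]
      by (intro mult_left_mono power_mono) auto
    also have "\<dots> = pi\<^sup>2 / 8 / (real n)\<^sup>2" by (simp add: \<Delta> power_divide power_mult_distrib)
    also have "\<dots> \<le> 2 / (real n)\<^sup>2"
      using power_mono[OF pi4, of 2] pi_ge_zero by (intro divide_right_mono) auto
    finally show "1 - cos \<Delta> \<le> 2 / (real n)\<^sup>2" .
  qed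
  have sub: "Q \<subseteq> ((\<Union>i\<in>I. G i) \<times> UNIV) \<union> (\<Union>i\<in>I. A i \<times> H i)"
  proof
    fix p assume "p \<in> Q"
    then obtain v w where vw: "p = (v, w)"
      and rise: "d / real n \<le> Mx v - Mx (cos \<Delta> *\<^sub>R v - sin \<Delta> *\<^sub>R w)" by (auto simp: Q)
    have "Mx v \<in> (\<lambda>i. g i v) ` I" unfolding Mx using I by (intro Max_in) auto
    then have ex: "\<exists>i. i \<in> I \<and> g i v = Mx v" by auto
    define i where "i = (LEAST i. i \<in> I \<and> g i v = Mx v)"
    have i: "i \<in> I" "g i v = Mx v" using LeastI_ex[OF ex] by (auto simp: i_def)
    have "v \<in> A i"
    proof -
      have "g j v \<noteq> Mx v" if "j \<in> I" "j < i" for j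
        using not_less_Least[OF that(2)[unfolded i_def]] that(1) by blast
      then show ?thesis using i(2) by (simp add: A_def)
    qed
    interpret gi: bounded_linear "g i" by (rule g(1)[OF i(1)])
    have "g i (cos \<Delta> *\<^sub>R v - sin \<Delta> *\<^sub>R w) \<le> Mx (cos \<Delta> *\<^sub>R v - sin \<Delta> *\<^sub>R w)"
      unfolding Mx using I i by (intro Max_ge) auto
    then have "d / real n \<le> (1 - cos \<Delta>) * g i v + sin \<Delta> * g i w"
      using rise by (simp add: gi.diff gi.scaleR i(2) algebra_simps)
    then have "d / (2 * real n) \<le> (1 - cos \<Delta>) * g i v \<or> d / (2 * real n) \<le> sin \<Delta> * g i w"
      using n0 by (auto simp: field_simps)
    then show "p \<in> ((\<Union>i\<in>I. G i) \<times> UNIV) \<union> (\<Union>i\<in>I. A i \<times> H i)"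
    proof
      assume *: "d / (2 * real n) \<le> (1 - cos \<Delta>) * g i v"
      have "0 < d / (2 * real n)" using d n0 by simp
      then have "g i v > 0" using * cos(1) by (smt (verit) mult_nonneg_nonpos)
      then have "(1 - cos \<Delta>) * g i v \<le> 2 / (real n)\<^sup>2 * g i v"
        using cos(2) by (intro mult_right_mono) auto
      then have "d / (2 * real n) \<le> 2 / (real n)\<^sup>2 * g i v" using * by simp
      then have "real n * d / 4 \<le> g i v" using n0 by (simp add: field_simps power2_eq_square)
      then have "v \<in> G i" by (simp add: G_def)
      then show ?thesis using i(1) vw by blast
    next
      assume *: "d / (2 * real n) \<le> sin \<Delta> * g i w"
      have "0 < d / (2 * real n)" using d n0 by simp
      then have pos: "g i w > 0" using * sin(1) by (smt (verit) mult_nonneg_nonpos)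
      then have "sin \<Delta> * g i w \<le> pi / (2 * real n) * g i w"
        using sin(2) by (intro mult_right_mono) auto
      then have "d / (2 * real n) \<le> pi / (2 * real n) * g i w" using * by simp
      then have "d \<le> pi * g i w" using n0 by (simp add: field_simps)
      also have "\<dots> \<le> 4 * g i w" using pi4 pos by (intro mult_right_mono) auto
      finally show ?thesis using i vw \<open>v \<in> A i\<close> by (auto simp: H_def)
    qed
  qed
  have UNb: "(UNIV :: 'a set) \<in> sets borel" by simp
  have GUb: "(\<Union>i\<in>I. G i) \<in> sets borel" using I(1) HG by (intro sets.finite_UN) auto
  have b1: "(\<Union>i\<in>I. G i) \<times> UNIV \<in> sets (\<mu> \<Otimes>\<^sub>M \<mu>)"
    using GUb by (auto simp: sets_eq_borel)
  have b2: "A i \<times> H i \<in> sets (\<mu> \<Otimes>\<^sub>M \<mu>)" if "i \<in> I" for i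
    using Ab[OF that] HG[OF that] by (auto simp: sets_eq_borel)
  have b3: "(\<Union>i\<in>I. A i \<times> H i) \<in> sets (\<mu> \<Otimes>\<^sub>M \<mu>)" using I(1) b2 by (intro sets.finite_UN) auto
  have m1: "pair.prob ((\<Union>i\<in>I. G i) \<times> UNIV)
      \<le> real (card I) * exp (- ((real n * d / 4)\<^sup>2 / 2))"
  proof -
    have "pair.prob ((\<Union>i\<in>I. G i) \<times> UNIV) = prob (\<Union>i\<in>I. G i)"
      using prob_Times[OF GUb UNb] prob_space by simp
    also have "\<dots> \<le> (\<Sum>i\<in>I. prob (G i))"
      using I(1) HG by (intro finite_measure_subadditive_finite) (auto simp: sets_eq_borel)
    also have "\<dots> \<le> (\<Sum>i\<in>I. exp (- ((real n * d / 4)\<^sup>2 / 2)))"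
    proof (rule sum_mono)
      fix i assume i: "i \<in> I"
      show "prob (G i) \<le> exp (- ((real n * d / 4)\<^sup>2 / 2))"
        unfolding G_def using tail_le[OF g(1)[OF i], of 1 "real n * d / 4"] g(2)[OF i] n0 d by simp
    qed
    finally show ?thesis by simp
  qed
  have m2: "pair.prob (\<Union>i\<in>I. A i \<times> H i) \<le> exp (- ((d / 4)\<^sup>2 / 2))"
  proof -
    have "pair.prob (\<Union>i\<in>I. A i \<times> H i) \<le> (\<Sum>i\<in>I. pair.prob (A i \<times> H i))"
      using I(1) b2 by (intro pair.finite_measure_subadditive_finite) auto
    also have "\<dots> = (\<Sum>i\<in>I. prob (A i) * prob (H i))"
      using Ab HG by (intro sum.cong) (auto simp: prob_Times)
    also have "\<dots> \<le> (\<Sum>i\<in>I. prob (A i) * exp (- ((d / 4)\<^sup>2 / 2)))"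
    proof (rule sum_mono, rule mult_left_mono)
      fix i assume i: "i \<in> I"
      show "prob (H i) \<le> exp (- ((d / 4)\<^sup>2 / 2))"
        unfolding H_def using tail_le[OF g(1)[OF i], of 1 "d / 4"] g(2)[OF i] d by simp
    qed simp
    also have "\<dots> = (\<Sum>i\<in>I. prob (A i)) * exp (- ((d / 4)\<^sup>2 / 2))" by (simp add: sum_distrib_right)
    also have "\<dots> \<le> 1 * exp (- ((d / 4)\<^sup>2 / 2))"
    proof (rule mult_right_mono)
      have "disjoint_family_on A I"
        unfolding disjoint_family_on_def
      proof (intro ballI impI)
        fix i j assume "i \<in> I" "j \<in> I" "i \<noteq> j"
        then show "A i \<inter> A j = {}" by (cases "i < j") (auto simp: A_def)
      qed
      then have "(\<Sum>i\<in>I. prob (A i)) = prob (\<Union>i\<in>I. A i)"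
        using I(1) Ab by (intro finite_measure_finite_Union[symmetric]) (auto simp: sets_eq_borel)
      then show "(\<Sum>i\<in>I. prob (A i)) \<le> 1" by simp
    qed simp
    finally show ?thesis by simp
  qed
  have "pair.prob Q \<le> pair.prob (((\<Union>i\<in>I. G i) \<times> UNIV) \<union> (\<Union>i\<in>I. A i \<times> H i))"
    by (rule pair.finite_measure_mono[OF sub]) (use b1 b3 in auto)
  also have "\<dots> \<le> pair.prob ((\<Union>i\<in>I. G i) \<times> UNIV) + pair.prob (\<Union>i\<in>I. A i \<times> H i)"
    by (rule measure_Un_le[OF b1 b3])
  finally show ?thesis2 using m1 m2 by simp
qed

text \<open>
  A concentration inequality for maxima, in multiplicative form. An independent pair \<open>(x, y)\<close> is
  joined by the arc \<open>cos \<theta> *\<^sub>R x + sin \<theta> *\<^sub>R y\<close>, cut into \<open>n\<close> steps; if the maximum rises by more than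
  \<open>d\<close> along the arc, it rises by at least \<open>d / n\<close> in one step, and by rotation invariance all steps
  are equally likely to do so.
\<close>

lemma max_concentration:
  fixes g :: "nat \<Rightarrow> 'a \<Rightarrow> real"
  assumes I: "finite I" "I \<noteq> {}"
    and g: "\<And>i. i \<in> I \<Longrightarrow> bounded_linear (g i)" "\<And>i. i \<in> I \<Longrightarrow> cov (g i) (g i) = 1"
    and d: "d > 0" and n: "n \<ge> (1 :: nat)"
  shows "prob {x. \<exists>i\<in>I. u \<le> g i x} * prob {x. \<forall>i\<in>I. g i x < u - d}
    \<le> real n * (real (card I) * exp (- ((real n * d / 4)\<^sup>2 / 2)) + exp (- ((d / 4)\<^sup>2 / 2)))"
proof -
  define \<Delta> where "\<Delta> = pi / (2 * real n)"
  define Mx where "Mx x = Max ((\<lambda>i. g i x) ` I)" for x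
  define Q where "Q = {(v, w). d / real n \<le> Mx v - Mx (cos \<Delta> *\<^sub>R v - sin \<Delta> *\<^sub>R w)}"
  note step = max_rise_step[OF I g d n \<Delta>_def Mx_def Q_def]
  define \<theta> where "\<theta> k = real k * \<Delta>" for k
  define R where "R k = {p. rotate (cos (\<theta> k)) (sin (\<theta> k)) p \<in> Q}" for k
  define X where "X k p = cos (\<theta> k) *\<^sub>R fst p + sin (\<theta> k) *\<^sub>R snd p" for k and p :: "'a \<times> 'a"
  have n0: "real n > 0" using n by simp
  have gb: "g i \<in> borel_measurable borel" if "i \<in> I" for i
    using g(1)[OF that] by (rule bounded_linear_measurable)
  have Mb [measurable]: "Mx \<in> borel_measurable borel"
    unfolding Mx_def by (rule borel_measurable_Max[OF I(1)]) (rule gb)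
  have A_eq: "{x. \<exists>i\<in>I. u \<le> g i x} = {x \<in> space borel. u \<le> Mx x}"
    unfolding Mx_def using I by (auto simp: Max_ge_iff)
  have B_eq: "{x. \<forall>i\<in>I. g i x < u - d} = {x \<in> space borel. Mx x < u - d}"
    unfolding Mx_def using I by auto
  have Ab: "{x. \<exists>i\<in>I. u \<le> g i x} \<in> sets borel" unfolding A_eq by measurable
  have Bb: "{x. \<forall>i\<in>I. g i x < u - d} \<in> sets borel" unfolding B_eq by measurable
  have Rk: "{p. p \<in> R k} \<in> sets (\<mu> \<Otimes>\<^sub>M \<mu>)" for k
  proof -
    have "rotate (cos (\<theta> k)) (sin (\<theta> k)) \<in> borel_measurable borel"
      by (rule borel_measurable_continuous_onI) (rule continuous_rotate)
    from measurable_sets[OF this step(1)] show ?thesis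
      unfolding sets_pair_borel by (simp add: R_def vimage_def)
  qed
  have end0: "X 0 p = fst p" for p by (simp add: X_def \<theta>_def)
  have endn: "X n p = snd p" for p
  proof -
    have "\<theta> n = pi / 2" using n0 by (simp add: \<theta>_def \<Delta>_def)
    then show ?thesis unfolding X_def by (simp only: cos_pi_half sin_pi_half) simp
  qed
  have R_rise: "p \<in> R (Suc k)" if "d / real n \<le> Mx (X (Suc k) p) - Mx (X k p)" for k p
  proof -
    have th: "\<theta> k = \<theta> (Suc k) - \<Delta>" by (simp add: \<theta>_def algebra_simps)
    have "X k p = cos \<Delta> *\<^sub>R X (Suc k) p
        - sin \<Delta> *\<^sub>R (- sin (\<theta> (Suc k)) *\<^sub>R fst p + cos (\<theta> (Suc k)) *\<^sub>R snd p)"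
      unfolding X_def th cos_diff sin_diff by (simp add: algebra_simps)
    then show ?thesis
      using that by (cases p) (simp add: R_def Q_def rotate_def X_def)
  qed
  have sub: "{x. \<forall>i\<in>I. g i x < u - d} \<times> {x. \<exists>i\<in>I. u \<le> g i x} \<subseteq> (\<Union>k\<in>{..<n}. R (Suc k))"
  proof
    fix p assume "p \<in> {x. \<forall>i\<in>I. g i x < u - d} \<times> {x. \<exists>i\<in>I. u \<le> g i x}"
    then have "Mx (fst p) < u - d" "u \<le> Mx (snd p)" unfolding A_eq B_eq by auto
    then have "d < Mx (X n p) - Mx (X 0 p)" by (simp add: end0 endn)
    also have "\<dots> = (\<Sum>k<n. Mx (X (Suc k) p) - Mx (X k p))" by (rule sum_lessThan_telescope[of "\<lambda>k. Mx (X k p)" n, symmetric])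
    finally have "d < (\<Sum>k<n. Mx (X (Suc k) p) - Mx (X k p))" .
    moreover have "(\<Sum>k<n. Mx (X (Suc k) p) - Mx (X k p)) \<le> (\<Sum>k<n. d / real n)"
      if "\<forall>k<n. Mx (X (Suc k) p) - Mx (X k p) < d / real n"
      using that by (intro sum_mono) (auto intro: less_imp_le)
    ultimately have "\<exists>k<n. d / real n \<le> Mx (X (Suc k) p) - Mx (X k p)"
      using n0 by (force simp: not_le)
    then show "p \<in> (\<Union>k\<in>{..<n}. R (Suc k))" using R_rise by blast
  qed
  have "prob {x. \<exists>i\<in>I. u \<le> g i x} * prob {x. \<forall>i\<in>I. g i x < u - d}
      = pair.prob ({x. \<forall>i\<in>I. g i x < u - d} \<times> {x. \<exists>i\<in>I. u \<le> g i x})"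
    by (simp only: prob_Times[OF Bb Ab] mult.commute)
  also have "\<dots> \<le> pair.prob (\<Union>k\<in>{..<n}. R (Suc k))"
    by (rule pair.finite_measure_mono[OF sub]) (use Rk in \<open>auto intro!: sets.finite_UN\<close>)
  also have "\<dots> \<le> (\<Sum>k<n. pair.prob (R (Suc k)))"
    by (rule pair.finite_measure_subadditive_finite) (use Rk in auto)
  also have "\<dots> = (\<Sum>k<n. pair.prob Q)"
    unfolding R_def by (intro sum.cong refl prob_rotate step(1)) simp
  also have "\<dots> = real n * pair.prob Q" by simp
  also have "\<dots> \<le> real n * (real (card I) * exp (- ((real n * d / 4)\<^sup>2 / 2)) + exp (- ((d / 4)\<^sup>2 / 2)))"
    using step(2) by (intro mult_left_mono) auto
  finally show ?thesis .
qed

text \<open>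
  The second moment bound alone shows that the level \<open>u\<close> is reached with probability at least
  \<open>1 / (1 / (N p) + q / p\<^sup>2)\<close>, which may be small; concentration brings this probability close to
  one, at the price of lowering the level by \<open>d\<close>.
\<close>

lemma max_lower_bound:
  fixes g :: "nat \<Rightarrow> 'a \<Rightarrow> real"
  assumes I: "finite I" "I \<noteq> {}"
    and g: "\<And>i. i \<in> I \<Longrightarrow> bounded_linear (g i)" "\<And>i. i \<in> I \<Longrightarrow> cov (g i) (g i) = 1"
    and corr: "\<And>i j. i \<in> I \<Longrightarrow> j \<in> I \<Longrightarrow> i \<noteq> j \<Longrightarrow> cov (g i) (g j) \<le> \<epsilon>" and \<epsilon>: "\<epsilon> > 0"
    and stat: "\<And>i. i \<in> I \<Longrightarrow> prob {x. u \<le> g i x} = p"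
    and u: "u \<ge> 0" and d: "d > 0" and n: "n \<ge> (1 :: nat)"
  defines "\<phi> \<equiv> std_normal_density (u + 1)"
  shows "prob {x. \<forall>i\<in>I. g i x < u - d}
    \<le> (1 / (real (card I) * \<phi>) + exp (- (u\<^sup>2 / (1 + \<epsilon>))) / \<phi>\<^sup>2) *
      (real n * (real (card I) * exp (- ((real n * d / 4)\<^sup>2 / 2)) + exp (- ((d / 4)\<^sup>2 / 2))))"
proof -
  define q where "q = exp (- (u\<^sup>2 / (1 + \<epsilon>)))"
  define A where "A i = {x. u \<le> g i x}" for i
  define c where "c = real (card I)"
  have c: "c > 0" using I by (simp add: c_def card_gt_0_iff)
  have gm [measurable]: "g i \<in> borel_measurable \<mu>" if "i \<in> I" for i
    using g(1)[OF that] by (rule bl_measurable)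
  have A: "A i \<in> events" if "i \<in> I" for i
  proof -
    have "{x \<in> space \<mu>. u \<le> g i x} \<in> events"
      using gm[OF that] by (intro borel_measurable_le) auto
    then show ?thesis by (simp add: A_def)
  qed
  have \<phi>: "\<phi> > 0" unfolding \<phi>_def by (rule normal_density_pos) simp
  obtain i0 where i0: "i0 \<in> I" using I by blast
  have p\<phi>: "\<phi> \<le> p" using tail_ge[OF g(1)[OF i0] g(2)[OF i0] u] stat[OF i0] by (simp add: \<phi>_def)
  then have p: "p > 0" using \<phi> by simp
  have q: "prob (A i \<inter> A j) \<le> q" if ij: "i \<in> I" "j \<in> I" "i \<noteq> j" for i j
  proof -
    define h where "h x = 1 * g i x + 1 * g j x" for x
    have h: "bounded_linear h" unfolding h_def[abs_def] by (rule bounded_linear_lincomb) (use g ij in auto)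
    have [measurable]: "h \<in> borel_measurable \<mu>" by (rule bl_measurable[OF h])
    have "cov h h = cov (g i) (g i) + 2 * cov (g i) (g j) + cov (g j) (g j)"
      unfolding h_def[abs_def] cov_lincomb[OF g(1)[OF ij(1)] g(1)[OF ij(2)]] by simp
    then have v: "cov h h \<le> 2 + 2 * \<epsilon>" using g(2) corr[OF ij] ij by simp
    have "prob (A i \<inter> A j) \<le> prob {x. 2 * u \<le> h x}"
    proof (rule finite_measure_mono)
      have "{x \<in> space \<mu>. 2 * u \<le> h x} \<in> events" by measurable
      then show "{x. 2 * u \<le> h x} \<in> events" by simp
    qed (auto simp: A_def h_def)
    also have "\<dots> \<le> exp (- ((2 * u)\<^sup>2 / (2 * (2 + 2 * \<epsilon>))))"
      by (rule tail_le[OF h v]) (use \<epsilon> u in auto)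
    also have "(2 * u)\<^sup>2 / (2 * (2 + 2 * \<epsilon>)) = u\<^sup>2 / (1 + \<epsilon>)"
      using \<epsilon> by (simp add: field_simps power2_eq_square)
    finally show ?thesis by (simp add: q_def)
  qed
  have "1 \<le> prob (\<Union>i\<in>I. A i) * (1 / (c * p) + q / p\<^sup>2)"
    unfolding c_def
    by (rule second_moment_union[OF I A p]) (use stat q in \<open>auto simp: A_def q_def\<close>)
  also have "\<dots> \<le> prob (\<Union>i\<in>I. A i) * (1 / (c * \<phi>) + q / \<phi>\<^sup>2)"
    using p\<phi> \<phi> c by (intro mult_left_mono add_mono divide_left_mono mult_pos_pos power_mono) (auto simp: q_def)
  finally have sm: "1 \<le> prob (\<Union>i\<in>I. A i) * (1 / (c * \<phi>) + q / \<phi>\<^sup>2)" .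
  have X: "0 \<le> 1 / (c * \<phi>) + q / \<phi>\<^sup>2" using c \<phi> by (simp add: q_def)
  have UA: "(\<Union>i\<in>I. A i) = {x. \<exists>i\<in>I. u \<le> g i x}" by (auto simp: A_def)
  have "prob {x. \<forall>i\<in>I. g i x < u - d}
      \<le> (prob (\<Union>i\<in>I. A i) * (1 / (c * \<phi>) + q / \<phi>\<^sup>2)) * prob {x. \<forall>i\<in>I. g i x < u - d}"
    using sm by (simp add: mult_le_cancel_right1 not_less)
  also have "\<dots> = (1 / (c * \<phi>) + q / \<phi>\<^sup>2) * (prob {x. \<exists>i\<in>I. u \<le> g i x} * prob {x. \<forall>i\<in>I. g i x < u - d})"
    by (simp add: UA mult_ac)
  also have "\<dots> \<le> (1 / (c * \<phi>) + q / \<phi>\<^sup>2) *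
      (real n * (c * exp (- ((real n * d / 4)\<^sup>2 / 2)) + exp (- ((d / 4)\<^sup>2 / 2))))"
    unfolding c_def by (rule mult_left_mono[OF max_concentration[OF I g d n] X[unfolded c_def]])
  finally show ?thesis by (simp add: c_def q_def)
qed

end


text \<open>
  The numerical balance: with \<open>s\<^sup>2 = 2 ln N\<close> the concentration step gains a power \<open>N powr (- \<eta>\<^sup>2 / 16)\<close>,
  which exceeds the loss \<open>N powr (\<eta>\<^sup>2 / 100)\<close> in the second moment caused by correlations of size
  \<open>\<epsilon> = \<eta>\<^sup>2 / 200\<close>.
\<close>

lemma max_lower_bound_numerics:
  fixes \<eta> :: real and n N :: nat
  assumes \<eta>: "0 < \<eta>" "\<eta> < 1" and n: "8 \<le> real n * \<eta>" and N: "N \<ge> 1"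
  defines "s \<equiv> sqrt (2 * ln (real N))"
  defines "u \<equiv> (1 - \<eta>) * s" and "d \<equiv> \<eta> * s" and "\<epsilon> \<equiv> \<eta>\<^sup>2 / 200"
  defines "\<phi> \<equiv> std_normal_density (u + 1)"
  shows "(1 / (real N * \<phi>) + exp (- (u\<^sup>2 / (1 + \<epsilon>))) / \<phi>\<^sup>2) *
      (real n * (real N * exp (- ((real n * d / 4)\<^sup>2 / 2)) + exp (- ((d / 4)\<^sup>2 / 2))))
    \<le> 24 * real n * exp (2 * s + 1 - 3 / 4 * (\<eta>\<^sup>2 / 16) * ln (real N))"
proof -
  define c where "c = \<eta>\<^sup>2 / 16"
  define L where "L = ln (real N)"
  have L: "L \<ge> 0" using N by (simp add: L_def)
  have NL: "real N = exp L" using N by (simp add: L_def)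
  have s2: "s\<^sup>2 = 2 * L" and s0: "s \<ge> 0" using L by (simp_all add: s_def L_def)
  have u0: "0 \<le> u" "u \<le> s" using \<eta> s0 by (auto simp: u_def mult_left_le_one_le)
  have u2: "u\<^sup>2 \<le> 2 * L" using power_mono[OF u0(2,1), of 2] s2 by simp
  have \<epsilon>: "\<epsilon> > 0" using \<eta> by (simp add: \<epsilon>_def)
  have c: "0 \<le> c" "c \<le> 1" using \<eta> by (auto simp: c_def power_le_one intro: order_trans[of _ 1])
  define K where "K = sqrt (2 * pi)"
  have K: "0 \<le> K" "K \<le> 3"
    using pi_less_4 pi_gt_zero by (auto simp: K_def intro!: real_le_lsqrt)
  have \<phi>_inv: "1 / \<phi> = K * exp ((u + 1)\<^sup>2 / 2)"
    by (simp add: \<phi>_def std_normal_density_def K_def exp_minus field_simps)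
  have first: "1 / (real N * \<phi>) \<le> 3 * exp (c / 4 * L + 2 * s + 1)"
  proof -
    have "1 / (real N * \<phi>) = exp (- L) * (1 / \<phi>)" by (simp add: NL exp_minus field_simps)
    also have "\<dots> = K * exp ((u + 1)\<^sup>2 / 2 - L)" unfolding \<phi>_inv by (simp flip: exp_add)
    also have "\<dots> \<le> 3 * exp (c / 4 * L + 2 * s + 1)"
    proof (intro mult_mono K)
      have "(u + 1)\<^sup>2 / 2 - L = (u\<^sup>2 - 2 * L) / 2 + u + 1 / 2" by (simp add: power2_sum field_simps)
      also have "\<dots> \<le> 0 + 2 * s + 1"
      proof -
        have "u + 1 / 2 \<le> 2 * s + 1" using u0 s0 by linarith
        moreover have "(u\<^sup>2 - 2 * L) / 2 \<le> 0" using u2 by simp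
        ultimately show ?thesis by (metis add.assoc add_mono)
      qed
      also have "\<dots> \<le> c / 4 * L + 2 * s + 1" using c L by (intro add_mono) auto
      finally show "exp ((u + 1)\<^sup>2 / 2 - L) \<le> exp (c / 4 * L + 2 * s + 1)" by simp
    qed auto
    finally show ?thesis .
  qed
  have second: "exp (- (u\<^sup>2 / (1 + \<epsilon>))) / \<phi>\<^sup>2 \<le> 9 * exp (c / 4 * L + 2 * s + 1)"
  proof -
    have "exp (- (u\<^sup>2 / (1 + \<epsilon>))) / \<phi>\<^sup>2 = exp (- (u\<^sup>2 / (1 + \<epsilon>))) * (1 / \<phi>)\<^sup>2"
      by (simp add: power_divide)
    also have "\<dots> = K\<^sup>2 * exp ((u + 1)\<^sup>2 - u\<^sup>2 / (1 + \<epsilon>))"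
      unfolding \<phi>_inv by (simp add: power_mult_distrib flip: exp_add exp_double)
    also have "\<dots> \<le> 9 * exp (c / 4 * L + 2 * s + 1)"
    proof (intro mult_mono)
      show "K\<^sup>2 \<le> 9" using power_mono[OF K(2,1), of 2] by simp
      have "u\<^sup>2 * (1 - \<epsilon>) \<le> u\<^sup>2 / (1 + \<epsilon>)"
      proof -
        have "(1 - \<epsilon>) * (1 + \<epsilon>) \<le> 1" by (simp add: algebra_simps)
        then have "1 - \<epsilon> \<le> 1 / (1 + \<epsilon>)" using \<epsilon> by (simp add: field_simps)
        from mult_left_mono[OF this, of "u\<^sup>2"] show ?thesis by simp
      qed
      then have "(u + 1)\<^sup>2 - u\<^sup>2 / (1 + \<epsilon>) \<le> \<epsilon> * u\<^sup>2 + 2 * u + 1"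
        by (simp add: power2_sum algebra_simps)
      also have "\<dots> \<le> \<epsilon> * (2 * L) + 2 * s + 1"
        using mult_left_mono[OF u2, of \<epsilon>] \<epsilon> u0 by (intro add_mono) auto
      also have "\<epsilon> * (2 * L) \<le> c / 4 * L"
      proof -
        have "2 * \<epsilon> \<le> c / 4" by (simp add: \<epsilon>_def c_def)
        from mult_right_mono[OF this L] show ?thesis by (simp add: mult_ac)
      qed
      finally show "exp ((u + 1)\<^sup>2 - u\<^sup>2 / (1 + \<epsilon>)) \<le> exp (c / 4 * L + 2 * s + 1)" by simp
    qed auto
    finally show ?thesis .
  qed
  \<comment> \<open>The choice \<open>n \<eta> \<ge> 8\<close> makes the union bound contribute at most \<open>N * exp (- 4 * ln N)\<close>.\<close>
  have third: "real N * exp (- ((real n * d / 4)\<^sup>2 / 2)) + exp (- ((d / 4)\<^sup>2 / 2)) \<le> 2 * exp (- (c * L))"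
  proof -
    have "(real n * d / 4)\<^sup>2 / 2 = (real n * \<eta>)\<^sup>2 * L / 16"
      by (simp add: d_def power_mult_distrib power_divide s2 field_simps)
    also have "\<dots> \<ge> 8\<^sup>2 * L / 16"
      using n L by (intro divide_right_mono mult_right_mono power_mono) auto
    finally have "4 * L \<le> (real n * d / 4)\<^sup>2 / 2" by simp
    moreover have "c * L \<le> 1 * L" using c L by (intro mult_right_mono) auto
    ultimately have "L - (real n * d / 4)\<^sup>2 / 2 \<le> - (c * L)" using L by linarith
    then have "real N * exp (- ((real n * d / 4)\<^sup>2 / 2)) \<le> exp (- (c * L))"
      by (simp add: NL flip: exp_add)
    moreover have "(d / 4)\<^sup>2 / 2 = c * L"
      by (simp add: d_def c_def power_mult_distrib power_divide s2 field_simps)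
    ultimately show ?thesis by simp
  qed
  have pos: "0 \<le> real N * exp (- ((real n * d / 4)\<^sup>2 / 2)) + exp (- ((d / 4)\<^sup>2 / 2))"
    by (intro add_nonneg_nonneg mult_nonneg_nonneg) auto
  have "(1 / (real N * \<phi>) + exp (- (u\<^sup>2 / (1 + \<epsilon>))) / \<phi>\<^sup>2) *
      (real n * (real N * exp (- ((real n * d / 4)\<^sup>2 / 2)) + exp (- ((d / 4)\<^sup>2 / 2))))
    \<le> (12 * exp (c / 4 * L + 2 * s + 1)) * (real n * (2 * exp (- (c * L))))"
  proof (rule mult_mono)
    show "1 / (real N * \<phi>) + exp (- (u\<^sup>2 / (1 + \<epsilon>))) / \<phi>\<^sup>2 \<le> 12 * exp (c / 4 * L + 2 * s + 1)"
      using first second by linarith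
    show "real n * (real N * exp (- ((real n * d / 4)\<^sup>2 / 2)) + exp (- ((d / 4)\<^sup>2 / 2)))
        \<le> real n * (2 * exp (- (c * L)))"
      by (rule mult_left_mono[OF third]) simp
    show "0 \<le> real n * (real N * exp (- ((real n * d / 4)\<^sup>2 / 2)) + exp (- ((d / 4)\<^sup>2 / 2)))"
      using pos by simp
  qed simp
  also have "\<dots> = 24 * real n * exp (2 * s + 1 - 3 / 4 * (\<eta>\<^sup>2 / 16) * ln (real N))"
    by (simp add: c_def[symmetric] L_def[symmetric] field_simps flip: exp_add)
  finally show ?thesis .
qed

context wiener_semigroup
begin

text \<open>
  The times are multiples of a large step \<open>\<tau>\<close>, beyond which all correlations are below \<open>\<epsilon>\<close>. No rate
  of decorrelation is available, so \<open>\<epsilon>\<close> stays fixed while the number of times grows.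
\<close>

lemma prob_max_small_tendsto_0:
  assumes f: "bounded_linear f" "cov f f = 1" and \<eta>: "0 < \<eta>" "\<eta> < 1"
  shows "\<exists>\<tau>\<ge>1. (\<lambda>N. prob {x. \<forall>i\<in>{1..N}. f (T (real i * \<tau>) x)
    < (1 - 2 * \<eta>) * sqrt (2 * ln (real N))}) \<longlonglongrightarrow> 0"
proof -
  define \<epsilon> where "\<epsilon> = \<eta>\<^sup>2 / 200"
  have \<epsilon>: "\<epsilon> > 0" using \<eta> by (simp add: \<epsilon>_def)
  have "eventually (\<lambda>t. cov (\<lambda>x. f (T t x)) f < \<epsilon>) at_top"
    using cov_T_tendsto_0[OF f(1)] \<epsilon> by (rule order_tendstoD)
  then obtain \<tau>0 where \<tau>0: "\<And>t. t \<ge> \<tau>0 \<Longrightarrow> cov (\<lambda>x. f (T t x)) f < \<epsilon>"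
    unfolding eventually_at_top_linorder by blast
  define \<tau> where "\<tau> = max 1 \<tau>0"
  have \<tau>: "\<tau> \<ge> 1" by (simp add: \<tau>_def)
  obtain n :: nat where n: "8 / \<eta> \<le> real n" using real_arch_simple by blast
  then have n8: "8 \<le> real n * \<eta>" using \<eta> by (simp add: field_simps)
  have n1: "n \<ge> 1" using n8 by (cases n) auto
  define g where "g i x = f (T (real i * \<tau>) x)" for i :: nat and x
  have bl: "bounded_linear (g i)" for i unfolding g_def[abs_def] by (rule bounded_linear_T[OF f(1)])
  have var: "cov (g i) (g i) = 1" for i
    unfolding g_def[abs_def] using \<tau> f(2) by (subst cov_T[OF f(1) f(1)]) auto
  have corr_less: "cov (g i) (g j) \<le> \<epsilon>" if "j < i" for i j
  proof -
    define h where "h x = f (T (real (i - j) * \<tau>) x)" for x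
    have h: "bounded_linear h" unfolding h_def[abs_def] by (rule bounded_linear_T[OF f(1)])
    have "real i * \<tau> = real (i - j) * \<tau> + real j * \<tau>"
      using that by (simp add: of_nat_diff algebra_simps)
    then have "g i = (\<lambda>x. h (T (real j * \<tau>) x))"
      using T_add[of "real (i - j) * \<tau>" "real j * \<tau>"] \<tau> by (simp add: g_def h_def fun_eq_iff)
    then have "cov (g i) (g j) = cov h f"
      using cov_T[OF h f(1), of "real j * \<tau>"] \<tau> by (simp add: g_def[abs_def])
    moreover have "\<tau>0 \<le> real (i - j) * \<tau>"
    proof -
      have "1 * \<tau> \<le> real (i - j) * \<tau>" using that \<tau> by (intro mult_right_mono) auto
      then show ?thesis by (simp add: \<tau>_def)
    qed
    ultimately show ?thesis using \<tau>0 by (simp add: h_def[abs_def] less_imp_le)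
  qed
  have corr: "cov (g i) (g j) \<le> \<epsilon>" if "i \<noteq> j" for i j
    using corr_less[of i j] corr_less[of j i] that
    by (cases "j < i") (auto simp: cov_def mult.commute)
  have stat: "prob {x. u \<le> g i x} = prob {x. u \<le> f x}" for i u
  proof -
    have "{x \<in> space borel. u \<le> f x} \<in> sets borel"
      using bounded_linear_measurable[OF f(1)] by measurable
    then show ?thesis
      using prob_T[of "real i * \<tau>" "{x. u \<le> f x}"] \<tau> by (simp add: g_def)
  qed
  have bound: "prob {x. \<forall>i\<in>{1..N}. f (T (real i * \<tau>) x) < (1 - 2 * \<eta>) * sqrt (2 * ln (real N))}
      \<le> 24 * real n * exp (2 * sqrt (2 * ln (real N)) + 1 - 3 / 4 * (\<eta>\<^sup>2 / 16) * ln (real N))"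
    if N: "N \<ge> 2" for N :: nat
  proof -
    define s where "s = sqrt (2 * ln (real N))"
    have s: "s > 0" using N by (simp add: s_def)
    have "prob {x. \<forall>i\<in>{1..N}. g i x < (1 - \<eta>) * s - \<eta> * s}
      \<le> (1 / (real (card {1..N}) * std_normal_density ((1 - \<eta>) * s + 1))
          + exp (- (((1 - \<eta>) * s)\<^sup>2 / (1 + \<epsilon>))) / (std_normal_density ((1 - \<eta>) * s + 1))\<^sup>2) *
        (real n * (real (card {1..N}) * exp (- ((real n * (\<eta> * s) / 4)\<^sup>2 / 2))
          + exp (- ((\<eta> * s / 4)\<^sup>2 / 2))))"
      by (rule max_lower_bound[OF _ _ bl var corr \<epsilon> stat _ _ n1]) (use N s \<eta> in auto)
    also have "\<dots> \<le> 24 * real n * exp (2 * s + 1 - 3 / 4 * (\<eta>\<^sup>2 / 16) * ln (real N))"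
      using max_lower_bound_numerics[OF \<eta> n8, of N] N by (simp add: s_def \<epsilon>_def)
    finally show ?thesis by (simp add: g_def s_def algebra_simps)
  qed
  have lim: "(\<lambda>N. 24 * real n * exp (2 * sqrt (2 * ln (real N)) + 1 - 3 / 4 * (\<eta>\<^sup>2 / 16) * ln (real N)))
      \<longlonglongrightarrow> 0"
  proof -
    have "(\<lambda>N. A * exp (2 * sqrt (2 * ln (real N)) + 1 - c * ln (real N))) \<longlonglongrightarrow> 0" if "c > 0" for A c :: real
      using that by real_asymp
    from this[of "3 / 4 * (\<eta>\<^sup>2 / 16)"] \<eta> show ?thesis by simp
  qed
  have "(\<lambda>N. prob {x. \<forall>i\<in>{1..N}. f (T (real i * \<tau>) x)
    < (1 - 2 * \<eta>) * sqrt (2 * ln (real N))}) \<longlonglongrightarrow> 0"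
  proof (rule tendsto_sandwich[OF _ _ tendsto_const lim])
    show "eventually (\<lambda>N. prob {x. \<forall>i\<in>{1..N}. f (T (real i * \<tau>) x) < (1 - 2 * \<eta>) * sqrt (2 * ln (real N))}
      \<le> 24 * real n * exp (2 * sqrt (2 * ln (real N)) + 1 - 3 / 4 * (\<eta>\<^sup>2 / 16) * ln (real N))) sequentially"
      using eventually_ge_at_top[of 2] by eventually_elim (rule bound)
  qed simp
  then show ?thesis using \<tau> by blast
qed

text \<open>
  Events whose probabilities tend to one occur infinitely often almost surely. The times at which
  the growing level is reached tend to infinity, since finitely many values are bounded.
\<close>

lemma frequently_functional_ge:
  assumes f: "bounded_linear f" "cov f f = 1" and \<eta>: "0 < \<eta>" "\<eta> < 1 / 3"
  shows "AE x in \<mu>. frequently (\<lambda>t. 1 - 3 * \<eta> \<le> f (traj x t)) at_top"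
proof -
  obtain \<tau> where \<tau>: "\<tau> \<ge> 1" and lim: "(\<lambda>N. prob {x. \<forall>i\<in>{1..N}. f (T (real i * \<tau>) x)
      < (1 - 2 * \<eta>) * sqrt (2 * ln (real N))}) \<longlonglongrightarrow> 0"
    using prob_max_small_tendsto_0[OF f, of \<eta>] \<eta> by auto
  define s where "s N = sqrt (2 * ln (real N))" for N :: nat
  define E where "E N = {x. \<forall>i\<in>{1..N}. f (T (real i * \<tau>) x) < (1 - 2 * \<eta>) * s N}" for N :: nat
  have E: "E N \<in> events" for N
  proof -
    have "E N = (\<Inter>i\<in>{1..N}. {x \<in> space \<mu>. f (T (real i * \<tau>) x) < (1 - 2 * \<eta>) * s N}) \<inter> space \<mu>"
      by (auto simp: E_def)
    also have "\<dots> \<in> events"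
      using bl_measurable[OF bounded_linear_T[OF f(1)]]
      by (cases "N = 0") (auto intro!: sets.finite_INT borel_measurable_less)
    finally show ?thesis .
  qed
  have "AE x in \<mu>. \<exists>N\<ge>n0. x \<notin> E N" for n0
  proof -
    have I: "(\<Inter>N\<in>{n0..}. E N) \<in> events" using E by (intro sets.countable_INT') auto
    have "prob (\<Inter>N\<in>{n0..}. E N) \<le> 0"
    proof (rule LIMSEQ_le_const[OF lim])
      have "prob (\<Inter>N\<in>{n0..}. E N) \<le> prob (E N)" if "N \<ge> n0" for N
        by (rule finite_measure_mono) (use that E in auto)
      then show "\<exists>m. \<forall>N\<ge>m. prob (\<Inter>N\<in>{n0..}. E N) \<le> prob {x. \<forall>i\<in>{1..N}. f (T (real i * \<tau>) x)
          < (1 - 2 * \<eta>) * sqrt (2 * ln (real N))}"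
        unfolding E_def s_def by blast
    qed
    then have "prob (\<Inter>N\<in>{n0..}. E N) = 0" using measure_nonneg by (intro antisym) auto
    then have "AE x in \<mu>. x \<notin> (\<Inter>N\<in>{n0..}. E N)" using I by (simp add: prob_eq_0)
    then show ?thesis by eventually_elim auto
  qed
  then have "AE x in \<mu>. \<forall>n0. \<exists>N\<ge>n0. x \<notin> E N" by (simp add: AE_all_countable)
  then show ?thesis
  proof eventually_elim
    case (elim x)
    have "\<exists>t\<ge>t0. 1 - 3 * \<eta> \<le> f (traj x t)" for t0 :: real
    proof -
      \<comment> \<open>The summand \<open>2\<close> keeps \<open>ln t\<close> positive, as \<open>t \<ge> 2\<close>.\<close>
      define J where "J = nat \<lceil>t0\<rceil> + 2"
      define m where "m = Max ((\<lambda>i. f (T (real i * \<tau>) x)) ` {..J})"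
      have sN: "filterlim (\<lambda>N. (1 - 2 * \<eta>) * s N) at_top sequentially"
      proof -
        have "filterlim (\<lambda>N. c * sqrt (2 * ln (real N))) at_top sequentially" if "c > 0" for c :: real
          using that by real_asymp
        then show ?thesis unfolding s_def using \<eta> by simp
      qed
      have ev1: "eventually (\<lambda>N. m < (1 - 2 * \<eta>) * s N) sequentially"
        using sN by (simp add: filterlim_at_top_dense)
      have ev2: "eventually (\<lambda>N. (1 - 3 * \<eta>) * sqrt (2 * ln (real N * \<tau>)) \<le> (1 - 2 * \<eta>) * s N) sequentially"
      proof -
        have D: "(1 - 3 * \<eta>)\<^sup>2 < (1 - 2 * \<eta>)\<^sup>2" using \<eta> by (intro power_strict_mono) auto
        have "eventually (\<lambda>N. b \<le> a * ln (real N)) sequentially" if "a > 0" for a b :: real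
          using that by real_asymp
        from this[of "(1 - 2 * \<eta>)\<^sup>2 - (1 - 3 * \<eta>)\<^sup>2" "(1 - 3 * \<eta>)\<^sup>2 * ln \<tau>"] D
        have "eventually (\<lambda>N. (1 - 3 * \<eta>)\<^sup>2 * ln \<tau>
            \<le> ((1 - 2 * \<eta>)\<^sup>2 - (1 - 3 * \<eta>)\<^sup>2) * ln (real N)) sequentially" by simp
        then show ?thesis
          using eventually_ge_at_top[of 1]
        proof eventually_elim
          case (elim N)
          have ln: "ln (real N * \<tau>) = ln (real N) + ln \<tau>" using elim \<tau> by (simp add: ln_mult)
          have lnN: "0 \<le> ln (real N)" "0 \<le> ln (real N * \<tau>)" using elim \<tau> by (simp_all add: ln)
          show ?case
          proof (rule power2_le_imp_le)
            have "(1 - 3 * \<eta>)\<^sup>2 * (2 * ln (real N * \<tau>)) \<le> (1 - 2 * \<eta>)\<^sup>2 * (2 * ln (real N))"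
              unfolding ln using elim(1) by (simp add: algebra_simps)
            then show "((1 - 3 * \<eta>) * sqrt (2 * ln (real N * \<tau>)))\<^sup>2 \<le> ((1 - 2 * \<eta>) * s N)\<^sup>2"
              using lnN by (simp add: power_mult_distrib s_def)
          qed (use lnN \<eta> in \<open>simp add: s_def\<close>)
        qed
      qed
      obtain n0 where n0: "\<And>N. N \<ge> n0 \<Longrightarrow> m < (1 - 2 * \<eta>) * s N
          \<and> (1 - 3 * \<eta>) * sqrt (2 * ln (real N * \<tau>)) \<le> (1 - 2 * \<eta>) * s N"
        using eventually_conj[OF ev1 ev2] unfolding eventually_sequentially by blast
      obtain N where N: "N \<ge> n0" "x \<notin> E N" using elim by blast
      then obtain i where i: "i \<in> {1..N}" "(1 - 2 * \<eta>) * s N \<le> f (T (real i * \<tau>) x)"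
        by (auto simp: E_def not_less)
      have "i > J"
      proof (rule ccontr)
        assume "\<not> i > J"
        then have "f (T (real i * \<tau>) x) \<le> m" unfolding m_def by (intro Max_ge) auto
        then show False using n0[OF N(1)] i(2) by simp
      qed
      define t where "t = real i * \<tau>"
      have "real i \<ge> t0 + 1" "real i \<ge> 2" using \<open>i > J\<close> unfolding J_def by linarith+
      moreover have "real i * 1 \<le> t" unfolding t_def using \<tau> by (intro mult_left_mono) auto
      ultimately have t: "t \<ge> t0" "t \<ge> 2" by auto
      have tN: "t \<le> real N * \<tau>" unfolding t_def using i(1) \<tau> by (intro mult_right_mono) auto
      have "(1 - 3 * \<eta>) * sqrt (2 * ln t) \<le> (1 - 3 * \<eta>) * sqrt (2 * ln (real N * \<tau>))"
        using t tN \<eta> by (intro mult_left_mono) auto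
      also have "\<dots> \<le> f (T t x)" using n0[OF N(1)] i(2) by (simp add: t_def)
      finally have "(1 - 3 * \<eta>) * sqrt (2 * ln t) \<le> f (T t x)" .
      moreover have "f (traj x t) = f (T t x) / sqrt (2 * ln t)"
        using linear_scale[OF bounded_linear.linear[OF f(1)]]
        by (simp add: traj_def divide_inverse mult.commute)
      moreover have "sqrt (2 * ln t) > 0" using t by simp
      ultimately have "1 - 3 * \<eta> \<le> f (traj x t)" by (simp add: pos_le_divide_eq)
      then show ?thesis using t by blast
    qed
    then show ?case
      unfolding frequently_def eventually_at_top_linorder by auto
  qed
qed

end

section \<open>Cluster points\<close>

lemma frequently_at_top_sequence:
  fixes t :: "nat \<Rightarrow> 'a::linorder"
  assumes t: "filterlim t at_top sequentially" and P: "eventually (\<lambda>n. P (t n)) sequentially"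
  shows "frequently P at_top"
  unfolding frequently_def
proof
  assume "eventually (\<lambda>s. \<not> P s) at_top"
  then have "eventually (\<lambda>n. \<not> P (t n)) sequentially"
    using t by (rule eventually_compose_filterlim)
  with P have "eventually (\<lambda>n. False) sequentially" by eventually_elim simp
  then show False by simp
qed

lemma cluster_point_iff_frequently:
  "y \<in> cluster_points_at_infinity {b<..} \<gamma> \<longleftrightarrow> (\<forall>e>0. frequently (\<lambda>t. norm (\<gamma> t - y) < e) at_top)"
proof
  assume "y \<in> cluster_points_at_infinity {b<..} \<gamma>"
  then obtain t where t: "filterlim t at_top sequentially" "(\<lambda>n. norm (\<gamma> (t n) - y)) \<longlonglongrightarrow> 0"
    by (auto simp: cluster_points_at_infinity_def)
  show "\<forall>e>0. frequently (\<lambda>t. norm (\<gamma> t - y) < e) at_top"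
  proof (intro allI impI)
    fix e :: real assume "e > 0"
    with t(2) have "eventually (\<lambda>n. norm (\<gamma> (t n) - y) < e) sequentially"
      by (rule order_tendstoD)
    then show "frequently (\<lambda>t. norm (\<gamma> t - y) < e) at_top"
      by (rule frequently_at_top_sequence[OF t(1)])
  qed
next
  assume fr: "\<forall>e>0. frequently (\<lambda>t. norm (\<gamma> t - y) < e) at_top"
  have ex: "\<exists>t>T0. norm (\<gamma> t - y) < e" if "e > 0" for T0 e
  proof -
    have "frequently (\<lambda>t. norm (\<gamma> t - y) < e \<and> t > T0) at_top"
      using fr that by (intro frequently_eventually_frequently eventually_gt_at_top) auto
    then show ?thesis by (auto dest: frequently_ex)
  qed
  have "\<exists>t :: nat \<Rightarrow> real. \<forall>n. (b < t n \<and> real n < t n \<and> norm (\<gamma> (t n) - y) < 1 / (real n + 1)) \<and> t n \<le> t (Suc n)"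
  proof (rule dependent_nat_choice)
    show "\<exists>s. b < s \<and> real 0 < s \<and> norm (\<gamma> s - y) < 1 / (real 0 + 1)"
      using ex[of 1 "max b 0"] by auto
    fix s n assume "b < s \<and> real n < s \<and> norm (\<gamma> s - y) < 1 / (real n + 1)"
    obtain s' where "s' > max (max b s) (real (Suc n))" "norm (\<gamma> s' - y) < 1 / (real (Suc n) + 1)"
      using ex[of "1 / (real (Suc n) + 1)" "max (max b s) (real (Suc n))"] by auto
    then show "\<exists>s'. (b < s' \<and> real (Suc n) < s' \<and> norm (\<gamma> s' - y) < 1 / (real (Suc n) + 1)) \<and> s \<le> s'"
      by (intro exI[of _ s']) auto
  qed
  then obtain t :: "nat \<Rightarrow> real" where t: "\<And>n. b < t n" "\<And>n. real n < t n"
      "\<And>n. norm (\<gamma> (t n) - y) < 1 / (real n + 1)" "\<And>n. t n \<le> t (Suc n)"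
    by blast
  have "filterlim t at_top sequentially"
    by (rule filterlim_at_top_mono[OF filterlim_real_sequentially])
      (intro always_eventually allI less_imp_le t(2))
  moreover have "(\<lambda>n. norm (\<gamma> (t n) - y)) \<longlonglongrightarrow> 0"
  proof (rule tendsto_sandwich[where f="\<lambda>_. 0"])
    show "(\<lambda>n. 1 / (real n + 1)) \<longlonglongrightarrow> 0" by real_asymp
  qed (use t(3) in \<open>auto intro!: always_eventually less_imp_le\<close>)
  moreover have "incseq t" by (rule incseq_SucI) (rule t(4))
  ultimately show "y \<in> cluster_points_at_infinity {b<..} \<gamma>"
    using t(1) unfolding cluster_points_at_infinity_def by blast
qed

lemma closed_cluster_points: "closed (cluster_points_at_infinity {b<..} \<gamma>)"
  unfolding closed_sequential_limits
proof (intro allI impI, elim conjE)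
  fix y l assume y: "\<forall>n. y n \<in> cluster_points_at_infinity {b<..} \<gamma>" and lim: "y \<longlonglongrightarrow> l"
  show "l \<in> cluster_points_at_infinity {b<..} \<gamma>"
    unfolding cluster_point_iff_frequently
  proof (intro allI impI)
    fix e :: real assume e: "e > 0"
    obtain n where n: "norm (y n - l) < e / 2"
      using LIMSEQ_D[OF lim, of "e / 2"] e by auto
    have "frequently (\<lambda>t. norm (\<gamma> t - y n) < e / 2) at_top"
      using y half_gt_zero[OF e] unfolding cluster_point_iff_frequently by blast
    then show "frequently (\<lambda>t. norm (\<gamma> t - l) < e) at_top"
    proof (rule frequently_elim1)
      fix t assume "norm (\<gamma> t - y n) < e / 2"
      moreover have "norm (\<gamma> t - l) \<le> norm (\<gamma> t - y n) + norm (y n - l)"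
        using norm_triangle_ineq[of "\<gamma> t - y n" "y n - l"] by simp
      ultimately show "norm (\<gamma> t - l) < e" using n by simp
    qed
  qed
qed

lemma cluster_pointI_sequence:
  assumes t: "filterlim t at_top sequentially" and lim: "(\<lambda>n. \<gamma> (t n)) \<longlonglongrightarrow> y"
  shows "y \<in> cluster_points_at_infinity {b<..} \<gamma>"
  unfolding cluster_point_iff_frequently
proof (intro allI impI)
  fix e :: real assume e: "e > 0"
  have "eventually (\<lambda>n. norm (\<gamma> (t n) - y) < e) sequentially"
    using tendstoD[OF lim e] by (simp add: dist_norm)
  then show "frequently (\<lambda>t. norm (\<gamma> t - y) < e) at_top"
    by (rule frequently_at_top_sequence[OF t])
qed

lemma countable_dense_subset_exists:
  fixes A :: "'a::second_countable_topology set"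
  shows "\<exists>B. countable B \<and> B \<subseteq> A \<and> A \<subseteq> closure B"
proof -
  obtain \<B> :: "'a set set" where \<B>: "countable \<B>" "topological_basis \<B>"
    using ex_countable_basis by blast
  define B where "B = (\<lambda>V. SOME a. a \<in> V \<inter> A) ` {V \<in> \<B>. V \<inter> A \<noteq> {}}"
  have pick: "(SOME a. a \<in> V \<inter> A) \<in> V \<inter> A" if "V \<inter> A \<noteq> {}" for V
    by (rule someI_ex) (use that in blast)
  have "countable B" using \<B>(1) by (auto simp: B_def)
  moreover have "B \<subseteq> A" using pick by (auto simp: B_def)
  moreover have "A \<subseteq> closure B"
  proof
    fix x assume x: "x \<in> A"
    show "x \<in> closure B"
      unfolding closure_iff_nhds_not_empty
    proof (intro allI impI)
      fix U V assume UV: "V \<subseteq> U" "open V" "x \<in> V"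
      obtain W where W: "W \<in> \<B>" "x \<in> W" "W \<subseteq> V"
        using topological_basisE[OF \<B>(2) UV(2,3)] by blast
      then have ne: "W \<inter> A \<noteq> {}" using x by blast
      then have "(SOME a. a \<in> W \<inter> A) \<in> B" using W(1) by (auto simp: B_def)
      then show "B \<inter> U \<noteq> {}" using pick[OF ne] W(3) UV(1) by blast
    qed
  qed
  ultimately show ?thesis by blast
qed

section \<open>The law of the iterated logarithm\<close>

context wiener_semigroup
begin

abbreviation clusters :: "'a \<Rightarrow> 'a set" where
  "clusters x \<equiv> cluster_points_at_infinity {1<..} (traj x)"

text \<open>
  Along times where \<open>f\<close> nearly attains its largest possible value \<open>1\<close> on the unit ball, relative
  compactness produces a limit in the unit ball on which \<open>f\<close> is at least \<open>1\<close>. By the equality case of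
  the Cauchy-Schwarz inequality, the Riesz vector of \<open>f\<close> is the only such point.
\<close>

lemma riesz_is_cluster_point:
  assumes f: "bounded_linear f" "cov f f = 1"
  shows "AE x in \<mu>. \<iota> (riesz f) \<in> clusters x"
proof -
  have "AE x in \<mu>. \<forall>m::nat. frequently (\<lambda>t. 1 - 3 * (1 / (real m + 4)) \<le> f (traj x t)) at_top"
    unfolding AE_all_countable
    by (intro allI frequently_functional_ge[OF f]) (auto simp: field_simps)
  with limits_in_unit_ball trajectories_relatively_compact show ?thesis
  proof eventually_elim
    case (elim x)
    have "\<exists>t>real m. 1 - 3 * (1 / (real m + 4)) \<le> f (traj x t)" for m :: nat
    proof -
      have "frequently (\<lambda>t. 1 - 3 * (1 / (real m + 4)) \<le> f (traj x t) \<and> t > real m) at_top"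
        using elim(3) by (intro frequently_eventually_frequently eventually_gt_at_top) auto
      then show ?thesis by (auto dest: frequently_ex)
    qed
    then obtain t where t: "\<And>m. real m < t m" "\<And>m. 1 - 3 * (1 / (real m + 4)) \<le> f (traj x (t m))"
      by metis
    have tt: "filterlim t at_top sequentially"
      by (rule filterlim_at_top_mono[OF filterlim_real_sequentially])
        (intro always_eventually allI less_imp_le t(1))
    then obtain r y where r: "strict_mono r" "(\<lambda>n. traj x (t (r n))) \<longlonglongrightarrow> y" using elim(2) by blast
    have tr: "filterlim (\<lambda>n. t (r n)) at_top sequentially"
      by (rule filterlim_compose[OF tt filterlim_subseq[OF r(1)]])
    then have "y \<in> \<iota> ` cball 0 1" using elim(1) r(2) by blast
    then obtain k where k: "norm k \<le> 1" "y = \<iota> k" by auto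
    have "1 \<le> f y"
    proof (rule LIMSEQ_le)
      have "(\<lambda>m. 1 - 3 * (1 / (real m + 4))) \<longlonglongrightarrow> 1" by real_asymp
      then show "(\<lambda>n. 1 - 3 * (1 / (real (r n) + 4))) \<longlonglongrightarrow> 1"
        by (rule LIMSEQ_subseq_LIMSEQ[OF _ r(1), unfolded comp_def])
      show "(\<lambda>n. f (traj x (t (r n)))) \<longlonglongrightarrow> f y" by (rule bounded_linear.tendsto[OF f(1) r(2)])
    qed (use t(2) in blast)
    then have inner: "1 \<le> riesz f \<bullet> k" by (simp add: riesz_inner[OF f(1)] k(2))
    have "(norm (riesz f - k))\<^sup>2 = (norm (riesz f))\<^sup>2 - 2 * (riesz f \<bullet> k) + (norm k)\<^sup>2"
      by (simp add: power2_norm_eq_inner inner_diff_left inner_diff_right inner_commute)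
    also have "\<dots> \<le> 1 - 2 * 1 + 1\<^sup>2"
      using norm_riesz[OF f(1)] f(2) inner k(1) by (intro add_mono diff_mono power_mono) auto
    finally have "riesz f = k" by simp
    then show ?case using cluster_pointI_sequence[OF tr r(2)] k(2) by simp
  qed
qed

lemma unit_riesz_dense:
  assumes h: "norm h = 1" and e: "e > 0"
  shows "\<exists>f. bounded_linear f \<and> cov f f = 1 \<and> norm (\<iota> (riesz f) - \<iota> h) < e"
proof -
  interpret I: bounded_linear \<iota> by (rule embedding)
  obtain K where K: "K > 0" "\<And>x. norm (\<iota> x) \<le> norm x * K" using I.pos_bounded by blast
  define d where "d = min (1 / 2) (e / (2 * K))"
  have d: "d > 0" "d < 1" "2 * d * K \<le> e"
    using e K by (auto simp: d_def min_def field_simps)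
  obtain f0 where f0: "bounded_linear f0" "norm (riesz f0 - h) < d" using riesz_dense[OF d(1)] by blast
  define a where "a = norm (riesz f0)"
  have a1: "\<bar>a - 1\<bar> < d" using norm_triangle_ineq3[of "riesz f0" h] f0(2) h by (simp add: a_def)
  then have a: "a > 0" using d by auto
  define f where "f x = (1 / a) * f0 x + 0 * f0 x" for x
  have f: "bounded_linear f" unfolding f_def[abs_def] by (rule bounded_linear_lincomb[OF f0(1) f0(1)])
  have rf: "riesz f = (1 / a) *\<^sub>R riesz f0"
    unfolding f_def[abs_def] riesz_lincomb[OF f0(1) f0(1)] by simp
  have "norm (riesz f) = 1" unfolding rf using a by (simp add: a_def)
  then have cov: "cov f f = 1" using norm_riesz[OF f] by simp
  have "riesz f - riesz f0 = (1 / a - 1) *\<^sub>R riesz f0" by (simp add: rf scaleR_diff_left)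
  then have "norm (riesz f - riesz f0) = \<bar>1 / a - 1\<bar> * a" by (simp add: a_def)
  also have "\<dots> = \<bar>(1 / a - 1) * a\<bar>" using a by (simp add: abs_mult)
  also have "(1 / a - 1) * a = 1 - a" using a by (simp add: field_simps)
  finally have "norm (riesz f - riesz f0) < d" using a1 by simp
  then have "norm (riesz f - h) < 2 * d"
    using f0(2) norm_triangle_ineq[of "riesz f - riesz f0" "riesz f0 - h"] by simp
  then have "norm (\<iota> (riesz f) - \<iota> h) < 2 * d * K"
    using K(2)[of "riesz f - h"] K(1) by (simp add: I.diff) (smt (verit) mult_strict_right_mono)
  then show ?thesis using f cov d(3) by (intro exI[of _ f]) auto
qed

lemma unit_sphere_in_cluster_set:
  "AE x in \<mu>. \<forall>h. norm h = 1 \<longrightarrow> \<iota> h \<in> clusters x"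
proof -
  define A where "A = {\<iota> (riesz f) | f. bounded_linear f \<and> cov f f = 1}"
  obtain B where B: "countable B" "B \<subseteq> A" "A \<subseteq> closure B"
    using countable_dense_subset_exists[of A] by (elim exE conjE)
  have "AE x in \<mu>. \<forall>b\<in>B. b \<in> clusters x"
    unfolding AE_ball_countable[OF B(1)] using B(2) riesz_is_cluster_point by (auto simp: A_def)
  then show ?thesis
  proof eventually_elim
    case (elim x)
    then have "closure B \<subseteq> clusters x"
      by (intro closure_minimal closed_cluster_points) auto
    then have cA: "closure A \<subseteq> clusters x"
      using B(3) by (intro closure_minimal closed_cluster_points) auto
    have "\<iota> h \<in> closure A" if h: "norm h = 1" for h
      unfolding closure_approachable
      using unit_riesz_dense[OF h] by (fastforce simp: A_def dist_norm)
    then show ?case using cA by blast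
  qed
qed

text \<open>
  A vector \<open>h\<close> of the ball is the weak limit of the unit vectors \<open>h + c t *\<^sub>R adjoint (S t) k\<close>. Their
  images are cluster points, and relative compactness turns weak convergence into convergence in
  norm.
\<close>

lemma unit_ball_from_unit_sphere:
  fixes h k :: 'h
  assumes sphere: "\<And>h. norm h = 1 \<Longrightarrow> \<iota> h \<in> clusters x"
    and comp: "\<And>t. filterlim t at_top sequentially \<Longrightarrow>
      \<exists>r y. strict_mono r \<and> (\<lambda>n. traj x (t (r n))) \<longlonglongrightarrow> y"
    and k: "norm k = 1" and h: "norm h \<le> 1"
  shows "\<iota> h \<in> clusters x"
proof -
  interpret I: bounded_linear \<iota> by (rule embedding)
  define e where "e n = adjoint (S (real n)) k" for n :: nat
  have e1: "norm (e n) = 1" for n using k by (simp add: e_def norm_adjoint)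
  define b where "b n = h \<bullet> e n" for n
  have bb: "\<bar>b n\<bar> \<le> 1" for n
    using Cauchy_Schwarz_ineq2[of h "e n"] h e1 by (simp add: b_def)
  have hh: "0 \<le> 1 - (norm h)\<^sup>2" "1 - (norm h)\<^sup>2 \<le> 1" using h by (auto simp: power_le_one)
  \<comment> \<open>The nonnegative root of \<open>c\<^sup>2 + 2 b c + (norm h)\<^sup>2 = 1\<close>, which makes \<open>h + c e\<close> a unit vector.\<close>
  define c where "c n = sqrt ((b n)\<^sup>2 + (1 - (norm h)\<^sup>2)) - b n" for n
  have c3: "\<bar>c n\<bar> \<le> 3" for n
  proof -
    have "(b n)\<^sup>2 \<le> 1" using bb[of n] by (simp add: abs_square_le_1)
    then have "(b n)\<^sup>2 + (1 - (norm h)\<^sup>2) \<le> 1 + 1" using hh(2) by (rule add_mono)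
    then have "sqrt ((b n)\<^sup>2 + (1 - (norm h)\<^sup>2)) \<le> 2"
      by (intro real_le_lsqrt) auto
    moreover have "0 \<le> sqrt ((b n)\<^sup>2 + (1 - (norm h)\<^sup>2))" using hh by simp
    ultimately show ?thesis using bb[of n] unfolding c_def by linarith
  qed
  have unit: "norm (h + c n *\<^sub>R e n) = 1" for n
  proof -
    have "(norm (h + c n *\<^sub>R e n))\<^sup>2 = (norm h)\<^sup>2 + 2 * c n * b n + (c n)\<^sup>2 * (norm (e n))\<^sup>2"
      unfolding power2_norm_eq_inner b_def
      by (simp add: inner_add_left inner_add_right inner_commute[of "e n" h] power2_eq_square
          distrib_left)
    also have "\<dots> = (c n + b n)\<^sup>2 - (b n)\<^sup>2 + (norm h)\<^sup>2"
      by (simp add: e1 power2_sum)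
    also have "\<dots> = 1" using hh by (simp add: c_def)
    finally show ?thesis by (simp add: power2_eq_1_iff) (smt (verit) norm_ge_zero)
  qed
  have "\<exists>t>real n. norm (traj x t - \<iota> (h + c n *\<^sub>R e n)) < 1 / (real n + 1)" for n
  proof -
    have "frequently (\<lambda>t. norm (traj x t - \<iota> (h + c n *\<^sub>R e n)) < 1 / (real n + 1)) at_top"
      using sphere[OF unit[of n]] unfolding cluster_point_iff_frequently by simp
    then have "frequently (\<lambda>t. norm (traj x t - \<iota> (h + c n *\<^sub>R e n)) < 1 / (real n + 1) \<and> t > real n) at_top"
      by (rule frequently_eventually_frequently) (rule eventually_gt_at_top)
    then show ?thesis by (auto dest: frequently_ex)
  qed
  then obtain t where t: "\<And>n. real n < t n"
      "\<And>n. norm (traj x (t n) - \<iota> (h + c n *\<^sub>R e n)) < 1 / (real n + 1)" by metis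
  have tt: "filterlim t at_top sequentially"
    by (rule filterlim_at_top_mono[OF filterlim_real_sequentially])
        (intro always_eventually allI less_imp_le t(1))
  obtain r y where r: "strict_mono r" "(\<lambda>n. traj x (t (r n))) \<longlonglongrightarrow> y" using comp[OF tt] by blast
  have tr: "filterlim (\<lambda>n. t (r n)) at_top sequentially"
    by (rule filterlim_compose[OF tt filterlim_subseq[OF r(1)]])
  have close: "(\<lambda>n. traj x (t n) - \<iota> (h + c n *\<^sub>R e n)) \<longlonglongrightarrow> 0"
  proof (rule Lim_null_comparison)
    show "(\<lambda>n. 1 / (real n + 1)) \<longlonglongrightarrow> 0" by real_asymp
  qed (use t(2) in \<open>auto intro!: always_eventually less_imp_le\<close>)
  have same: "f y = f (\<iota> h)" if f: "bounded_linear f" for f :: "'a \<Rightarrow> real"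
  proof -
    interpret f: bounded_linear f by (rule f)
    have "(\<lambda>n. S (real n) (riesz f) \<bullet> k) \<longlonglongrightarrow> 0"
      by (rule filterlim_compose[OF weakly_null filterlim_real_sequentially])
    moreover have "S (real n) (riesz f) \<bullet> k = f (\<iota> (e n))" for n
      unfolding S_adjoint e_def by (rule riesz_inner[OF f])
    ultimately have null: "(\<lambda>n. f (\<iota> (e n))) \<longlonglongrightarrow> 0" by (simp only:)
    have "(\<lambda>n. c n * f (\<iota> (e n))) \<longlonglongrightarrow> 0"
    proof (rule Lim_null_comparison)
      show "eventually (\<lambda>n. norm (c n * f (\<iota> (e n))) \<le> 3 * \<bar>f (\<iota> (e n))\<bar>) sequentially"
        unfolding real_norm_def abs_mult
        by (intro always_eventually allI mult_right_mono c3 abs_ge_zero)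
      show "(\<lambda>n. 3 * \<bar>f (\<iota> (e n))\<bar>) \<longlonglongrightarrow> 0"
        by (rule tendsto_mult_right_zero[OF tendsto_rabs_zero[OF null]])
    qed
    then have "(\<lambda>n. f (traj x (t n) - \<iota> (h + c n *\<^sub>R e n)) + f (\<iota> h) + c n * f (\<iota> (e n))) \<longlonglongrightarrow> f 0 + f (\<iota> h) + 0"
      by (intro tendsto_add tendsto_const f.tendsto close)
    then have "(\<lambda>n. f (traj x (t n))) \<longlonglongrightarrow> f (\<iota> h)"
      by (simp add: f.diff f.add f.scaleR f.zero I.add I.scaleR)
    then have "(\<lambda>n. f (traj x (t (r n)))) \<longlonglongrightarrow> f (\<iota> h)"
      by (rule LIMSEQ_subseq_LIMSEQ[OF _ r(1), unfolded comp_def])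
    then show ?thesis by (rule LIMSEQ_unique[OF f.tendsto[OF r(2)]])
  qed
  obtain F :: "nat \<Rightarrow> 'a \<Rightarrow> real" where F: "norming_sequence F" using norming_sequence_exists by blast
  have "y = \<iota> h"
    by (rule norming_sequence_separates[OF F]) (use F same in \<open>auto simp: norming_sequence_def\<close>)
  then show ?thesis using cluster_pointI_sequence[OF tr r(2)] by simp
qed

theorem cluster_set_eq_unit_ball:
  "AE x in \<mu>. clusters x = \<iota> ` cball 0 1"
  using limits_in_unit_ball trajectories_relatively_compact unit_sphere_in_cluster_set
proof eventually_elim
  case (elim x)
  have comp: "\<exists>r y. strict_mono r \<and> (\<lambda>n. traj x (t (r n))) \<longlonglongrightarrow> y"
    if "filterlim t at_top sequentially" for t
    using elim(2) that by blast
  show ?case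
  proof
    show "clusters x \<subseteq> \<iota> ` cball 0 1"
    proof
      fix y assume "y \<in> clusters x"
      then obtain t where "filterlim t at_top sequentially" "(\<lambda>n. norm (traj x (t n) - y)) \<longlonglongrightarrow> 0"
        by (auto simp: cluster_points_at_infinity_def)
      then show "y \<in> \<iota> ` cball 0 1" using elim(1) by (simp add: tendsto_norm_zero_iff LIM_zero_iff)
    qed
    show "\<iota> ` cball 0 1 \<subseteq> clusters x"
    proof (cases "\<exists>k :: 'h. norm k = 1")
      case True
      then obtain k :: 'h where k: "norm k = 1" ..
      show ?thesis using unit_ball_from_unit_sphere[OF _ comp k] elim(3) by auto
    next
      case False
      \<comment> \<open>In the zero space the claim is that a cluster point exists.\<close>
      have zero: "h = 0" for h :: 'h
      proof (rule ccontr)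
        assume "h \<noteq> 0"
        then have "norm (h /\<^sub>R norm h) = 1" by simp
        then show False using False by blast
      qed
      obtain r y where r: "strict_mono r" "(\<lambda>n. traj x (real (r n))) \<longlonglongrightarrow> y"
        using comp[OF filterlim_real_sequentially] by blast
      have tr: "filterlim (\<lambda>n. real (r n)) at_top sequentially"
        by (rule filterlim_compose[OF filterlim_real_sequentially filterlim_subseq[OF r(1)]])
      obtain k where "y = \<iota> k" using elim(1) tr r(2) by blast
      then have "\<iota> h \<in> clusters x" for h
        using cluster_pointI_sequence[OF tr r(2)] zero[of h] zero[of k] by simp
      then show ?thesis by blast
    qed
  qed
qed

end

theorem proposition1p2:
  fixes \<mu> :: "'a::{banach, second_countable_topology} measure"
    and \<iota> :: "'h::{real_inner, banach} \<Rightarrow> 'a"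
    and S :: "real \<Rightarrow> 'h \<Rightarrow>\<^sub>L 'h"
    and T :: "real \<Rightarrow> 'a \<Rightarrow>\<^sub>L 'a"
  assumes "abstract_wiener_space \<mu> \<iota>"
    and "\<And>t u. t \<ge> 0 \<Longrightarrow> u \<ge> 0 \<Longrightarrow> S (t + u) = S t o\<^sub>L S u"
    and "\<And>t x. t \<ge> 0 \<Longrightarrow> S t (adjoint (S t) x) = x"
    and "\<And>x y. ((\<lambda>t. S t x \<bullet> y) \<longlongrightarrow> 0) at_top"
    and "strongly_continuous_semigroup T"
    and "\<And>t x. t \<ge> 0 \<Longrightarrow> T t (\<iota> x) = \<iota> (S t x)"
  shows "AE x in \<mu>. cluster_points_at_infinity {1<..} (\<lambda>t. T t x /\<^sub>R sqrt (2 * ln t))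
    = \<iota> ` cball 0 1"
proof -
  interpret wiener_semigroup \<mu> \<iota> S T
    using assms by (auto simp: wiener_semigroup_def wiener_semigroup_axioms_def)
  show ?thesis using cluster_set_eq_unit_ball by (simp add: traj_def[abs_def])
qed

end
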